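(* Let $K$ be any field and let $E$ be a finite directed graph. Let $d$ be a simple closed path in $E$ and let $T$ be a Chen simple left $L_K(E)$-module. Then the following are equivalent: (1) $\operatorname{Ext}^1_{L_K(E)}(V_{[d^\infty]},T)\neq 0$; (2) $s(d)\in U(T)$.
   Context: A directed graph $E=(E^0,E^1,s,r)$ consists of a set $E^0$ of vertices, a set $E^1$ of edges, and maps $s,r:E^1\to E^0$ (source and range); $E$ is finite if $E^0$ and $E^1$ are finite. A sink is a vertex $w$ with $s^{-1}(w)=\emptyset$. A path of length $n\ge 1$ is a sequence $\alpha=e_1\cdots e_n$ of edges with $r(e_i)=s(e_{i+1})$; $s(\alpha)=s(e_1)$, $r(\alpha)=r(e_n)$; vertices are the paths of length $0$. A path $c$ of length $\ge1$ is closed if $r(c)=s(c)$; a closed path $c$ is simple if $c\ne\beta^m$ for every closed path $\beta$ and integer $m\ge 2$. The Leavitt path algebra $L_K(E)$ is the $K$-algebra generated by $\{v: v\in E^0\}\cup\{e,e^*: e\in E^1\}$ with relations: (V) $vu=\delta_{v,u}v$ for $v,u\in E^0$; (E1) $s(e)e=er(e)=e$; (E2) $r(e)e^*=e^*s(e)=e^*$ for $e\in E^1$; (CK1) $e^*e'=\delta_{e,e'}r(e)$ for $e,e'\in E^1$; (CK2) $v=\sum_{e\in s^{-1}(v)}ee^*$ for every $v\in E^0$ with $0<|s^{-1}(v)|<\infty$. An infinite path is a sequence $p=e_1e_2e_3\cdots$ of edges with $r(e_i)=s(e_{i+1})$ for all $i$; $\tau_{>n}(p)=e_{n+1}e_{n+2}\cdots$.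 For a closed path $c$, $c^\infty=ccc\cdots$. Infinite paths $p,q$ are tail equivalent if $\tau_{>m}(p)=\tau_{>n}(q)$ for some $m,n\ge0$; $[p]$ is the class of $p$. For an infinite path $p$, $V_{[p]}$ is the $K$-vector space with basis $[p]$ and left $L_K(E)$-action determined, for $q=f_1f_2\cdots\in[p]$, $v\in E^0$, $e\in E^1$, by: $v\cdot q=q$ if $v=s(f_1)$ and $0$ otherwise; $e\cdot q=eq$ if $r(e)=s(f_1)$ and $0$ otherwise; $e^*\cdot q=\tau_{>1}(q)$ if $e=f_1$ and $0$ otherwise. For a sink $w$, $V_{[w^\infty]}$ denotes the left ideal $L_K(E)w$ (which has as $K$-basis the finite paths ending in $w$). A Chen simple module is a module $V_{[p]}$ with $p$ an infinite path, or $V_{[w^\infty]}$ with $w$ a sink. For a Chen simple module $T$, $U(T)=\{v\in E^0: vT\ne\{0\}\}$. *)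

theory Defs
  imports
    "HOL-Library.Poly_Mapping"
    "HOL-Library.Stream"
    "HOL-Algebra.Coset"
    "HOL-Algebra.QuotRing"
    "HOL-Algebra.Module"
    "Graph_Theory.Digraph"
    "Graph_Theory.Arc_Walk"
begin

text \<open>
  A directed graph is a \<^typ>\<open>('v, 'e) pre_digraph\<close>: \<^term>\<open>verts E\<close> and \<^term>\<open>arcs E\<close> are
  \<open>E\<^sup>0\<close> and \<open>E\<^sup>1\<close>, and \<^term>\<open>tail E\<close> and \<^term>\<open>head E\<close> are the source and range maps.
\<close>

section \<open>Paths\<close>

definition is_sink :: "('v, 'e) pre_digraph \<Rightarrow> 'v \<Rightarrow> bool" where
  "is_sink E w \<longleftrightarrow> w \<in> verts E \<and> out_arcs E w = {}"

definition closed_path :: "('v, 'e) pre_digraph \<Rightarrow> 'e list \<Rightarrow> bool" where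
  "closed_path E c \<longleftrightarrow> c \<noteq> [] \<and> (\<exists>u. pre_digraph.awalk E u c u)"

definition simple_closed_path :: "('v, 'e) pre_digraph \<Rightarrow> 'e list \<Rightarrow> bool" where
  "simple_closed_path E c \<longleftrightarrow> closed_path E c \<and>
     (\<forall>b m. closed_path E b \<and> m \<ge> 2 \<longrightarrow> c \<noteq> concat (replicate m b))"

definition path_source :: "('v, 'e) pre_digraph \<Rightarrow> 'e list \<Rightarrow> 'v" where
  "path_source E c = tail E (hd c)"

definition infinite_path :: "('v, 'e) pre_digraph \<Rightarrow> 'e stream \<Rightarrow> bool" where
  "infinite_path E p \<longleftrightarrow> (\<forall>i. p !! i \<in> arcs E \<and> head E (p !! i) = tail E (p !! Suc i))"

definition tail_equivalent :: "'e stream \<Rightarrow> 'e stream \<Rightarrow> bool" where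
  "tail_equivalent p q \<longleftrightarrow> (\<exists>m n. sdrop m p = sdrop n q)"

definition tail_class :: "('v, 'e) pre_digraph \<Rightarrow> 'e stream \<Rightarrow> 'e stream set" where
  "tail_class E p = {q. infinite_path E q \<and> tail_equivalent p q}"


section \<open>The Leavitt path algebra\<close>

datatype ('v, 'e) generator = Vertex 'v | Edge 'e | Ghost 'e

text \<open>
  Words form a monoid under concatenation, written additively because \<^typ>\<open>'a \<Rightarrow>\<^sub>0 'b\<close> is the
  monoid ring of an additively written monoid.
\<close>

datatype 'a word = Word (letters: "'a list")

instantiation word :: (type) monoid_add
begin

definition zero_word :: "'a word" where
  "0 = Word []"

definition plus_word :: "'a word \<Rightarrow> 'a word \<Rightarrow> 'a word" where
  "u + v = Word (letters u @ letters v)"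

instance
  by standard (simp_all add: zero_word_def plus_word_def)

end

type_synonym ('v, 'e, 'k) polynomial = "('v, 'e) generator word \<Rightarrow>\<^sub>0 'k"

type_synonym ('v, 'e, 'k) lpa_element = "('v, 'e, 'k) polynomial set"

abbreviation gen :: "('v, 'e) generator \<Rightarrow> ('v, 'e, 'k::field) polynomial" where
  "gen g \<equiv> Poly_Mapping.single (Word [g]) 1"

definition generators :: "('v, 'e) pre_digraph \<Rightarrow> ('v, 'e) generator set" where
  "generators E = Vertex ` verts E \<union> Edge ` arcs E \<union> Ghost ` arcs E"

text \<open>The unital free algebra over the field \<^typ>\<open>'k::field\<close>; its scalars are the multiples of the empty word.\<close>

definition free_algebra :: "('v, 'e) pre_digraph \<Rightarrow> ('v, 'e, 'k::field) polynomial ring" where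
  "free_algebra E =
     \<lparr>carrier = {f. \<forall>w \<in> Poly_Mapping.keys f. set (letters w) \<subseteq> generators E},
      mult = (*), one = 1, zero = 0, add = (+)\<rparr>"

definition lpa_relations :: "('v, 'e) pre_digraph \<Rightarrow> ('v, 'e, 'k::field) polynomial set" where
  "lpa_relations E =
     \<comment> \<open>(V)\<close>
     {gen (Vertex v) * gen (Vertex u) - (if v = u then gen (Vertex v) else 0) | v u.
        v \<in> verts E \<and> u \<in> verts E} \<union>
     \<comment> \<open>(E1)\<close>
     {gen (Vertex (tail E e)) * gen (Edge e) - gen (Edge e) | e. e \<in> arcs E} \<union>
     {gen (Edge e) * gen (Vertex (head E e)) - gen (Edge e) | e. e \<in> arcs E} \<union>
     \<comment> \<open>(E2)\<close>
     {gen (Vertex (head E e)) * gen (Ghost e) - gen (Ghost e) | e. e \<in> arcs E} \<union>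
     {gen (Ghost e) * gen (Vertex (tail E e)) - gen (Ghost e) | e. e \<in> arcs E} \<union>
     \<comment> \<open>(CK1)\<close>
     {gen (Ghost e) * gen (Edge e') - (if e = e' then gen (Vertex (head E e)) else 0) | e e'.
        e \<in> arcs E \<and> e' \<in> arcs E} \<union>
     \<comment> \<open>(CK2)\<close>
     {gen (Vertex v) - (\<Sum>e \<in> out_arcs E v. gen (Edge e) * gen (Ghost e)) | v.
        v \<in> verts E \<and> out_arcs E v \<noteq> {} \<and> finite (out_arcs E v)}"

definition lpa_ideal :: "('v, 'e) pre_digraph \<Rightarrow> ('v, 'e, 'k::field) polynomial set" where
  "lpa_ideal E = genideal (free_algebra E) (lpa_relations E)"

definition lpa_class ::
  "('v, 'e) pre_digraph \<Rightarrow> ('v, 'e, 'k::field) polynomial \<Rightarrow> ('v, 'e, 'k) lpa_element" where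
  "lpa_class E f = a_r_coset (free_algebra E) (lpa_ideal E) f"

text \<open>
  The presentation of \<open>L\<^sub>K(E)\<close> is one of not necessarily unital algebras: the words in the
  generators are nonempty, and the empty word must not contribute an identity of its own.
  So \<open>L\<^sub>K(E)\<close> consists of the classes of polynomials without constant term. (The relations have
  no constant term, hence generate the same ideal in the unital and in the non-unital free
  algebra.) For a finite graph, \<open>L\<^sub>K(E)\<close> is unital and its identity is the sum of the vertices.
\<close>

definition leavitt :: "('v, 'e) pre_digraph \<Rightarrow> ('v, 'e, 'k::field) lpa_element ring" where
  "leavitt E = (free_algebra E Quot lpa_ideal E)
     \<lparr>carrier := lpa_class E ` {f \<in> carrier (free_algebra E). 0 \<notin> Poly_Mapping.keys f},
      one := lpa_class E (\<Sum>v \<in> verts E. gen (Vertex v))\<rparr>"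


section \<open>Chen modules\<close>

text \<open>
  Left modules are \<^typ>\<open>('a, 'b) module\<close> records; the fields \<^const>\<open>mult\<close> and \<^const>\<open>one\<close>, which
  that record inherits from rings, are irrelevant and left unspecified.
\<close>

definition linear_extension ::
  "('a \<Rightarrow> ('b \<Rightarrow>\<^sub>0 'k)) \<Rightarrow> ('a \<Rightarrow>\<^sub>0 'k) \<Rightarrow> ('b \<Rightarrow>\<^sub>0 'k::field)" where
  "linear_extension f x =
     (\<Sum>a \<in> Poly_Mapping.keys x. Poly_Mapping.map (\<lambda>c. Poly_Mapping.lookup x a * c) (f a))"

fun gen_action ::
  "('v, 'e) pre_digraph \<Rightarrow> ('v, 'e) generator \<Rightarrow> 'e stream \<Rightarrow> ('e stream \<Rightarrow>\<^sub>0 'k::field)" where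
  "gen_action E (Vertex v) q =
     (if v = tail E (shd q) then Poly_Mapping.single q 1 else 0)"
| "gen_action E (Edge e) q =
     (if head E e = tail E (shd q) then Poly_Mapping.single (e ## q) 1 else 0)"
| "gen_action E (Ghost e) q =
     (if e = shd q then Poly_Mapping.single (stl q) 1 else 0)"

definition word_action ::
  "('v, 'e) pre_digraph \<Rightarrow> ('v, 'e) generator word \<Rightarrow> ('e stream \<Rightarrow>\<^sub>0 'k)
     \<Rightarrow> ('e stream \<Rightarrow>\<^sub>0 'k::field)" where
  "word_action E w x = foldr (\<lambda>g. linear_extension (gen_action E g)) (letters w) x"

definition poly_action ::
  "('v, 'e) pre_digraph \<Rightarrow> ('v, 'e, 'k) polynomial \<Rightarrow> ('e stream \<Rightarrow>\<^sub>0 'k)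
     \<Rightarrow> ('e stream \<Rightarrow>\<^sub>0 'k::field)" where
  "poly_action E f x = linear_extension (\<lambda>w. word_action E w x) f"

text \<open>
  \<open>V\<^bsub>[p]\<^esub>\<close>. On infinite paths the action of a polynomial depends only on its class \<open>A\<close>, so
  \<open>(\<lambda>f. poly_action E f x) ` A\<close> is a singleton.
\<close>

definition chen_path_module ::
  "('v, 'e) pre_digraph \<Rightarrow> 'e stream
     \<Rightarrow> (('v, 'e, 'k::field) lpa_element, 'e stream \<Rightarrow>\<^sub>0 'k) module" where
  "chen_path_module E p =
     \<lparr>carrier = {x. Poly_Mapping.keys x \<subseteq> tail_class E p},
      mult = undefined, one = undefined, zero = 0, add = (+),
      smult = (\<lambda>A x. the_elem ((\<lambda>f. poly_action E f x) ` A))\<rparr>"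

text \<open>\<open>V\<^bsub>[w\<^sup>\<infinity>]\<^esub>\<close> for a sink \<open>w\<close>: the left ideal \<open>L\<^sub>K(E) w\<close>.\<close>

definition chen_sink_module ::
  "('v, 'e) pre_digraph \<Rightarrow> 'v
     \<Rightarrow> (('v, 'e, 'k::field) lpa_element, ('v, 'e, 'k) lpa_element) module" where
  "chen_sink_module E w =
     \<lparr>carrier = {a \<otimes>\<^bsub>leavitt E\<^esub> lpa_class E (gen (Vertex w)) | a. a \<in> carrier (leavitt E)},
      mult = undefined, one = undefined, zero = \<zero>\<^bsub>leavitt E\<^esub>, add = add (leavitt E),
      smult = mult (leavitt E)\<rparr>"

definition vertex_support ::
  "('v, 'e) pre_digraph \<Rightarrow> (('v, 'e, 'k::field) lpa_element, 'm) module \<Rightarrow> 'v set" where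
  "vertex_support E T = {v \<in> verts E.
     {lpa_class E (gen (Vertex v)) \<odot>\<^bsub>T\<^esub> x | x. x \<in> carrier T} \<noteq> {\<zero>\<^bsub>T\<^esub>}}"


section \<open>\<open>Ext\<^sup>1\<close> over a ring\<close>

definition hom_group ::
  "'r ring \<Rightarrow> ('r, 'm) module \<Rightarrow> ('r, 'n) module \<Rightarrow> ('m \<Rightarrow> 'n) monoid" where
  "hom_group R M N =
     \<lparr>carrier = {h \<in> carrier M \<rightarrow>\<^sub>E carrier N.
        (\<forall>x \<in> carrier M. \<forall>y \<in> carrier M. h (x \<oplus>\<^bsub>M\<^esub> y) = h x \<oplus>\<^bsub>N\<^esub> h y) \<and>
        (\<forall>a \<in> carrier R. \<forall>x \<in> carrier M. h (a \<odot>\<^bsub>M\<^esub> x) = a \<odot>\<^bsub>N\<^esub> h x)},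
      mult = (\<lambda>g h. \<lambda>x \<in> carrier M. g x \<oplus>\<^bsub>N\<^esub> h x),
      one = (\<lambda>x \<in> carrier M. \<zero>\<^bsub>N\<^esub>)\<rparr>"

definition free_module :: "'r ring \<Rightarrow> 'x set \<Rightarrow> ('r, 'x \<Rightarrow> 'r) module" where
  "free_module R X =
     \<lparr>carrier = {f. (\<forall>x. f x \<in> carrier R) \<and> (\<forall>x. x \<notin> X \<longrightarrow> f x = \<zero>\<^bsub>R\<^esub>) \<and>
        finite {x. f x \<noteq> \<zero>\<^bsub>R\<^esub>}},
      mult = undefined, one = undefined,
      zero = (\<lambda>x. \<zero>\<^bsub>R\<^esub>), add = (\<lambda>f g x. f x \<oplus>\<^bsub>R\<^esub> g x), smult = (\<lambda>a f x. a \<otimes>\<^bsub>R\<^esub> f x)\<rparr>"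

text \<open>For \<open>X \<subseteq> carrier M\<close>, the homomorphism from the free module on \<open>X\<close> that extends the
  inclusion of \<open>X\<close> into \<open>M\<close>, and its kernel.\<close>

definition evaluation :: "'r ring \<Rightarrow> ('r, 'm) module \<Rightarrow> ('m \<Rightarrow> 'r) \<Rightarrow> 'm" where
  "evaluation R M f = (\<Oplus>\<^bsub>M\<^esub>x \<in> {x. f x \<noteq> \<zero>\<^bsub>R\<^esub>}. f x \<odot>\<^bsub>M\<^esub> x)"

definition syzygies :: "'r ring \<Rightarrow> ('r, 'm) module \<Rightarrow> 'm set \<Rightarrow> ('m \<Rightarrow> 'r) set" where
  "syzygies R M X = {f \<in> carrier (free_module R X). evaluation R M f = \<zero>\<^bsub>M\<^esub>}"

text \<open>
  \<open>Ext\<^sup>1\<^sub>R(M, N)\<close> is the first cohomology of \<open>Hom\<^sub>R(P\<^sub>\<bullet>, N)\<close> for a projective resolution \<open>P\<^sub>\<bullet>\<close> of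
  \<open>M\<close>. We take the standard free resolution: \<open>P\<^sub>0\<close> is free on \<open>M\<close>, and each further term is free
  on the kernel of the preceding map, all maps being evaluations. Here \<open>P\<^sub>2 \<rightarrow> P\<^sub>1 \<rightarrow> P\<^sub>0\<close> is its
  beginning.
\<close>

definition Ext1 ::
  "'r ring \<Rightarrow> ('r, 'm) module \<Rightarrow> ('r, 'n) module \<Rightarrow> ((('m \<Rightarrow> 'r) \<Rightarrow> 'r) \<Rightarrow> 'n) set monoid" where
  "Ext1 R M N =
     (let P\<^sub>0 = free_module R (carrier M);
          Z\<^sub>0 = syzygies R M (carrier M);
          P\<^sub>1 = free_module R Z\<^sub>0;
          Z\<^sub>1 = syzygies R P\<^sub>0 Z\<^sub>0;
          P\<^sub>2 = free_module R Z\<^sub>1;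
          \<delta>\<^sub>0 = (\<lambda>h. compose (carrier P\<^sub>1) h (evaluation R P\<^sub>0));
          \<delta>\<^sub>1 = (\<lambda>h. compose (carrier P\<^sub>2) h (evaluation R P\<^sub>1))
      in (hom_group R P\<^sub>1 N)\<lparr>carrier := kernel (hom_group R P\<^sub>1 N) (hom_group R P\<^sub>2 N) \<delta>\<^sub>1\<rparr>
           Mod \<delta>\<^sub>0 ` carrier (hom_group R P\<^sub>0 N))"

end

theory Submission
  imports Defs
begin

text \<open>
  Write \<open>v = s(d)\<close>. The module \<open>V\<^bsub>[d\<^sup>\<infinity>]\<^esub>\<close> has the projective presentation
  \<open>0 \<rightarrow> Lv \<rightarrow> Lv \<rightarrow> V\<^bsub>[d\<^sup>\<infinity>]\<^esub> \<rightarrow> 0\<close>, where the first map is right multiplication by \<open>d - v\<close> and the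
  second sends \<open>a\<close> to \<open>a d\<^sup>\<infinity>\<close>. Injectivity of the first map follows from the \<open>\<int>\<close>-grading of \<open>L\<close>.
  Exactness in the middle holds because two finite paths \<open>\<alpha>\<close>, \<open>\<beta>\<close> with \<open>\<alpha>d\<^sup>\<infinity> = \<beta>d\<^sup>\<infinity>\<close> differ by a
  power of the simple closed path \<open>d\<close>, hence agree modulo \<open>L(d - v)\<close>. Therefore
  \<open>Ext\<^sup>1(V\<^bsub>[d\<^sup>\<infinity>]\<^esub>, T) \<cong> vT / (d - v)T\<close>. If \<open>vT = 0\<close>, this is zero. Otherwise the paths starting at \<open>v\<close>
  form a basis of \<open>vT\<close>, and the sum of the coefficients is a nonzero functional on \<open>vT\<close> that vanishes
  on \<open>(d - v)T\<close>, because \<open>d\<close> maps such paths to such paths.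
\<close>

section \<open>Left modules and the first Ext group\<close>

text \<open>\<open>Ext1\<close> is built from the standard free resolution on all elements of the
  module, whereas the argument lives on a presentation by two copies of \<open>Lv\<close>. The two
  are not linked by an isomorphism of cohomology groups; only vanishing is transported. It is an
  extension problem for homomorphisms on the syzygies \<open>Z\<^sub>0\<close>, and this problem is
  equivalent to solving \<open>(d - v) s = t\<close> for every \<open>t\<close> in
  \<open>vT\<close>. Elements of \<open>L\<close> are cosets of polynomials, so statements about
  \<open>L\<close> are congruences modulo the ideal \<open>I\<close>. Congruences are refuted by
  letting polynomials act on a space spanned by paths, where \<open>I\<close> acts as zero. They are
  produced by lifting each basis path to a polynomial and showing that the linear extension of the
  lift commutes with the action. This one argument yields both the annihilator of
  \<open>d\<^sup>\<infinity>\<close> and the fact that \<open>Lw\<close> is spanned by the paths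
  ending in the sink \<open>w\<close>.\<close>

locale left_module = R?: ring R + M?: abelian_group M
    for R :: "'r ring" (structure) and M :: "('r, 'm) module" (structure) +
  assumes smult_closed [simp, intro]:
      "\<lbrakk>a \<in> carrier R; x \<in> carrier M\<rbrakk> \<Longrightarrow> a \<odot>\<^bsub>M\<^esub> x \<in> carrier M"
    and smult_l_distr:
      "\<lbrakk>a \<in> carrier R; b \<in> carrier R; x \<in> carrier M\<rbrakk> \<Longrightarrow> (a \<oplus> b) \<odot>\<^bsub>M\<^esub> x = a \<odot>\<^bsub>M\<^esub> x \<oplus>\<^bsub>M\<^esub> b \<odot>\<^bsub>M\<^esub> x"
    and smult_r_distr:
      "\<lbrakk>a \<in> carrier R; x \<in> carrier M; y \<in> carrier M\<rbrakk> \<Longrightarrow> a \<odot>\<^bsub>M\<^esub> (x \<oplus>\<^bsub>M\<^esub> y) = a \<odot>\<^bsub>M\<^esub> x \<oplus>\<^bsub>M\<^esub> a \<odot>\<^bsub>M\<^esub> y"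
    and smult_assoc:
      "\<lbrakk>a \<in> carrier R; b \<in> carrier R; x \<in> carrier M\<rbrakk> \<Longrightarrow> (a \<otimes> b) \<odot>\<^bsub>M\<^esub> x = a \<odot>\<^bsub>M\<^esub> (b \<odot>\<^bsub>M\<^esub> x)"
    and smult_one [simp]: "x \<in> carrier M \<Longrightarrow> \<one> \<odot>\<^bsub>M\<^esub> x = x"
begin

lemma smult_l_null [simp]:
  assumes "x \<in> carrier M" shows "\<zero> \<odot>\<^bsub>M\<^esub> x = \<zero>\<^bsub>M\<^esub>"
  using assms smult_l_distr[of \<zero> \<zero> x] by (metis M.add.r_cancel_one' R.l_zero R.zero_closed smult_closed)

lemma smult_r_null [simp]:
  assumes "a \<in> carrier R" shows "a \<odot>\<^bsub>M\<^esub> \<zero>\<^bsub>M\<^esub> = \<zero>\<^bsub>M\<^esub>"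
  using assms smult_r_distr[of a "\<zero>\<^bsub>M\<^esub>" "\<zero>\<^bsub>M\<^esub>"] by (metis M.add.r_cancel_one' M.l_zero M.zero_closed smult_closed)

lemma smult_l_minus:
  assumes "a \<in> carrier R" "x \<in> carrier M" shows "(\<ominus> a) \<odot>\<^bsub>M\<^esub> x = \<ominus>\<^bsub>M\<^esub> (a \<odot>\<^bsub>M\<^esub> x)"
  using assms smult_l_distr[of "\<ominus> a" a x] by (simp add: M.minus_equality R.l_neg)

lemma smult_r_minus:
  assumes "a \<in> carrier R" "x \<in> carrier M" shows "a \<odot>\<^bsub>M\<^esub> (\<ominus>\<^bsub>M\<^esub> x) = \<ominus>\<^bsub>M\<^esub> (a \<odot>\<^bsub>M\<^esub> x)"
  using assms smult_r_distr[of a "\<ominus>\<^bsub>M\<^esub> x" x] by (simp add: M.minus_equality M.l_neg)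

lemma diff_eq_zero_iff [simp]:
  assumes "x \<in> carrier M" "y \<in> carrier M" shows "x \<ominus>\<^bsub>M\<^esub> y = \<zero>\<^bsub>M\<^esub> \<longleftrightarrow> x = y"
  using assms by (metis M.add.inv_closed M.minus_equality M.minus_minus M.r_neg a_minus_def)

lemma finsum_smult:
  assumes "finite A" "a \<in> carrier R" "f \<in> A \<rightarrow> carrier M"
  shows "a \<odot>\<^bsub>M\<^esub> finsum M f A = (\<Oplus>\<^bsub>M\<^esub>x\<in>A. a \<odot>\<^bsub>M\<^esub> f x)"
  using assms by (induction A rule: finite_induct) (auto simp: smult_r_distr Pi_iff)

end

text \<open>The domain is a bare subset \<open>Z\<close> of \<open>M\<close>, so homomorphisms out
  of the syzygies need no module record of their own. Values outside \<open>Z\<close> are left free;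
  \<open>hom_group\<close>, in contrast, asks for extensional functions.\<close>

definition linear_on ::
  "'r ring \<Rightarrow> ('r, 'm) module \<Rightarrow> ('r, 'n) module \<Rightarrow> 'm set \<Rightarrow> ('m \<Rightarrow> 'n) \<Rightarrow> bool" where
  "linear_on R M N Z f \<longleftrightarrow> f \<in> Z \<rightarrow> carrier N \<and>
     (\<forall>x \<in> Z. \<forall>y \<in> Z. f (x \<oplus>\<^bsub>M\<^esub> y) = f x \<oplus>\<^bsub>N\<^esub> f y) \<and>
     (\<forall>a \<in> carrier R. \<forall>x \<in> Z. f (a \<odot>\<^bsub>M\<^esub> x) = a \<odot>\<^bsub>N\<^esub> f x)"

definition submodule_of :: "'r ring \<Rightarrow> ('r, 'm) module \<Rightarrow> 'm set \<Rightarrow> bool" where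
  "submodule_of R M Z \<longleftrightarrow> Z \<subseteq> carrier M \<and> \<zero>\<^bsub>M\<^esub> \<in> Z \<and>
     (\<forall>x \<in> Z. \<forall>y \<in> Z. x \<oplus>\<^bsub>M\<^esub> y \<in> Z) \<and> (\<forall>a \<in> carrier R. \<forall>x \<in> Z. a \<odot>\<^bsub>M\<^esub> x \<in> Z)"

section \<open>Free modules and their universal property\<close>

definition free_lift :: "'r ring \<Rightarrow> ('r, 'n) module \<Rightarrow> ('x \<Rightarrow> 'n) \<Rightarrow> ('x \<Rightarrow> 'r) \<Rightarrow> 'n" where
  "free_lift R N k f = (\<Oplus>\<^bsub>N\<^esub>x \<in> {x. f x \<noteq> \<zero>\<^bsub>R\<^esub>}. f x \<odot>\<^bsub>N\<^esub> k x)"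

definition free_basis :: "'r ring \<Rightarrow> 'x \<Rightarrow> 'x \<Rightarrow> 'r" where
  "free_basis R x = (\<lambda>y. if y = x then \<one>\<^bsub>R\<^esub> else \<zero>\<^bsub>R\<^esub>)"

lemma evaluation_eq_free_lift: "evaluation R M = free_lift R M (\<lambda>x. x)"
  by (simp add: evaluation_def free_lift_def fun_eq_iff)

lemma left_module_free_module:
  assumes "ring R"
  shows "left_module R (free_module R X)"
proof -
  interpret R: ring R by fact
  have fin: "finite {x. h (f x) (g x) \<noteq> \<zero>\<^bsub>R\<^esub>}"
    if "finite {x. f x \<noteq> \<zero>\<^bsub>R\<^esub>}" "finite {x. g x \<noteq> \<zero>\<^bsub>R\<^esub>}" "h \<zero>\<^bsub>R\<^esub> \<zero>\<^bsub>R\<^esub> = \<zero>\<^bsub>R\<^esub>"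
    for h and f g :: "'b \<Rightarrow> 'a"
    by (rule finite_subset[OF _ finite_UnI[OF that(1,2)]]) (use that(3) in auto)
  have "abelian_group (free_module R X)"
  proof (rule abelian_groupI)
    fix f g assume "f \<in> carrier (free_module R X)" "g \<in> carrier (free_module R X)"
    then show "f \<oplus>\<^bsub>free_module R X\<^esub> g \<in> carrier (free_module R X)"
      using fin[of f g "add R"] by (auto simp: free_module_def)
  next
    fix f assume f: "f \<in> carrier (free_module R X)"
    then have "(\<lambda>x. \<ominus>\<^bsub>R\<^esub> f x) \<in> carrier (free_module R X)"
      using fin[of f f "\<lambda>a b. \<ominus>\<^bsub>R\<^esub> a"] by (auto simp: free_module_def)
    then show "\<exists>y\<in>carrier (free_module R X). y \<oplus>\<^bsub>free_module R X\<^esub> f = \<zero>\<^bsub>free_module R X\<^esub>"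
      using f by (intro bexI[of _ "\<lambda>x. \<ominus>\<^bsub>R\<^esub> f x"]) (auto simp: free_module_def R.l_neg)
  qed (auto simp: free_module_def R.a_ac)
  then show ?thesis
    unfolding left_module_def left_module_axioms_def
    using fin[of _ _ "\<lambda>a b. _ \<otimes>\<^bsub>R\<^esub> b"] assms
    by (auto simp: free_module_def R.l_distr R.r_distr R.m_assoc)
qed

lemma free_basis_closed:
  assumes "ring R" "x \<in> X"
  shows "free_basis R x \<in> carrier (free_module R X)"
proof -
  interpret ring R by fact
  have "finite {y. free_basis R x y \<noteq> \<zero>\<^bsub>R\<^esub>}"
    by (rule finite_subset[of _ "{x}"]) (auto simp: free_basis_def)
  then show ?thesis
    using assms by (auto simp: free_module_def free_basis_def)
qed

context left_module
begin

text \<open>The supports of \<open>f\<close>, \<open>g\<close> and their sum differ, so sums over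
  them cannot be added termwise. Over a common finite superset they can, as the extra terms are
  zero.\<close>

lemma free_lift_superset:
  assumes "finite A" "{x. f x \<noteq> \<zero>} \<subseteq> A" "A \<subseteq> X" "k \<in> X \<rightarrow> carrier M"
    and "f \<in> carrier (free_module R X)"
  shows "free_lift R M k f = (\<Oplus>\<^bsub>M\<^esub>x\<in>A. f x \<odot>\<^bsub>M\<^esub> k x)"
  unfolding free_lift_def
  by (rule M.add.finprod_mono_neutral_cong_left) (use assms in \<open>auto simp: Pi_iff free_module_def subset_iff\<close>)

lemma support_subset:
  assumes "f \<in> carrier (free_module R X)"
  shows "finite {x. f x \<noteq> \<zero>}" "{x. f x \<noteq> \<zero>} \<subseteq> X" "\<And>x. f x \<in> carrier R"
  using assms by (auto simp: free_module_def)

lemma free_lift_linear: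
  assumes k: "k \<in> X \<rightarrow> carrier M"
  shows "linear_on R (free_module R X) M (carrier (free_module R X)) (free_lift R M k)"
  unfolding linear_on_def
proof (intro conjI ballI funcsetI)
  interpret F: left_module R "free_module R X"
    by (rule left_module_free_module) (rule R.ring_axioms)
  fix f assume f: "f \<in> carrier (free_module R X)"
  note sf = support_subset[OF f]
  show "free_lift R M k f \<in> carrier M"
    unfolding free_lift_def using sf k by (intro M.finsum_closed) (auto simp: Pi_iff)
  {
    fix g assume g: "g \<in> carrier (free_module R X)"
    note sg = support_subset[OF g]
    have fg: "f \<oplus>\<^bsub>free_module R X\<^esub> g \<in> carrier (free_module R X)"
      using f g by simp
    define A where "A = {x. f x \<noteq> \<zero>} \<union> {x. g x \<noteq> \<zero>}"
    have A: "finite A" "{x. f x \<noteq> \<zero>} \<subseteq> A" "{x. g x \<noteq> \<zero>} \<subseteq> A" "A \<subseteq> X"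
      "{x. (f \<oplus>\<^bsub>free_module R X\<^esub> g) x \<noteq> \<zero>} \<subseteq> A"
      using sf sg by (auto simp: A_def free_module_def)
    have "(\<Oplus>\<^bsub>M\<^esub>x\<in>A. (f \<oplus>\<^bsub>free_module R X\<^esub> g) x \<odot>\<^bsub>M\<^esub> k x) = (\<Oplus>\<^bsub>M\<^esub>x\<in>A. f x \<odot>\<^bsub>M\<^esub> k x \<oplus>\<^bsub>M\<^esub> g x \<odot>\<^bsub>M\<^esub> k x)"
      by (rule M.finsum_cong') (use A k sf sg in \<open>auto simp: Pi_iff free_module_def subset_iff smult_l_distr\<close>)
    also have "\<dots> = (\<Oplus>\<^bsub>M\<^esub>x\<in>A. f x \<odot>\<^bsub>M\<^esub> k x) \<oplus>\<^bsub>M\<^esub> (\<Oplus>\<^bsub>M\<^esub>x\<in>A. g x \<odot>\<^bsub>M\<^esub> k x)"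
      by (rule M.finsum_addf) (use A k sf sg in \<open>auto simp: Pi_iff\<close>)
    finally show "free_lift R M k (f \<oplus>\<^bsub>free_module R X\<^esub> g) = free_lift R M k f \<oplus>\<^bsub>M\<^esub> free_lift R M k g"
      using free_lift_superset[OF A(1,2,4) k f] free_lift_superset[OF A(1,3,4) k g]
        free_lift_superset[OF A(1,5,4) k fg] by simp
  next
    fix a assume a: "a \<in> carrier R"
    have af: "a \<odot>\<^bsub>free_module R X\<^esub> f \<in> carrier (free_module R X)"
      using f a by simp
    have sub: "{x. (a \<odot>\<^bsub>free_module R X\<^esub> f) x \<noteq> \<zero>} \<subseteq> {x. f x \<noteq> \<zero>}"
      using a by (auto simp: free_module_def)
    have "free_lift R M k (a \<odot>\<^bsub>free_module R X\<^esub> f) = (\<Oplus>\<^bsub>M\<^esub>x\<in>{x. f x \<noteq> \<zero>}. (a \<odot>\<^bsub>free_module R X\<^esub> f) x \<odot>\<^bsub>M\<^esub> k x)"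
      by (rule free_lift_superset[OF sf(1) sub sf(2) k af])
    also have "\<dots> = (\<Oplus>\<^bsub>M\<^esub>x\<in>{x. f x \<noteq> \<zero>}. a \<odot>\<^bsub>M\<^esub> (f x \<odot>\<^bsub>M\<^esub> k x))"
      by (rule M.finsum_cong') (use a sf k in \<open>auto simp: free_module_def smult_assoc Pi_iff\<close>)
    also have "\<dots> = a \<odot>\<^bsub>M\<^esub> free_lift R M k f"
      unfolding free_lift_def by (rule finsum_smult[symmetric]) (use a sf k in \<open>auto simp: Pi_iff\<close>)
    finally show "free_lift R M k (a \<odot>\<^bsub>free_module R X\<^esub> f) = a \<odot>\<^bsub>M\<^esub> free_lift R M k f" .
  }
qed

lemma free_lift_basis:
  assumes k: "k \<in> X \<rightarrow> carrier M" and x: "x \<in> X"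
  shows "free_lift R M k (free_basis R x) = k x"
proof -
  have "free_lift R M k (free_basis R x) = (\<Oplus>\<^bsub>M\<^esub>y\<in>{x}. free_basis R x y \<odot>\<^bsub>M\<^esub> k y)"
    by (rule free_lift_superset[OF _ _ _ k])
       (use x free_basis_closed[OF R.ring_axioms x] in \<open>auto simp: free_basis_def\<close>)
  also have "\<dots> = k x"
    using k x by (subst M.finsum_insert) (auto simp: free_basis_def Pi_iff)
  finally show ?thesis .
qed

lemma free_lift_compose:
  assumes k: "k \<in> X \<rightarrow> carrier M" and f: "f \<in> carrier (free_module R X)"
    and h: "linear_on R M N (carrier M) h" and N: "left_module R N"
  shows "h (free_lift R M k f) = free_lift R N (\<lambda>x. h (k x)) f"
proof -
  interpret N: left_module R N by fact
  note sf = support_subset[OF f]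
  have h0: "h \<zero>\<^bsub>M\<^esub> = \<zero>\<^bsub>N\<^esub>"
  proof -
    have "h (\<zero> \<odot>\<^bsub>M\<^esub> \<zero>\<^bsub>M\<^esub>) = \<zero> \<odot>\<^bsub>N\<^esub> h \<zero>\<^bsub>M\<^esub>"
      using h unfolding linear_on_def by blast
    then show ?thesis using h by (auto simp: linear_on_def Pi_iff)
  qed
  have "h (\<Oplus>\<^bsub>M\<^esub>x \<in> A. f x \<odot>\<^bsub>M\<^esub> k x) = (\<Oplus>\<^bsub>N\<^esub>x \<in> A. f x \<odot>\<^bsub>N\<^esub> h (k x))"
    if "finite A" "A \<subseteq> X" for A
    using that
  proof (induction A rule: finite_induct)
    case (insert x A)
    have "(\<Oplus>\<^bsub>M\<^esub>x \<in> A. f x \<odot>\<^bsub>M\<^esub> k x) \<in> carrier M"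
      using insert.prems k sf by (intro M.finsum_closed) (auto simp: Pi_iff)
    then show ?case
      using insert k sf h by (auto simp: Pi_iff linear_on_def subset_iff M.finsum_insert N.finsum_insert)
  qed (simp add: h0)
  then show ?thesis using sf by (simp add: free_lift_def)
qed

lemma evaluation_linear:
  assumes "Z \<subseteq> carrier M"
  shows "linear_on R (free_module R Z) M (carrier (free_module R Z)) (evaluation R M)"
  unfolding evaluation_eq_free_lift by (rule free_lift_linear) (use assms in auto)

lemma evaluation_basis:
  assumes "Z \<subseteq> carrier M" "z \<in> Z"
  shows "evaluation R M (free_basis R z) = z"
  unfolding evaluation_eq_free_lift by (rule free_lift_basis[of _ Z]) (use assms in auto)

lemma submodule_minus:
  assumes Z: "submodule_of R M Z" and xy: "x \<in> Z" "y \<in> Z"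
  shows "x \<ominus>\<^bsub>M\<^esub> y \<in> Z"
proof -
  have "\<ominus>\<^bsub>M\<^esub> y = (\<ominus> \<one>) \<odot>\<^bsub>M\<^esub> y"
    using Z xy by (subst smult_l_minus) (auto simp: submodule_of_def)
  then show ?thesis
    using Z xy unfolding submodule_of_def a_minus_def by auto
qed

lemma submodule_carrier: "submodule_of R M (carrier M)"
  by (auto simp: submodule_of_def)

lemma linear_on_zero:
  assumes f: "linear_on R M N Z f" and N: "left_module R N" and Z: "submodule_of R M Z"
  shows "f \<zero>\<^bsub>M\<^esub> = \<zero>\<^bsub>N\<^esub>"
proof -
  interpret N: left_module R N by fact
  have z: "\<zero>\<^bsub>M\<^esub> \<in> Z" using Z by (simp add: submodule_of_def)
  then have "f (\<zero> \<odot>\<^bsub>M\<^esub> \<zero>\<^bsub>M\<^esub>) = \<zero> \<odot>\<^bsub>N\<^esub> f \<zero>\<^bsub>M\<^esub>"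
    using f unfolding linear_on_def by blast
  then show ?thesis using f z by (auto simp: linear_on_def Pi_iff)
qed

lemma linear_on_minus:
  assumes f: "linear_on R M N Z f" and N: "left_module R N" and Z: "submodule_of R M Z"
    and xy: "x \<in> Z" "y \<in> Z"
  shows "f (x \<ominus>\<^bsub>M\<^esub> y) = f x \<ominus>\<^bsub>N\<^esub> f y"
proof -
  interpret N: left_module R N by fact
  have xyM: "x \<in> carrier M" "y \<in> carrier M" and fxy: "f x \<in> carrier N" "f y \<in> carrier N"
    using f Z xy by (auto simp: linear_on_def submodule_of_def)
  have d: "x \<ominus>\<^bsub>M\<^esub> y \<in> Z" by (rule submodule_minus[OF Z xy])
  then have fd: "f (x \<ominus>\<^bsub>M\<^esub> y) \<in> carrier N" using f by (auto simp: linear_on_def)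
  have "f x = f ((x \<ominus>\<^bsub>M\<^esub> y) \<oplus>\<^bsub>M\<^esub> y)"
    using xyM by (simp add: a_minus_def M.a_assoc M.l_neg)
  also have "\<dots> = f (x \<ominus>\<^bsub>M\<^esub> y) \<oplus>\<^bsub>N\<^esub> f y"
    using f d xy by (auto simp: linear_on_def)
  finally show ?thesis
    using fd fxy by (simp add: a_minus_def N.a_assoc N.r_neg)
qed

lemma submodule_kernel:
  assumes f: "linear_on R M N (carrier M) f" and N: "left_module R N"
  shows "submodule_of R M {x \<in> carrier M. f x = \<zero>\<^bsub>N\<^esub>}"
proof -
  interpret N: left_module R N by fact
  show ?thesis
    using f linear_on_zero[OF f N submodule_carrier] by (auto simp: submodule_of_def linear_on_def)
qed

lemma submodule_syzygies:
  assumes "Z \<subseteq> carrier M"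
  shows "submodule_of R (free_module R Z) (syzygies R M Z)"
proof -
  interpret F: left_module R "free_module R Z"
    by (rule left_module_free_module) (rule R.ring_axioms)
  show ?thesis
    unfolding syzygies_def
    by (rule F.submodule_kernel[OF evaluation_linear[OF assms] left_module_axioms])
qed

text \<open>A submodule contains the linear combinations of its elements. Applied to the syzygies,
  this lets a homomorphism that is defined only on \<open>Z\<^sub>0\<close> be composed with the
  evaluation on \<open>P\<^sub>1\<close>.\<close>

lemma evaluation_in_submodule:
  assumes Z: "submodule_of R M Z" and f: "f \<in> carrier (free_module R Z)"
  shows "evaluation R M f \<in> Z"
proof -
  note sf = support_subset[OF f]
  have ZM: "Z \<subseteq> carrier M" using Z by (simp add: submodule_of_def)
  have "(\<Oplus>\<^bsub>M\<^esub>x \<in> A. f x \<odot>\<^bsub>M\<^esub> x) \<in> Z" if "finite A" "A \<subseteq> Z" for A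
    using that
  proof (induction A rule: finite_induct)
    case (insert x A)
    then show ?case
      using Z ZM sf by (subst M.finsum_insert) (auto simp: submodule_of_def Pi_iff subset_iff)
  qed (use Z in \<open>simp add: submodule_of_def\<close>)
  then show ?thesis using sf by (simp add: evaluation_def)
qed

end

section \<open>The first Ext group as an extension problem\<close>

lemma hom_group_carrier_iff:
  "h \<in> carrier (hom_group R M N) \<longleftrightarrow> h \<in> extensional (carrier M) \<and> linear_on R M N (carrier M) h"
  by (auto simp: hom_group_def linear_on_def PiE_def)

lemma linear_on_restrict:
  assumes "linear_on R M N Z f" "submodule_of R M Z"
  shows "linear_on R M N Z (restrict f Z)"
  using assms by (auto simp: linear_on_def submodule_of_def)

lemma linear_on_compose:
  assumes "linear_on R M N Z f" "linear_on R N P W g" "f \<in> Z \<rightarrow> W"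
  shows "linear_on R M P Z (\<lambda>x. g (f x))"
  using assms by (auto simp: linear_on_def Pi_iff)

text \<open>The assumptions are what the coset argument asks of a bare record: \<open>x\<close> lies
  in its own coset because the neutral element is in \<open>B\<close>, and translation by an element
  of \<open>B\<close> maps \<open>B\<close> onto itself.\<close>

lemma factor_group_carrier_trivial_iff:
  fixes G :: "('a, 'b) monoid_scheme"
  assumes one: "\<And>x. x \<in> C \<Longrightarrow> \<one>\<^bsub>G\<^esub> \<otimes>\<^bsub>G\<^esub> x = x"
    and oneB: "\<one>\<^bsub>G\<^esub> \<in> B" "\<one>\<^bsub>G\<^esub> \<in> C"
    and B: "\<And>x. x \<in> C \<Longrightarrow> x \<in> B \<Longrightarrow> (\<lambda>b. b \<otimes>\<^bsub>G\<^esub> x) ` B = B"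
  shows "carrier (G\<lparr>carrier := C\<rparr> Mod B) = {\<one>\<^bsub>G\<lparr>carrier := C\<rparr> Mod B\<^esub>} \<longleftrightarrow> C \<subseteq> B"
proof -
  have coset: "B #>\<^bsub>G\<lparr>carrier := C\<rparr>\<^esub> x = (\<lambda>b. b \<otimes>\<^bsub>G\<^esub> x) ` B" for x
    by (auto simp: r_coset_def)
  have coset': "B #>\<^bsub>G\<^esub> x = (\<lambda>b. b \<otimes>\<^bsub>G\<^esub> x) ` B" for x
    by (auto simp: r_coset_def)
  have *: "carrier (G\<lparr>carrier := C\<rparr> Mod B) = (\<lambda>x. (\<lambda>b. b \<otimes>\<^bsub>G\<^esub> x) ` B) ` C"
    by (auto simp: FactGroup_def RCOSETS_def coset coset')
  have **: "\<one>\<^bsub>G\<lparr>carrier := C\<rparr> Mod B\<^esub> = B"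
    by (simp add: FactGroup_def)
  show ?thesis
  proof
    assume a: "carrier (G\<lparr>carrier := C\<rparr> Mod B) = {\<one>\<^bsub>G\<lparr>carrier := C\<rparr> Mod B\<^esub>}"
    show "C \<subseteq> B"
    proof
      fix x assume x: "x \<in> C"
      from a have "(\<lambda>x. (\<lambda>b. b \<otimes>\<^bsub>G\<^esub> x) ` B) ` C = {B}" by (simp only: * **)
      from equalityD1[OF this] have "(\<lambda>b. b \<otimes>\<^bsub>G\<^esub> x) ` B = B" using x by (simp only: image_subset_iff singleton_iff)
      moreover have "x \<in> (\<lambda>b. b \<otimes>\<^bsub>G\<^esub> x) ` B"
        using one[OF x] oneB by (intro image_eqI[of _ _ "\<one>\<^bsub>G\<^esub>"]) auto
      ultimately show "x \<in> B" by simp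
    qed
  next
    assume "C \<subseteq> B"
    then show "carrier (G\<lparr>carrier := C\<rparr> Mod B) = {\<one>\<^bsub>G\<lparr>carrier := C\<rparr> Mod B\<^esub>}"
      unfolding * ** using B oneB by (auto simp: subset_iff intro!: image_eqI[of _ _ "\<one>\<^bsub>G\<^esub>"])
  qed
qed

lemma (in left_module) linear_on_add:
  assumes "linear_on R P M Z f" "linear_on R P M Z g"
  shows "linear_on R P M Z (\<lambda>x. f x \<oplus>\<^bsub>M\<^esub> g x)"
proof -
  have *: "(a \<oplus>\<^bsub>M\<^esub> b) \<oplus>\<^bsub>M\<^esub> (c \<oplus>\<^bsub>M\<^esub> d) = (a \<oplus>\<^bsub>M\<^esub> c) \<oplus>\<^bsub>M\<^esub> (b \<oplus>\<^bsub>M\<^esub> d)"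
    if "a \<in> carrier M" "b \<in> carrier M" "c \<in> carrier M" "d \<in> carrier M" for a b c d
    using that by (simp add: M.a_ac)
  show ?thesis
    using assms unfolding linear_on_def Pi_iff by (simp add: * smult_r_distr)
qed

lemma (in left_module) linear_on_diff:
  assumes "linear_on R P M Z f" "linear_on R P M Z g"
  shows "linear_on R P M Z (\<lambda>x. f x \<ominus>\<^bsub>M\<^esub> g x)"
proof -
  have *: "(a \<oplus>\<^bsub>M\<^esub> b) \<ominus>\<^bsub>M\<^esub> (c \<oplus>\<^bsub>M\<^esub> d) = (a \<ominus>\<^bsub>M\<^esub> c) \<oplus>\<^bsub>M\<^esub> (b \<ominus>\<^bsub>M\<^esub> d)"
    if "a \<in> carrier M" "b \<in> carrier M" "c \<in> carrier M" "d \<in> carrier M" for a b c d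
    using that by (simp add: a_minus_def M.minus_add M.a_ac)
  have **: "r \<odot>\<^bsub>M\<^esub> (a \<ominus>\<^bsub>M\<^esub> b) = r \<odot>\<^bsub>M\<^esub> a \<ominus>\<^bsub>M\<^esub> r \<odot>\<^bsub>M\<^esub> b"
    if "r \<in> carrier R" "a \<in> carrier M" "b \<in> carrier M" for r a b
    using that by (simp add: a_minus_def smult_r_distr smult_r_minus)
  show ?thesis
    using assms unfolding linear_on_def Pi_iff by (simp add: * **)
qed

lemma (in left_module) linear_on_const_zero:
  "linear_on R P M Z (\<lambda>x. \<zero>\<^bsub>M\<^esub>)"
  by (auto simp: linear_on_def Pi_iff)

text \<open>A cocycle is a homomorphism on \<open>P\<^sub>1\<close> that vanishes on
  \<open>Z\<^sub>1\<close>, the kernel of the surjection from \<open>P\<^sub>1\<close> to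
  \<open>Z\<^sub>0\<close>, and so amounts to a homomorphism \<open>f\<close> on
  \<open>Z\<^sub>0\<close>. It is a coboundary exactly if \<open>f\<close> extends to
  \<open>P\<^sub>0\<close>.\<close>

lemma Ext1_trivial_iff_extension:
  fixes R :: "'r ring" and M :: "('r, 'm) module" and N :: "('r, 'n) module"
  assumes M: "left_module R M" and N: "left_module R N"
  defines "P\<^sub>0 \<equiv> free_module R (carrier M)" and "Z\<^sub>0 \<equiv> syzygies R M (carrier M)"
  shows "carrier (Ext1 R M N) = {\<one>\<^bsub>Ext1 R M N\<^esub>} \<longleftrightarrow>
    (\<forall>f. linear_on R P\<^sub>0 N Z\<^sub>0 f \<longrightarrow>
       (\<exists>h. linear_on R P\<^sub>0 N (carrier P\<^sub>0) h \<and> (\<forall>z \<in> Z\<^sub>0. h z = f z)))"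
proof -
  interpret M: left_module R M by fact
  interpret N: left_module R N by fact
  have R: "ring R" ..
  interpret P0: left_module R P\<^sub>0
    unfolding P\<^sub>0_def by (rule left_module_free_module[OF R])
  have Z0: "submodule_of R P\<^sub>0 Z\<^sub>0"
    unfolding P\<^sub>0_def Z\<^sub>0_def by (rule M.submodule_syzygies) simp
  then have Z0P0: "Z\<^sub>0 \<subseteq> carrier P\<^sub>0" by (simp add: submodule_of_def)
  define P\<^sub>1 where "P\<^sub>1 = free_module R Z\<^sub>0"
  define Z\<^sub>1 where "Z\<^sub>1 = syzygies R P\<^sub>0 Z\<^sub>0"
  define P\<^sub>2 where "P\<^sub>2 = free_module R Z\<^sub>1"
  interpret P1: left_module R P\<^sub>1
    unfolding P\<^sub>1_def by (rule left_module_free_module[OF R])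
  interpret P2: left_module R P\<^sub>2
    unfolding P\<^sub>2_def by (rule left_module_free_module[OF R])
  have Z1: "submodule_of R P\<^sub>1 Z\<^sub>1"
    unfolding P\<^sub>1_def Z\<^sub>1_def by (rule P0.submodule_syzygies[OF Z0P0])
  then have Z1P1: "Z\<^sub>1 \<subseteq> carrier P\<^sub>1" by (simp add: submodule_of_def)
  have ev0: "linear_on R P\<^sub>1 P\<^sub>0 (carrier P\<^sub>1) (evaluation R P\<^sub>0)"
    unfolding P\<^sub>1_def by (rule P0.evaluation_linear[OF Z0P0])
  have ev1: "linear_on R P\<^sub>2 P\<^sub>1 (carrier P\<^sub>2) (evaluation R P\<^sub>1)"
    unfolding P\<^sub>2_def by (rule P1.evaluation_linear[OF Z1P1])
  have ev0Z: "evaluation R P\<^sub>0 \<in> carrier P\<^sub>1 \<rightarrow> Z\<^sub>0"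
    using P0.evaluation_in_submodule[OF Z0] by (auto simp: P\<^sub>1_def)
  have ev1Z: "evaluation R P\<^sub>1 \<in> carrier P\<^sub>2 \<rightarrow> Z\<^sub>1"
    using P1.evaluation_in_submodule[OF Z1] by (auto simp: P\<^sub>2_def)
  have b0: "free_basis R z \<in> carrier P\<^sub>1" "evaluation R P\<^sub>0 (free_basis R z) = z" if "z \<in> Z\<^sub>0" for z
    using free_basis_closed[OF R that] P0.evaluation_basis[OF Z0P0 that] by (auto simp: P\<^sub>1_def)
  have b1: "free_basis R z \<in> carrier P\<^sub>2" "evaluation R P\<^sub>1 (free_basis R z) = z" if "z \<in> Z\<^sub>1" for z
    using free_basis_closed[OF R that] P1.evaluation_basis[OF Z1P1 that] by (auto simp: P\<^sub>2_def)
  define G where "G = hom_group R P\<^sub>1 N"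
  define B where "B = (\<lambda>h. compose (carrier P\<^sub>1) h (evaluation R P\<^sub>0)) ` carrier (hom_group R P\<^sub>0 N)"
  define C where "C = kernel G (hom_group R P\<^sub>2 N) (\<lambda>h. compose (carrier P\<^sub>2) h (evaluation R P\<^sub>1))"
  have Ext: "Ext1 R M N = G\<lparr>carrier := C\<rparr> Mod B"
    by (simp add: Ext1_def Let_def G_def B_def C_def P\<^sub>0_def P\<^sub>1_def P\<^sub>2_def Z\<^sub>0_def Z\<^sub>1_def)
  have mem_B: "g \<in> B \<longleftrightarrow> g \<in> extensional (carrier P\<^sub>1) \<and>
      (\<exists>h. linear_on R P\<^sub>0 N (carrier P\<^sub>0) h \<and> (\<forall>y \<in> carrier P\<^sub>1. g y = h (evaluation R P\<^sub>0 y)))" (is "_ \<longleftrightarrow> ?B g") for g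
  proof
    assume "g \<in> B" then show "?B g"
      by (auto simp: B_def hom_group_carrier_iff compose_eq)
  next
    assume "?B g"
    then obtain h where g: "g \<in> extensional (carrier P\<^sub>1)" and h: "linear_on R P\<^sub>0 N (carrier P\<^sub>0) h"
      "\<forall>y \<in> carrier P\<^sub>1. g y = h (evaluation R P\<^sub>0 y)" by blast
    have "restrict h (carrier P\<^sub>0) \<in> carrier (hom_group R P\<^sub>0 N)"
      using linear_on_restrict[OF h(1) P0.submodule_carrier] by (auto simp: hom_group_carrier_iff)
    moreover have "g = compose (carrier P\<^sub>1) (restrict h (carrier P\<^sub>0)) (evaluation R P\<^sub>0)"
      using g h(2) ev0 by (intro extensionalityI[OF g]) (auto simp: compose_eq linear_on_def Pi_iff)
    ultimately show "g \<in> B" unfolding B_def by blast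
  qed
  have mem_C: "g \<in> C \<longleftrightarrow> g \<in> extensional (carrier P\<^sub>1) \<and> linear_on R P\<^sub>1 N (carrier P\<^sub>1) g \<and>
      (\<forall>z \<in> Z\<^sub>1. g z = \<zero>\<^bsub>N\<^esub>)" for g
  proof -
    have "compose (carrier P\<^sub>2) g (evaluation R P\<^sub>1) = (\<lambda>x \<in> carrier P\<^sub>2. \<zero>\<^bsub>N\<^esub>) \<longleftrightarrow>
        (\<forall>y \<in> carrier P\<^sub>2. g (evaluation R P\<^sub>1 y) = \<zero>\<^bsub>N\<^esub>)"
      by (auto simp: compose_def restrict_def fun_eq_iff)
    \<comment> \<open>Every \<open>z\<close> in \<open>Z\<^sub>1\<close> is the evaluation of a
      basis vector of \<open>P\<^sub>2\<close>, so the image of \<open>P\<^sub>2\<close> is all of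
      \<open>Z\<^sub>1\<close>.\<close>
    also have "\<dots> \<longleftrightarrow> (\<forall>z \<in> Z\<^sub>1. g z = \<zero>\<^bsub>N\<^esub>)"
      using ev1Z b1 by (metis PiE)
    finally show ?thesis
      by (auto simp: C_def kernel_def G_def hom_group_carrier_iff) (auto simp: hom_group_def)
  qed
  have mult: "g \<otimes>\<^bsub>G\<^esub> h = (\<lambda>x \<in> carrier P\<^sub>1. g x \<oplus>\<^bsub>N\<^esub> h x)"
    and one: "\<one>\<^bsub>G\<^esub> = (\<lambda>x \<in> carrier P\<^sub>1. \<zero>\<^bsub>N\<^esub>)" for g h
    by (simp_all add: G_def hom_group_def)
  have "carrier (Ext1 R M N) = {\<one>\<^bsub>Ext1 R M N\<^esub>} \<longleftrightarrow> C \<subseteq> B"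
    unfolding Ext
  proof (rule factor_group_carrier_trivial_iff)
    fix g assume "g \<in> C"
    then show "\<one>\<^bsub>G\<^esub> \<otimes>\<^bsub>G\<^esub> g = g"
      unfolding mult one mem_C
      by (intro extensionalityI[of _ "carrier P\<^sub>1"]) (auto simp: linear_on_def Pi_iff)
  next
    show "\<one>\<^bsub>G\<^esub> \<in> B"
      unfolding mem_B one using N.linear_on_const_zero by fastforce
    show "\<one>\<^bsub>G\<^esub> \<in> C"
      unfolding mem_C one using Z1P1 linear_on_restrict[OF N.linear_on_const_zero P1.submodule_carrier]
      by auto
  next
    fix g assume "g \<in> C" "g \<in> B"
    then obtain h where h: "linear_on R P\<^sub>0 N (carrier P\<^sub>0) h" "\<And>y. y \<in> carrier P\<^sub>1 \<Longrightarrow> g y = h (evaluation R P\<^sub>0 y)"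
      unfolding mem_B by blast
    show "(\<lambda>b. b \<otimes>\<^bsub>G\<^esub> g) ` B = B"
    proof
      show "(\<lambda>b. b \<otimes>\<^bsub>G\<^esub> g) ` B \<subseteq> B"
      proof clarify
        fix b assume "b \<in> B"
        then obtain k where k: "linear_on R P\<^sub>0 N (carrier P\<^sub>0) k" "\<And>y. y \<in> carrier P\<^sub>1 \<Longrightarrow> b y = k (evaluation R P\<^sub>0 y)"
          unfolding mem_B by blast
        show "b \<otimes>\<^bsub>G\<^esub> g \<in> B"
          unfolding mem_B mult using N.linear_on_add[OF k(1) h(1)] k(2) h(2) by auto
      qed
    next
      show "B \<subseteq> (\<lambda>b. b \<otimes>\<^bsub>G\<^esub> g) ` B"
      proof
        fix b assume b: "b \<in> B"
        then obtain k where bx: "b \<in> extensional (carrier P\<^sub>1)"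
          and k: "linear_on R P\<^sub>0 N (carrier P\<^sub>0) k" "\<And>y. y \<in> carrier P\<^sub>1 \<Longrightarrow> b y = k (evaluation R P\<^sub>0 y)"
          unfolding mem_B by blast
        let ?b = "\<lambda>y \<in> carrier P\<^sub>1. b y \<ominus>\<^bsub>N\<^esub> g y"
        have "?b \<in> B"
          unfolding mem_B using N.linear_on_diff[OF k(1) h(1)] k(2) h(2) by auto
        moreover have "b = ?b \<otimes>\<^bsub>G\<^esub> g"
          unfolding mult using k h ev0
          by (intro extensionalityI[OF bx])
             (auto simp: linear_on_def Pi_iff a_minus_def N.a_assoc N.l_neg)
        ultimately show "b \<in> (\<lambda>b. b \<otimes>\<^bsub>G\<^esub> g) ` B" by blast
      qed
    qed
  qed
  also have "C \<subseteq> B \<longleftrightarrow> (\<forall>f. linear_on R P\<^sub>0 N Z\<^sub>0 f \<longrightarrow>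
       (\<exists>h. linear_on R P\<^sub>0 N (carrier P\<^sub>0) h \<and> (\<forall>z \<in> Z\<^sub>0. h z = f z)))"
  proof (intro iffI allI impI subsetI)
    fix f assume CB: "C \<subseteq> B" and f: "linear_on R P\<^sub>0 N Z\<^sub>0 f"
    define g where "g = (\<lambda>y \<in> carrier P\<^sub>1. f (evaluation R P\<^sub>0 y))"
    have "g \<in> C"
      unfolding mem_C
    proof (intro conjI ballI)
      show "g \<in> extensional (carrier P\<^sub>1)" by (simp add: g_def)
      show "linear_on R P\<^sub>1 N (carrier P\<^sub>1) g"
        unfolding g_def
        by (rule linear_on_restrict[OF linear_on_compose[OF ev0 f ev0Z] P1.submodule_carrier])
      show "g z = \<zero>\<^bsub>N\<^esub>" if "z \<in> Z\<^sub>1" for z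
        using that Z1P1 P0.linear_on_zero[OF f N Z0]
        by (auto simp: g_def Z\<^sub>1_def syzygies_def P\<^sub>1_def)
    qed
    with CB have "g \<in> B" by blast
    then obtain h where h: "linear_on R P\<^sub>0 N (carrier P\<^sub>0) h" "\<And>y. y \<in> carrier P\<^sub>1 \<Longrightarrow> g y = h (evaluation R P\<^sub>0 y)"
      unfolding mem_B by blast
    have "h z = f z" if "z \<in> Z\<^sub>0" for z
      using h(2)[OF b0(1)[OF that]] b0[OF that] by (simp add: g_def)
    then show "\<exists>h. linear_on R P\<^sub>0 N (carrier P\<^sub>0) h \<and> (\<forall>z \<in> Z\<^sub>0. h z = f z)"
      using h(1) by blast
  next
    fix g assume ext: "\<forall>f. linear_on R P\<^sub>0 N Z\<^sub>0 f \<longrightarrow>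
       (\<exists>h. linear_on R P\<^sub>0 N (carrier P\<^sub>0) h \<and> (\<forall>z \<in> Z\<^sub>0. h z = f z))" and "g \<in> C"
    then have g: "g \<in> extensional (carrier P\<^sub>1)" "linear_on R P\<^sub>1 N (carrier P\<^sub>1) g"
      "\<And>z. z \<in> Z\<^sub>1 \<Longrightarrow> g z = \<zero>\<^bsub>N\<^esub>" by (auto simp: mem_C)
    \<comment> \<open>The basis vector of \<open>z\<close> is only one preimage of \<open>z\<close>,
      and \<open>free_basis\<close> is not additive. The choice is harmless: elements of
      \<open>P\<^sub>1\<close> with equal evaluation differ by an element of
      \<open>Z\<^sub>1\<close>, where \<open>g\<close> vanishes.\<close>
    define f where "f z = g (free_basis R z)" for z
    have key: "g y = f (evaluation R P\<^sub>0 y)" if y: "y \<in> carrier P\<^sub>1" for y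
    proof -
      have e: "evaluation R P\<^sub>0 y \<in> Z\<^sub>0" using y ev0Z by auto
      let ?b = "free_basis R (evaluation R P\<^sub>0 y)"
      have "evaluation R P\<^sub>0 (y \<ominus>\<^bsub>P\<^sub>1\<^esub> ?b) = \<zero>\<^bsub>P\<^sub>0\<^esub>"
        using P1.linear_on_minus[OF ev0 P0.left_module_axioms P1.submodule_carrier y b0(1)[OF e]]
          b0(2)[OF e] e Z0P0 by auto
      then have "y \<ominus>\<^bsub>P\<^sub>1\<^esub> ?b \<in> Z\<^sub>1"
        using y b0(1)[OF e] unfolding Z\<^sub>1_def syzygies_def P\<^sub>1_def[symmetric] by simp
      then have "g y \<ominus>\<^bsub>N\<^esub> g ?b = \<zero>\<^bsub>N\<^esub>"
        using g(3) P1.linear_on_minus[OF g(2) N P1.submodule_carrier y b0(1)[OF e]] by metis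
      then show ?thesis
        using g(2) y b0(1)[OF e] by (auto simp: f_def linear_on_def Pi_iff)
    qed
    have "linear_on R P\<^sub>0 N Z\<^sub>0 f"
      unfolding linear_on_def
    proof (intro conjI ballI funcsetI)
      fix x assume x: "x \<in> Z\<^sub>0"
      show "f x \<in> carrier N" using g(2) b0(1)[OF x] by (auto simp: f_def linear_on_def)
      {
        fix y assume y: "y \<in> Z\<^sub>0"
        have "g (free_basis R x \<oplus>\<^bsub>P\<^sub>1\<^esub> free_basis R y) = f (x \<oplus>\<^bsub>P\<^sub>0\<^esub> y)"
          using ev0 b0[OF x] b0[OF y] by (subst key) (auto simp: linear_on_def)
        then show "f (x \<oplus>\<^bsub>P\<^sub>0\<^esub> y) = f x \<oplus>\<^bsub>N\<^esub> f y"
          using g(2) b0(1)[OF x] b0(1)[OF y] by (simp add: f_def linear_on_def)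
      next
        fix a assume a: "a \<in> carrier R"
        have "g (a \<odot>\<^bsub>P\<^sub>1\<^esub> free_basis R x) = f (a \<odot>\<^bsub>P\<^sub>0\<^esub> x)"
          using ev0 b0[OF x] a by (subst key) (auto simp: linear_on_def)
        then show "f (a \<odot>\<^bsub>P\<^sub>0\<^esub> x) = a \<odot>\<^bsub>N\<^esub> f x"
          using g(2) b0(1)[OF x] a by (simp add: f_def linear_on_def)
      }
    qed
    then obtain h where h: "linear_on R P\<^sub>0 N (carrier P\<^sub>0) h" "\<forall>z \<in> Z\<^sub>0. h z = f z"
      using ext by blast
    then show "g \<in> B"
      unfolding mem_B using g(1) key funcset_mem[OF ev0Z] by (intro conjI exI[of _ h] ballI) simp_all
  qed
  finally show ?thesis .
qed

section \<open>Cyclic modules presented by right multiplication with one element\<close>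

definition regular_module :: "'r ring \<Rightarrow> ('r, 'r) module" where
  "regular_module R = \<lparr>carrier = carrier R, mult = undefined, one = undefined,
     zero = \<zero>\<^bsub>R\<^esub>, add = add R, smult = mult R\<rparr>"

lemma left_module_regular_module:
  assumes "ring R" shows "left_module R (regular_module R)"
proof -
  interpret ring R by fact
  have "abelian_group (regular_module R)"
    by (rule abelian_groupI) (auto simp: regular_module_def a_ac intro: exI[of _ "\<ominus>\<^bsub>R\<^esub> _"] l_neg)
  then show ?thesis
    using assms unfolding left_module_def left_module_axioms_def
    by (auto simp: regular_module_def l_distr r_distr m_assoc)
qed

text \<open>Modelled on an idempotent \<open>v\<close>: the hypotheses then say that right
  multiplication by \<open>r\<close> and \<open>a \<mapsto> a x\<close> form an exact sequence
  \<open>0 \<rightarrow> Rv \<rightarrow> Rv \<rightarrow> M \<rightarrow> 0\<close>. A homomorphism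
  from \<open>Rv\<close> to \<open>N\<close> is the choice of a \<open>t\<close> with
  \<open>v t = t\<close>, and it factors through right multiplication by \<open>r\<close> exactly if
  \<open>t = r s\<close> for some \<open>s\<close>.\<close>

lemma Ext1_trivial_iff_cyclic:
  fixes R :: "'r ring" and M :: "('r, 'm) module" and N :: "('r, 'n) module"
  assumes M: "left_module R M" and N: "left_module R N"
    and v: "v \<in> carrier R" and r: "r \<in> carrier R"
    and vr: "v \<otimes>\<^bsub>R\<^esub> r = r" and rv: "r \<otimes>\<^bsub>R\<^esub> v = r"
    and x: "x \<in> carrier M" and vx: "v \<odot>\<^bsub>M\<^esub> x = x" and rx: "r \<odot>\<^bsub>M\<^esub> x = \<zero>\<^bsub>M\<^esub>"
    and generates: "\<And>y. y \<in> carrier M \<Longrightarrow> \<exists>a \<in> carrier R. y = a \<odot>\<^bsub>M\<^esub> x"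
    and annihilator: "\<And>a. a \<in> carrier R \<Longrightarrow> a \<odot>\<^bsub>M\<^esub> x = \<zero>\<^bsub>M\<^esub> \<Longrightarrow> \<exists>b \<in> carrier R. a \<otimes>\<^bsub>R\<^esub> v = b \<otimes>\<^bsub>R\<^esub> r"
    and injective: "\<And>b. b \<in> carrier R \<Longrightarrow> b \<otimes>\<^bsub>R\<^esub> r = \<zero>\<^bsub>R\<^esub> \<Longrightarrow> b \<otimes>\<^bsub>R\<^esub> v = \<zero>\<^bsub>R\<^esub>"
  shows "carrier (Ext1 R M N) = {\<one>\<^bsub>Ext1 R M N\<^esub>} \<longleftrightarrow>
    (\<forall>t \<in> carrier N. v \<odot>\<^bsub>N\<^esub> t = t \<longrightarrow> (\<exists>s \<in> carrier N. r \<odot>\<^bsub>N\<^esub> s = t))"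
proof -
  interpret M: left_module R M by fact
  interpret N: left_module R N by fact
  have R: "ring R" ..
  interpret RR: left_module R "regular_module R" by (rule left_module_regular_module[OF R])
  define P\<^sub>0 where "P\<^sub>0 = free_module R (carrier M)"
  define Z\<^sub>0 where "Z\<^sub>0 = syzygies R M (carrier M)"
  interpret P0: left_module R P\<^sub>0
    unfolding P\<^sub>0_def by (rule left_module_free_module[OF R])
  have Z0: "submodule_of R P\<^sub>0 Z\<^sub>0"
    unfolding P\<^sub>0_def Z\<^sub>0_def by (rule M.submodule_syzygies) simp
  then have Z0P0: "Z\<^sub>0 \<subseteq> carrier P\<^sub>0" by (simp add: submodule_of_def)
  have ev: "linear_on R P\<^sub>0 M (carrier P\<^sub>0) (evaluation R M)"
    unfolding P\<^sub>0_def by (rule M.evaluation_linear) simp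
  have mem_Z0: "z \<in> Z\<^sub>0 \<longleftrightarrow> z \<in> carrier P\<^sub>0 \<and> evaluation R M z = \<zero>\<^bsub>M\<^esub>" for z
    by (simp add: Z\<^sub>0_def P\<^sub>0_def syzygies_def)
  have regular_simps: "carrier (regular_module R) = carrier R" "add (regular_module R) = add R"
    "smult (regular_module R) = mult R" "zero (regular_module R) = zero R"
    by (simp_all add: regular_module_def)
  obtain a' where a': "\<And>y. y \<in> carrier M \<Longrightarrow> a' y \<in> carrier R \<and> y = a' y \<odot>\<^bsub>M\<^esub> x"
    using generates by metis
  \<comment> \<open>\<open>a'\<close> picks arbitrary preimages; resetting it at \<open>x\<close>
    makes the lift \<open>A\<close> send the basis vector of \<open>x\<close> to exactly
    \<open>v\<close>.\<close>
  define a where "a = a'(x := v)"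
  have a: "a y \<in> carrier R" "a y \<odot>\<^bsub>M\<^esub> x = y" if "y \<in> carrier M" for y
    using a'[OF that] v vx by (auto simp: a_def)
  \<comment> \<open>\<open>A\<close> lifts the evaluation from \<open>P\<^sub>0\<close> to
    \<open>M\<close> along \<open>a \<mapsto> a x\<close> and thus compares the standard resolution
    with the short one.\<close>
  define A where "A = free_lift R (regular_module R) a"
  have A: "linear_on R P\<^sub>0 (regular_module R) (carrier P\<^sub>0) A"
    unfolding A_def P\<^sub>0_def by (rule RR.free_lift_linear) (use a in \<open>auto simp: regular_module_def\<close>)
  have Ac: "A y \<in> carrier R" if "y \<in> carrier P\<^sub>0" for y
    using A that by (auto simp: linear_on_def regular_module_def)
  have Aev: "A y \<odot>\<^bsub>M\<^esub> x = evaluation R M y" if y: "y \<in> carrier P\<^sub>0" for y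
  proof -
    have y': "y \<in> carrier (free_module R (carrier M))" using y by (simp add: P\<^sub>0_def)
    have "A y \<odot>\<^bsub>M\<^esub> x = free_lift R M (\<lambda>z. a z \<odot>\<^bsub>M\<^esub> x) y"
      unfolding A_def
    proof (rule RR.free_lift_compose[OF _ y' _ M])
      show "a \<in> carrier M \<rightarrow> carrier (regular_module R)" using a by (simp add: regular_module_def)
      show "linear_on R (regular_module R) M (carrier (regular_module R)) (\<lambda>b. b \<odot>\<^bsub>M\<^esub> x)"
        using x by (auto simp: linear_on_def regular_module_def M.smult_l_distr M.smult_assoc)
    qed
    also have "\<dots> = evaluation R M y"
      unfolding evaluation_def free_lift_def
      by (rule M.finsum_cong') (use M.support_subset[OF y'] a in \<open>auto simp: Pi_iff subset_iff\<close>)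
    finally show ?thesis .
  qed
  define e where "e = free_basis R x"
  have e: "e \<in> carrier P\<^sub>0" "evaluation R M e = x" "A e = v"
  proof -
    show "e \<in> carrier P\<^sub>0" unfolding e_def P\<^sub>0_def by (rule free_basis_closed[OF R x])
    show "evaluation R M e = x" unfolding e_def by (rule M.evaluation_basis[OF _ x]) simp
    have "A e = a x" unfolding A_def e_def
      by (rule RR.free_lift_basis[OF _ x]) (use a in \<open>auto simp: regular_module_def\<close>)
    then show "A e = v" by (simp add: a_def)
  qed
  have re: "r \<odot>\<^bsub>P\<^sub>0\<^esub> e \<in> Z\<^sub>0"
    unfolding mem_Z0 using e r ev rx by (auto simp: linear_on_def)
  have "(\<forall>f. linear_on R P\<^sub>0 N Z\<^sub>0 f \<longrightarrow> (\<exists>h. linear_on R P\<^sub>0 N (carrier P\<^sub>0) h \<and> (\<forall>z \<in> Z\<^sub>0. h z = f z))) \<longleftrightarrow>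
    (\<forall>t \<in> carrier N. v \<odot>\<^bsub>N\<^esub> t = t \<longrightarrow> (\<exists>s \<in> carrier N. r \<odot>\<^bsub>N\<^esub> s = t))" (is "?L \<longleftrightarrow> ?Rt")
  proof (intro iffI ballI allI impI)
    fix t assume L: ?L and t: "t \<in> carrier N" "v \<odot>\<^bsub>N\<^esub> t = t"
    have "\<exists>b \<in> carrier R. A z \<otimes>\<^bsub>R\<^esub> v = b \<otimes>\<^bsub>R\<^esub> r" if "z \<in> Z\<^sub>0" for z
      using annihilator Ac Aev that by (auto simp: mem_Z0)
    then obtain \<beta> where \<beta>: "\<And>z. z \<in> Z\<^sub>0 \<Longrightarrow> \<beta> z \<in> carrier R \<and> A z \<otimes>\<^bsub>R\<^esub> v = \<beta> z \<otimes>\<^bsub>R\<^esub> r"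
      by metis
    \<comment> \<open>\<open>\<beta>\<close> is a mere choice and need not be linear. Two choices
      agree after multiplication by \<open>r\<close>, hence by \<open>injective\<close> after
      multiplication by \<open>v\<close>, and so they act alike on \<open>t = v t\<close>.\<close>
    have uniq: "b \<odot>\<^bsub>N\<^esub> t = c \<odot>\<^bsub>N\<^esub> t"
      if bc: "b \<in> carrier R" "c \<in> carrier R" "b \<otimes>\<^bsub>R\<^esub> r = c \<otimes>\<^bsub>R\<^esub> r" for b c
    proof -
      have "(b \<ominus>\<^bsub>R\<^esub> c) \<otimes>\<^bsub>R\<^esub> r = \<zero>\<^bsub>R\<^esub>"
        using bc r by (simp add: a_minus_def M.R.l_distr M.R.l_minus M.R.r_neg)
      then have "(b \<ominus>\<^bsub>R\<^esub> c) \<otimes>\<^bsub>R\<^esub> v = \<zero>\<^bsub>R\<^esub>"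
        using injective bc by simp
      then have "((b \<ominus>\<^bsub>R\<^esub> c) \<otimes>\<^bsub>R\<^esub> v) \<odot>\<^bsub>N\<^esub> t = \<zero>\<^bsub>N\<^esub>"
        using t by simp
      then have "(b \<ominus>\<^bsub>R\<^esub> c) \<odot>\<^bsub>N\<^esub> t = \<zero>\<^bsub>N\<^esub>"
        using t bc v by (simp add: N.smult_assoc)
      then show ?thesis
        using bc t N.diff_eq_zero_iff[of "b \<odot>\<^bsub>N\<^esub> t" "c \<odot>\<^bsub>N\<^esub> t"]
        by (simp add: a_minus_def N.smult_l_distr N.smult_l_minus)
    qed
    have "linear_on R P\<^sub>0 N Z\<^sub>0 (\<lambda>z. \<beta> z \<odot>\<^bsub>N\<^esub> t)"
      unfolding linear_on_def
    proof (intro conjI ballI funcsetI)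
      fix z assume z: "z \<in> Z\<^sub>0"
      show "\<beta> z \<odot>\<^bsub>N\<^esub> t \<in> carrier N" using \<beta>[OF z] t by simp
      {
        fix y assume y: "y \<in> Z\<^sub>0"
        have zy: "z \<oplus>\<^bsub>P\<^sub>0\<^esub> y \<in> Z\<^sub>0" using Z0 y z by (simp add: submodule_of_def)
        have "A (z \<oplus>\<^bsub>P\<^sub>0\<^esub> y) = A z \<oplus>\<^bsub>R\<^esub> A y"
          using A y z Z0P0 unfolding linear_on_def regular_simps by blast
        then have "\<beta> (z \<oplus>\<^bsub>P\<^sub>0\<^esub> y) \<otimes>\<^bsub>R\<^esub> r = (\<beta> z \<oplus>\<^bsub>R\<^esub> \<beta> y) \<otimes>\<^bsub>R\<^esub> r"
          using \<beta>[OF z] \<beta>[OF y] \<beta>[OF zy] Ac[of z] Ac[of y] v r y z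
          by (auto simp: mem_Z0 M.R.l_distr)
        then have "\<beta> (z \<oplus>\<^bsub>P\<^sub>0\<^esub> y) \<odot>\<^bsub>N\<^esub> t = (\<beta> z \<oplus>\<^bsub>R\<^esub> \<beta> y) \<odot>\<^bsub>N\<^esub> t"
          using uniq \<beta>[OF z] \<beta>[OF y] \<beta>[OF zy] by simp
        then show "\<beta> (z \<oplus>\<^bsub>P\<^sub>0\<^esub> y) \<odot>\<^bsub>N\<^esub> t = \<beta> z \<odot>\<^bsub>N\<^esub> t \<oplus>\<^bsub>N\<^esub> \<beta> y \<odot>\<^bsub>N\<^esub> t"
          using \<beta>[OF z] \<beta>[OF y] t by (simp add: N.smult_l_distr)
      next
        fix b assume b: "b \<in> carrier R"
        have bz: "b \<odot>\<^bsub>P\<^sub>0\<^esub> z \<in> Z\<^sub>0" using Z0 b z by (simp add: submodule_of_def)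
        have "A (b \<odot>\<^bsub>P\<^sub>0\<^esub> z) = b \<otimes>\<^bsub>R\<^esub> A z"
          using A b z Z0P0 unfolding linear_on_def regular_simps by blast
        then have "\<beta> (b \<odot>\<^bsub>P\<^sub>0\<^esub> z) \<otimes>\<^bsub>R\<^esub> r = (b \<otimes>\<^bsub>R\<^esub> \<beta> z) \<otimes>\<^bsub>R\<^esub> r"
          using \<beta>[OF z] \<beta>[OF bz] Ac[of z] v r b z by (auto simp: mem_Z0 M.R.m_assoc)
        then have "\<beta> (b \<odot>\<^bsub>P\<^sub>0\<^esub> z) \<odot>\<^bsub>N\<^esub> t = (b \<otimes>\<^bsub>R\<^esub> \<beta> z) \<odot>\<^bsub>N\<^esub> t"
          using uniq \<beta>[OF z] \<beta>[OF bz] b by simp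
        then show "\<beta> (b \<odot>\<^bsub>P\<^sub>0\<^esub> z) \<odot>\<^bsub>N\<^esub> t = b \<odot>\<^bsub>N\<^esub> (\<beta> z \<odot>\<^bsub>N\<^esub> t)"
          using \<beta>[OF z] b t by (simp add: N.smult_assoc)
      }
    qed
    then obtain h where h: "linear_on R P\<^sub>0 N (carrier P\<^sub>0) h" "\<And>z. z \<in> Z\<^sub>0 \<Longrightarrow> h z = \<beta> z \<odot>\<^bsub>N\<^esub> t"
      using L by blast
    \<comment> \<open>The witness is \<open>s = h e\<close>: as \<open>A (r e) v = r = v r\<close>,
      the coefficient \<open>\<beta> (r e)\<close> acts on \<open>t\<close> as \<open>v\<close>
      does, and \<open>r (h e) = h (r e) = t\<close>.\<close>
    have "A (r \<odot>\<^bsub>P\<^sub>0\<^esub> e) = r \<otimes>\<^bsub>R\<^esub> A e"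
      using A e r unfolding linear_on_def regular_simps by blast
    then have "\<beta> (r \<odot>\<^bsub>P\<^sub>0\<^esub> e) \<otimes>\<^bsub>R\<^esub> r = v \<otimes>\<^bsub>R\<^esub> r"
      using \<beta>[OF re] e rv vr by simp
    then have "h (r \<odot>\<^bsub>P\<^sub>0\<^esub> e) = t"
      using uniq[OF _ v] \<beta>[OF re] h(2)[OF re] t by simp
    then show "\<exists>s \<in> carrier N. r \<odot>\<^bsub>N\<^esub> s = t"
      using h(1) e r by (intro bexI[of _ "h e"]) (auto simp: linear_on_def)
  next
    fix f assume Rt: ?Rt and f: "linear_on R P\<^sub>0 N Z\<^sub>0 f"
    have fre: "f (r \<odot>\<^bsub>P\<^sub>0\<^esub> e) \<in> carrier N" using f re by (auto simp: linear_on_def)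
    have "v \<odot>\<^bsub>N\<^esub> f (r \<odot>\<^bsub>P\<^sub>0\<^esub> e) = f (v \<odot>\<^bsub>P\<^sub>0\<^esub> (r \<odot>\<^bsub>P\<^sub>0\<^esub> e))"
      using f re v by (simp add: linear_on_def)
    also have "\<dots> = f (r \<odot>\<^bsub>P\<^sub>0\<^esub> e)"
      using e v r vr by (simp add: P0.smult_assoc[symmetric])
    finally obtain t where t: "t \<in> carrier N" "r \<odot>\<^bsub>N\<^esub> t = f (r \<odot>\<^bsub>P\<^sub>0\<^esub> e)"
      using Rt fre by blast
    \<comment> \<open>\<open>p\<close> subtracts from \<open>y\<close> a multiple of
      \<open>e\<close> with the same evaluation, so its values lie in \<open>Z\<^sub>0\<close>,
      where \<open>f\<close> is defined. For \<open>z\<close> in \<open>Z\<^sub>0\<close> the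
      subtracted part is some \<open>b (r e)\<close>, and the summand with \<open>t\<close> in
      \<open>h\<close> below restores its value under \<open>f\<close>.\<close>
    define p where "p y = y \<ominus>\<^bsub>P\<^sub>0\<^esub> (A y \<otimes>\<^bsub>R\<^esub> v) \<odot>\<^bsub>P\<^sub>0\<^esub> e" for y
    have Av_linear: "linear_on R P\<^sub>0 Q (carrier P\<^sub>0) (\<lambda>y. (A y \<otimes>\<^bsub>R\<^esub> v) \<odot>\<^bsub>Q\<^esub> q)"
      if Q: "left_module R Q" and q: "q \<in> carrier Q" for Q :: "('r, 'q) module" and q
    proof -
      interpret Q: left_module R Q by fact
      have "linear_on R (regular_module R) Q (carrier (regular_module R)) (\<lambda>b. (b \<otimes>\<^bsub>R\<^esub> v) \<odot>\<^bsub>Q\<^esub> q)"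
        using q v unfolding linear_on_def regular_simps
        by (auto simp: Q.smult_l_distr Q.smult_assoc)
      from linear_on_compose[OF A this] show ?thesis
        using A by (simp add: linear_on_def)
    qed
    have p: "linear_on R P\<^sub>0 P\<^sub>0 (carrier P\<^sub>0) p"
      unfolding p_def
      by (rule P0.linear_on_diff[OF _ Av_linear[OF P0.left_module_axioms e(1)]])
         (auto simp: linear_on_def)
    have pZ: "p \<in> carrier P\<^sub>0 \<rightarrow> Z\<^sub>0"
    proof
      fix y assume y: "y \<in> carrier P\<^sub>0"
      have c: "(A y \<otimes>\<^bsub>R\<^esub> v) \<odot>\<^bsub>P\<^sub>0\<^esub> e \<in> carrier P\<^sub>0" using Ac[OF y] v e by simp
      have "evaluation R M (p y) = evaluation R M y \<ominus>\<^bsub>M\<^esub> evaluation R M ((A y \<otimes>\<^bsub>R\<^esub> v) \<odot>\<^bsub>P\<^sub>0\<^esub> e)"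
        unfolding p_def by (rule P0.linear_on_minus[OF ev M P0.submodule_carrier y c])
      also have "evaluation R M ((A y \<otimes>\<^bsub>R\<^esub> v) \<odot>\<^bsub>P\<^sub>0\<^esub> e) = (A y \<otimes>\<^bsub>R\<^esub> v) \<odot>\<^bsub>M\<^esub> x"
        using ev e Ac[OF y] v by (simp add: linear_on_def)
      also have "\<dots> = evaluation R M y"
        using Ac[OF y] v x vx Aev[OF y] by (simp add: M.smult_assoc)
      finally show "p y \<in> Z\<^sub>0"
        using p ev y by (auto simp: mem_Z0 linear_on_def Pi_iff)
    qed
    define h where "h y = f (p y) \<oplus>\<^bsub>N\<^esub> (A y \<otimes>\<^bsub>R\<^esub> v) \<odot>\<^bsub>N\<^esub> t" for y
    have "linear_on R P\<^sub>0 N (carrier P\<^sub>0) h"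
      unfolding h_def
      by (rule N.linear_on_add[OF linear_on_compose[OF p f pZ] Av_linear[OF N t(1)]])
    moreover have "h z = f z" if z: "z \<in> Z\<^sub>0" for z
    proof -
      have zP: "z \<in> carrier P\<^sub>0" using z Z0P0 by auto
      obtain b where b: "b \<in> carrier R" "A z \<otimes>\<^bsub>R\<^esub> v = b \<otimes>\<^bsub>R\<^esub> r"
        using annihilator[of "A z"] Ac[OF zP] Aev[OF zP] z by (auto simp: mem_Z0)
      have *: "(A z \<otimes>\<^bsub>R\<^esub> v) \<odot>\<^bsub>P\<^sub>0\<^esub> e = b \<odot>\<^bsub>P\<^sub>0\<^esub> (r \<odot>\<^bsub>P\<^sub>0\<^esub> e)"
        "(A z \<otimes>\<^bsub>R\<^esub> v) \<odot>\<^bsub>N\<^esub> t = b \<odot>\<^bsub>N\<^esub> f (r \<odot>\<^bsub>P\<^sub>0\<^esub> e)"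
        using b r e t by (simp_all add: P0.smult_assoc N.smult_assoc)
      have bz: "b \<odot>\<^bsub>P\<^sub>0\<^esub> (r \<odot>\<^bsub>P\<^sub>0\<^esub> e) \<in> Z\<^sub>0"
        using Z0 b re by (simp add: submodule_of_def)
      have "f (p z) = f z \<ominus>\<^bsub>N\<^esub> f (b \<odot>\<^bsub>P\<^sub>0\<^esub> (r \<odot>\<^bsub>P\<^sub>0\<^esub> e))"
        unfolding p_def * by (rule P0.linear_on_minus[OF f N Z0 z bz])
      also have "f (b \<odot>\<^bsub>P\<^sub>0\<^esub> (r \<odot>\<^bsub>P\<^sub>0\<^esub> e)) = b \<odot>\<^bsub>N\<^esub> f (r \<odot>\<^bsub>P\<^sub>0\<^esub> e)"
        using f b re by (simp add: linear_on_def)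
      moreover have "f z \<in> carrier N" using f z by (auto simp: linear_on_def)
      ultimately show ?thesis
        using b fre unfolding h_def * by (simp add: a_minus_def N.a_assoc N.l_neg)
    qed
    ultimately show "\<exists>h. linear_on R P\<^sub>0 N (carrier P\<^sub>0) h \<and> (\<forall>z \<in> Z\<^sub>0. h z = f z)" by blast
  qed
  then show ?thesis
    using Ext1_trivial_iff_extension[OF M N] by (simp add: P\<^sub>0_def Z\<^sub>0_def)
qed

section \<open>Linear extensions and representations of words\<close>

abbreviation scale :: "'k::field \<Rightarrow> ('b \<Rightarrow>\<^sub>0 'k) \<Rightarrow> ('b \<Rightarrow>\<^sub>0 'k)" where
  "scale c \<equiv> Poly_Mapping.map ((*) c)"

lemma lookup_scale [simp]: "Poly_Mapping.lookup (scale c x) b = c * Poly_Mapping.lookup x b"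
  by (simp add: map.rep_eq when_def)

lemma scale_add_right: "scale c (x + y) = scale c x + scale c y"
  and scale_diff_right: "scale c (x - y) = scale c x - scale c y"
  and scale_scale: "scale c (scale d x) = scale (c * d) x"
  by (rule poly_mapping_eqI; simp add: lookup_add lookup_minus algebra_simps)+

lemma scale_one [simp]: "scale 1 x = x"
  and scale_zero_left [simp]: "scale 0 x = 0"
  and scale_zero_right [simp]: "scale c 0 = 0"
  by (rule poly_mapping_eqI; simp)+

lemma scale_single [simp]: "scale c (Poly_Mapping.single a d) = Poly_Mapping.single a (c * d)"
  by (rule poly_mapping_eqI) (simp add: lookup_single when_def)

lemma scale_mult_left: "scale c f * g = scale c (f * g)" for f :: "'a::monoid_add \<Rightarrow>\<^sub>0 'k::field"
  by (simp add: mult_map_scale_conv_mult mult.assoc)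

lemma poly_mapping_sum_singles:
  fixes x :: "'a \<Rightarrow>\<^sub>0 'b::comm_monoid_add"
  shows "x = (\<Sum>a \<in> Poly_Mapping.keys x. Poly_Mapping.single a (Poly_Mapping.lookup x a))"
  by (rule poly_mapping_eqI)
     (simp add: lookup_sum lookup_single when_def sum.delta in_keys_iff)

text \<open>Additive statements need checking on monomials only. Carrying the set \<open>S\<close>
  along confines later arguments to basis elements that are paths, or to words in the generators of
  the graph.\<close>

lemma poly_mapping_additive_induct [case_names zero single add]:
  fixes x :: "'a \<Rightarrow>\<^sub>0 'b::comm_monoid_add"
  assumes "Poly_Mapping.keys x \<subseteq> S"
    and "P 0" and single: "\<And>a c. a \<in> S \<Longrightarrow> P (Poly_Mapping.single a c)"
    and add: "\<And>x y. P x \<Longrightarrow> P y \<Longrightarrow> P (x + y)"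
  shows "P x"
proof -
  have "P (\<Sum>a \<in> A. Poly_Mapping.single a (Poly_Mapping.lookup x a))" if "finite A" "A \<subseteq> S" for A
    using that by (induction A rule: finite_induct) (auto intro: assms)
  from this[OF finite_keys assms(1)] show ?thesis
    using poly_mapping_sum_singles[of x] by simp
qed

lemma lookup_linear_extension:
  assumes "finite A" "Poly_Mapping.keys x \<subseteq> A"
  shows "Poly_Mapping.lookup (linear_extension f x) b =
    (\<Sum>a \<in> A. Poly_Mapping.lookup x a * Poly_Mapping.lookup (f a) b)"
proof -
  have "Poly_Mapping.lookup (linear_extension f x) b =
      (\<Sum>a \<in> Poly_Mapping.keys x. Poly_Mapping.lookup x a * Poly_Mapping.lookup (f a) b)"
    by (simp add: linear_extension_def lookup_sum)
  also have "\<dots> = (\<Sum>a \<in> A. Poly_Mapping.lookup x a * Poly_Mapping.lookup (f a) b)"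
    by (rule sum.mono_neutral_left) (use assms in \<open>auto simp: in_keys_iff\<close>)
  finally show ?thesis .
qed

lemma linear_extension_zero [simp]: "linear_extension f 0 = 0"
  by (simp add: linear_extension_def)

lemma linear_extension_single [simp]:
  "linear_extension f (Poly_Mapping.single a c) = scale c (f a)"
  by (cases "c = 0") (simp_all add: linear_extension_def)

lemma linear_extension_add: "linear_extension f (x + y) = linear_extension f x + linear_extension f y"
proof (rule poly_mapping_eqI)
  fix b
  have k: "finite (Poly_Mapping.keys x \<union> Poly_Mapping.keys y)" by simp
  show "Poly_Mapping.lookup (linear_extension f (x + y)) b =
      Poly_Mapping.lookup (linear_extension f x + linear_extension f y) b"
    unfolding lookup_add lookup_linear_extension[OF k Un_upper1] lookup_linear_extension[OF k Un_upper2]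
      lookup_linear_extension[OF k Poly_Mapping.keys_add]
    by (simp add: sum.distrib[symmetric] distrib_right)
qed

lemma linear_extension_scale: "linear_extension f (scale c x) = scale c (linear_extension f x)"
proof (rule poly_mapping_eqI)
  fix b
  have k: "Poly_Mapping.keys (scale c x) \<subseteq> Poly_Mapping.keys x"
    by (auto simp: in_keys_iff)
  show "Poly_Mapping.lookup (linear_extension f (scale c x)) b =
      Poly_Mapping.lookup (scale c (linear_extension f x)) b"
    unfolding lookup_scale lookup_linear_extension[OF finite_keys k]
      lookup_linear_extension[where x = x, OF finite_keys order_refl]
    by (simp add: sum_distrib_left mult.assoc)
qed

lemma linear_extension_uminus: "linear_extension f (- x) = - linear_extension f x"
  using linear_extension_add[of f x "- x"] by (simp add: eq_neg_iff_add_eq_0 add.commute)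

lemma linear_extension_diff: "linear_extension f (x - y) = linear_extension f x - linear_extension f y"
  using linear_extension_add[of f x "- y"] by (simp add: linear_extension_uminus)

lemma linear_extension_sum: "linear_extension f (\<Sum>i \<in> A. x i) = (\<Sum>i \<in> A. linear_extension f (x i))"
  by (induction A rule: infinite_finite_induct) (simp_all add: linear_extension_add)

lemma linear_extension_add_fun:
  "linear_extension (\<lambda>a. f a + g a) x = linear_extension f x + linear_extension g x"
  by (simp add: linear_extension_def scale_add_right sum.distrib)

lemma linear_extension_scale_fun:
  "linear_extension (\<lambda>a. scale c (f a)) x = scale c (linear_extension f x)"
proof (rule poly_mapping_additive_induct[of x UNIV])
  show "linear_extension (\<lambda>a. scale c (f a)) (Poly_Mapping.single a d) =
      scale c (linear_extension f (Poly_Mapping.single a d))" for a d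
    by (simp add: scale_scale mult.commute[of c d])
qed (simp_all add: linear_extension_add scale_add_right)

lemma keys_linear_extension:
  assumes "\<And>a. a \<in> Poly_Mapping.keys x \<Longrightarrow> Poly_Mapping.keys (f a) \<subseteq> S"
  shows "Poly_Mapping.keys (linear_extension f x) \<subseteq> S"
proof
  fix b assume "b \<in> Poly_Mapping.keys (linear_extension f x)"
  then have "(\<Sum>a \<in> Poly_Mapping.keys x. Poly_Mapping.lookup x a * Poly_Mapping.lookup (f a) b) \<noteq> 0"
    by (simp add: in_keys_iff lookup_linear_extension[OF finite_keys order_refl])
  then obtain a where "a \<in> Poly_Mapping.keys x" "Poly_Mapping.lookup (f a) b \<noteq> 0"
    by (metis (no_types, lifting) mult_zero_right sum.neutral)
  then show "b \<in> S" using assms[of a] by (auto simp: in_keys_iff)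
qed

lemma linear_extension_cong:
  assumes "\<And>a. a \<in> Poly_Mapping.keys x \<Longrightarrow> f a = g a"
  shows "linear_extension f x = linear_extension g x"
  unfolding linear_extension_def using assms by simp

text \<open>This is \<open>word_action\<close> for an arbitrary basis type and action, so that
  infinite paths and finite paths ending in a sink share one theory;
  \<open>poly_action_eq_poly_rep\<close> links it back.\<close>

definition word_rep :: "('g \<Rightarrow> 'b \<Rightarrow> ('b \<Rightarrow>\<^sub>0 'k::field)) \<Rightarrow> 'g word \<Rightarrow> ('b \<Rightarrow>\<^sub>0 'k) \<Rightarrow> ('b \<Rightarrow>\<^sub>0 'k)" where
  "word_rep act w x = foldr (\<lambda>g. linear_extension (act g)) (letters w) x"

definition poly_rep :: "('g \<Rightarrow> 'b \<Rightarrow> ('b \<Rightarrow>\<^sub>0 'k::field)) \<Rightarrow> ('g word \<Rightarrow>\<^sub>0 'k) \<Rightarrow> ('b \<Rightarrow>\<^sub>0 'k) \<Rightarrow> ('b \<Rightarrow>\<^sub>0 'k)" where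
  "poly_rep act f x = linear_extension (\<lambda>w. word_rep act w x) f"

lemma poly_action_eq_poly_rep: "poly_action E = poly_rep (gen_action E)"
  by (simp add: fun_eq_iff poly_action_def poly_rep_def word_action_def word_rep_def)

lemma word_rep_zero [simp]: "word_rep act 0 x = x"
  by (simp add: word_rep_def zero_word_def)

lemma word_rep_singleton: "word_rep act (Word [g]) x = linear_extension (act g) x"
  by (simp add: word_rep_def)

lemma word_rep_Cons: "word_rep act (Word (g # gs)) x = linear_extension (act g) (word_rep act (Word gs) x)"
  by (simp add: word_rep_def)

lemma word_rep_Nil [simp]: "word_rep act (Word []) x = x"
  by (simp add: word_rep_def)

lemma word_rep_plus: "word_rep act (u + w) x = word_rep act u (word_rep act w x)"
  by (simp add: word_rep_def plus_word_def)

lemma word_rep_add: "word_rep act w (x + y) = word_rep act w x + word_rep act w y"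
proof (cases w)
  case (Word gs)
  show ?thesis unfolding Word by (induction gs) (simp_all add: word_rep_Cons linear_extension_add)
qed

lemma word_rep_scale: "word_rep act w (scale c x) = scale c (word_rep act w x)"
proof (cases w)
  case (Word gs)
  show ?thesis unfolding Word by (induction gs) (simp_all add: word_rep_Cons linear_extension_scale)
qed

lemma poly_rep_simps:
  "poly_rep act 0 x = 0"
  "poly_rep act (f + g) x = poly_rep act f x + poly_rep act g x"
  "poly_rep act (f - g) x = poly_rep act f x - poly_rep act g x"
  "poly_rep act (- f) x = - poly_rep act f x"
  "poly_rep act (sum h A) x = (\<Sum>i \<in> A. poly_rep act (h i) x)"
  "poly_rep act (scale c f) x = scale c (poly_rep act f x)"
  "poly_rep act (Poly_Mapping.single w c) x = scale c (word_rep act w x)"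
  "poly_rep act f (x + y) = poly_rep act f x + poly_rep act f y"
  "poly_rep act f (scale c x) = scale c (poly_rep act f x)"
  by (simp_all add: poly_rep_def linear_extension_add linear_extension_diff linear_extension_uminus
    linear_extension_sum linear_extension_scale linear_extension_add_fun linear_extension_scale_fun
    word_rep_add word_rep_scale)

lemma word_rep_zero_right [simp]: "word_rep act w 0 = 0"
  using word_rep_scale[of act w 0 0] by simp

lemma poly_rep_zero_right [simp]: "poly_rep act f 0 = 0"
  using poly_rep_simps(9)[of act f 0 0] by simp

lemma poly_rep_one [simp]: "poly_rep act 1 x = x"
  by (simp add: single_one[symmetric] poly_rep_simps(7) del: single_one)

lemma poly_rep_gen: "poly_rep act (Poly_Mapping.single (Word [g]) 1) x = linear_extension (act g) x"
  by (simp add: poly_rep_simps word_rep_singleton)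

text \<open>Concatenation of words acts by composition, and both sides are additive in
  \<open>f\<close> and in \<open>g\<close>, so monomials decide.\<close>

lemma poly_rep_mult: "poly_rep act (f * g) x = poly_rep act f (poly_rep act g x)"
proof -
  have *: "poly_rep act (Poly_Mapping.single w c * g) x = scale c (word_rep act w (poly_rep act g x))" for w c
    by (rule poly_mapping_additive_induct[of g UNIV])
       (simp_all add: poly_rep_simps mult_single word_rep_plus distrib_left word_rep_add scale_add_right
          scale_scale word_rep_scale)
  show ?thesis
    by (rule poly_mapping_additive_induct[of f UNIV]) (simp_all add: poly_rep_simps * distrib_right)
qed

lemma keys_word_rep:
  assumes "\<And>g q. g \<in> set (letters w) \<Longrightarrow> q \<in> S \<Longrightarrow> Poly_Mapping.keys (act g q) \<subseteq> S"
    and "Poly_Mapping.keys x \<subseteq> S"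
  shows "Poly_Mapping.keys (word_rep act w x) \<subseteq> S"
proof (cases w)
  case (Word gs)
  have "Poly_Mapping.keys (word_rep act (Word gs) x) \<subseteq> S"
    if "\<And>g q. g \<in> set gs \<Longrightarrow> q \<in> S \<Longrightarrow> Poly_Mapping.keys (act g q) \<subseteq> S"
    using that
  proof (induction gs)
    case (Cons g gs)
    then have "Poly_Mapping.keys (word_rep act (Word gs) x) \<subseteq> S" by auto
    then show ?case unfolding word_rep_Cons
      by (intro keys_linear_extension) (use Cons.prems in auto)
  qed (use assms(2) in simp)
  then show ?thesis using assms(1) Word by simp
qed

section \<open>The free algebra and its quotient\<close>

text \<open>The graph does not mention the field, so the parameter \<open>K\<close> fixes its
  type.\<close>

locale leavitt_graph = fin_digraph E for E :: "('v, 'e) pre_digraph" +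
  fixes K :: "'k::field itself"
begin

abbreviation F :: "('v, 'e, 'k) polynomial ring" where "F \<equiv> free_algebra E"
abbreviation A :: "('v, 'e, 'k) polynomial set" where "A \<equiv> carrier F"
abbreviation I :: "('v, 'e, 'k) polynomial set" where "I \<equiv> lpa_ideal E"
abbreviation L :: "('v, 'e, 'k) lpa_element ring" where "L \<equiv> leavitt E"
abbreviation cls :: "('v, 'e, 'k) polynomial \<Rightarrow> ('v, 'e, 'k) lpa_element" where "cls \<equiv> lpa_class E"
abbreviation vtx :: "'v \<Rightarrow> ('v, 'e, 'k) polynomial" where "vtx v \<equiv> gen (Vertex v)"
abbreviation edg :: "'e \<Rightarrow> ('v, 'e, 'k) polynomial" where "edg e \<equiv> gen (Edge e)"
abbreviation gho :: "'e \<Rightarrow> ('v, 'e, 'k) polynomial" where "gho e \<equiv> gen (Ghost e)"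
abbreviation ok :: "('v, 'e) generator word \<Rightarrow> bool" where "ok w \<equiv> set (letters w) \<subseteq> generators E"

lemma F_simps [simp]: "mult F = (*)" "one F = 1" "zero F = 0" "add F = (+)"
  by (simp_all add: free_algebra_def)

lemma mem_A: "f \<in> A \<longleftrightarrow> Poly_Mapping.keys f \<subseteq> {w. ok w}"
  by (auto simp: free_algebra_def)

lemma A_zero [simp]: "0 \<in> A"
  and A_one [simp]: "1 \<in> A"
  by (auto simp: mem_A zero_word_def)

lemma A_single [intro]: "ok w \<Longrightarrow> Poly_Mapping.single w c \<in> A"
  by (auto simp: mem_A)

lemma A_add [intro]: "f \<in> A \<Longrightarrow> g \<in> A \<Longrightarrow> f + g \<in> A"
  using Poly_Mapping.keys_add[of f g] unfolding mem_A by blast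

lemma A_uminus [intro]: "f \<in> A \<Longrightarrow> - f \<in> A"
  unfolding mem_A by (auto simp: in_keys_iff)

lemma A_diff [intro]: "f \<in> A \<Longrightarrow> g \<in> A \<Longrightarrow> f - g \<in> A"
  using A_add[of f "- g"] by auto

lemma A_mult [intro]: "f \<in> A \<Longrightarrow> g \<in> A \<Longrightarrow> f * g \<in> A"
  using Poly_Mapping.keys_mult[of f g] unfolding mem_A by (fastforce simp: plus_word_def)

lemma A_sum [intro]: "(\<And>i. i \<in> S \<Longrightarrow> f i \<in> A) \<Longrightarrow> sum f S \<in> A"
  by (induction S rule: infinite_finite_induct) auto

lemma A_scale [intro]: "f \<in> A \<Longrightarrow> scale c f \<in> A"
  unfolding mem_A by (auto simp: in_keys_iff)

lemma A_gen [simp]: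
  "v \<in> verts E \<Longrightarrow> vtx v \<in> A" "e \<in> arcs E \<Longrightarrow> edg e \<in> A" "e \<in> arcs E \<Longrightarrow> gho e \<in> A"
  by (auto simp: generators_def)

lemma ring_F: "ring F"
proof (rule ringI)
  show "abelian_group F"
    by (rule abelian_groupI) (auto intro: exI[of _ "- _"] bexI[of _ "- _"])
  show "Group.monoid F" by (rule monoidI) (auto simp: mult.assoc)
qed (auto simp: algebra_simps)

lemma relations_subset: "lpa_relations E \<subseteq> A"
  unfolding lpa_relations_def by (auto intro!: A_mult A_diff A_sum simp: tail_in_verts head_in_verts)

lemma ideal_I: "ideal I F"
  unfolding lpa_ideal_def by (rule ring.genideal_ideal[OF ring_F relations_subset])

lemma relation_in_I: "f \<in> lpa_relations E \<Longrightarrow> f \<in> I"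
  unfolding lpa_ideal_def using ring.genideal_self[OF ring_F relations_subset] by auto

text \<open>\<open>I\<close> is known only through its generators. A property of its members is
  proved by showing that the polynomials with this property form an ideal that contains the
  relations.\<close>

lemma I_minimal: "ideal J F \<Longrightarrow> lpa_relations E \<subseteq> J \<Longrightarrow> I \<subseteq> J"
  unfolding lpa_ideal_def by (rule ring.genideal_minimal[OF ring_F])

lemma I_subset: "f \<in> I \<Longrightarrow> f \<in> A"
  using ideal_I by (simp add: ideal.Icarr)

lemma I_zero [simp]: "0 \<in> I"
  and I_add [intro]: "f \<in> I \<Longrightarrow> g \<in> I \<Longrightarrow> f + g \<in> I"
  and I_uminus [intro]: "f \<in> I \<Longrightarrow> - f \<in> I"
  and I_mult_left [intro]: "f \<in> I \<Longrightarrow> g \<in> A \<Longrightarrow> g * f \<in> I"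
  and I_mult_right [intro]: "f \<in> I \<Longrightarrow> g \<in> A \<Longrightarrow> f * g \<in> I"
proof -
  interpret ideal I F by (rule ideal_I)
  show "0 \<in> I" "f \<in> I \<Longrightarrow> g \<in> I \<Longrightarrow> f + g \<in> I"
    "f \<in> I \<Longrightarrow> g \<in> A \<Longrightarrow> g * f \<in> I" "f \<in> I \<Longrightarrow> g \<in> A \<Longrightarrow> f * g \<in> I"
    using additive_subgroup.zero_closed[OF ideal.axioms(1)[OF ideal_I]]
      additive_subgroup.a_closed[OF ideal.axioms(1)[OF ideal_I], of f g]
      I_l_closed[of f g] I_r_closed[of f g] by simp_all
  show "f \<in> I \<Longrightarrow> - f \<in> I"
    using I_l_closed[of f "- 1"] A_uminus[OF A_one] by simp
qed

lemma I_diff [intro]: "f \<in> I \<Longrightarrow> g \<in> I \<Longrightarrow> f - g \<in> I"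
  using I_add[of f "- g"] by auto

lemma I_sum [intro]: "(\<And>i. i \<in> S \<Longrightarrow> f i \<in> I) \<Longrightarrow> sum f S \<in> I"
  by (induction S rule: infinite_finite_induct) auto

lemma cls_def': "cls f = (\<lambda>i. i + f) ` I"
  by (auto simp: lpa_class_def a_r_coset_def r_coset_def)

lemma cls_eq_iff:
  "cls f = cls g \<longleftrightarrow> f - g \<in> I"
proof
  assume "cls f = cls g"
  moreover have "f \<in> cls f" unfolding cls_def' by (rule image_eqI[of _ _ 0]) auto
  ultimately obtain i where "i \<in> I" "f = i + g" unfolding cls_def' by blast
  then show "f - g \<in> I" by simp
next
  assume d: "f - g \<in> I"
  show "cls f = cls g"
  proof (intro equalityI subsetI)
    fix x assume "x \<in> cls f"
    then obtain i where "i \<in> I" "x = i + f" unfolding cls_def' by blast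
    then have "x = (i + (f - g)) + g" "i + (f - g) \<in> I" using d by auto
    then show "x \<in> cls g" unfolding cls_def' by blast
  next
    fix x assume "x \<in> cls g"
    then obtain i where "i \<in> I" "x = i + g" unfolding cls_def' by blast
    then have "x = (i - (f - g)) + f" "i - (f - g) \<in> I" using d by auto
    then show "x \<in> cls f" unfolding cls_def' by blast
  qed
qed

section \<open>Polynomials without constant term and the ring \<open>L\<close>\<close>

definition A0 :: "('v, 'e, 'k) polynomial set" where
  "A0 = {f \<in> A. 0 \<notin> Poly_Mapping.keys f}"

lemma A0_subset: "f \<in> A0 \<Longrightarrow> f \<in> A"
  by (simp add: A0_def)

lemma A0_zero [simp]: "0 \<in> A0"
  by (simp add: A0_def)

lemma A0_add [intro]: "f \<in> A0 \<Longrightarrow> g \<in> A0 \<Longrightarrow> f + g \<in> A0"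
  by (auto simp: A0_def in_keys_iff lookup_add)

lemma A0_uminus [intro]: "f \<in> A0 \<Longrightarrow> - f \<in> A0"
  by (auto simp: A0_def in_keys_iff)

lemma A0_diff [intro]: "f \<in> A0 \<Longrightarrow> g \<in> A0 \<Longrightarrow> f - g \<in> A0"
  using A0_add[of f "- g"] by auto

lemma word_plus_eq_zero_iff: "a + b = (0 :: 'a word) \<longleftrightarrow> a = 0 \<and> b = 0"
  by (cases a; cases b) (simp add: plus_word_def zero_word_def)

text \<open>A product of words is empty only if both factors are, so it is enough that the right
  factor lies in \<open>A0\<close>. Hence multiplication by a vertex on the right turns any
  polynomial in \<open>A\<close> into a representative of an element of \<open>L\<close>.\<close>

lemma A0_mult [intro]: "f \<in> A \<Longrightarrow> g \<in> A0 \<Longrightarrow> f * g \<in> A0"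
  using Poly_Mapping.keys_mult[of f g] A_mult[of f g]
  by (fastforce simp: A0_def word_plus_eq_zero_iff)

lemma A0_single: "ok w \<Longrightarrow> w \<noteq> 0 \<Longrightarrow> Poly_Mapping.single w c \<in> A0"
  by (auto simp: A0_def)

lemma A0_vtx [simp]: "v \<in> verts E \<Longrightarrow> vtx v \<in> A0"
  by (rule A0_single) (auto simp: zero_word_def generators_def)

lemma A0_sum [intro]: "(\<And>i. i \<in> S \<Longrightarrow> f i \<in> A0) \<Longrightarrow> sum f S \<in> A0"
  by (induction S rule: infinite_finite_induct) auto

lemma L_carrier: "carrier L = cls ` A0"
  by (simp add: leavitt_def A0_def)

lemma L_zero: "\<zero>\<^bsub>L\<^esub> = cls 0"
  by (simp add: leavitt_def FactRing_def cls_def')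

lemma L_one: "\<one>\<^bsub>L\<^esub> = cls (\<Sum>v \<in> verts E. vtx v)"
  by (simp add: leavitt_def)

lemma L_add: "f \<in> A \<Longrightarrow> g \<in> A \<Longrightarrow> cls f \<oplus>\<^bsub>L\<^esub> cls g = cls (f + g)"
proof -
  interpret ideal I F by (rule ideal_I)
  show "f \<in> A \<Longrightarrow> g \<in> A \<Longrightarrow> cls f \<oplus>\<^bsub>L\<^esub> cls g = cls (f + g)"
    using a_rcos_sum[of f g] by (simp add: leavitt_def FactRing_def lpa_class_def)
qed

lemma L_mult: "f \<in> A \<Longrightarrow> g \<in> A \<Longrightarrow> cls f \<otimes>\<^bsub>L\<^esub> cls g = cls (f * g)"
proof -
  interpret ideal I F by (rule ideal_I)
  show "f \<in> A \<Longrightarrow> g \<in> A \<Longrightarrow> cls f \<otimes>\<^bsub>L\<^esub> cls g = cls (f * g)"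
    using rcoset_mult_add[of f g] by (simp add: leavitt_def FactRing_def lpa_class_def)
qed


lemma eqv_sym: "f - g \<in> I \<Longrightarrow> g - f \<in> I"
  using I_uminus[of "f - g"] by simp

lemma eqv_trans: "f - g \<in> I \<Longrightarrow> g - h \<in> I \<Longrightarrow> f - h \<in> I"
  using I_add[of "f - g" "g - h"] by simp

lemma eqv_mult_left: "f - g \<in> I \<Longrightarrow> h \<in> A \<Longrightarrow> h * f - h * g \<in> I"
  using I_mult_left[of "f - g" h] by (simp add: right_diff_distrib)

lemma eqv_mult_right: "f - g \<in> I \<Longrightarrow> h \<in> A \<Longrightarrow> f * h - g * h \<in> I"
  using I_mult_right[of "f - g" h] by (simp add: left_diff_distrib)

lemma relation_V: "v \<in> verts E \<Longrightarrow> u \<in> verts E \<Longrightarrow> vtx v * vtx u - (if v = u then vtx v else 0) \<in> I"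
  and relation_E1: "e \<in> arcs E \<Longrightarrow> vtx (tail E e) * edg e - edg e \<in> I"
    "e \<in> arcs E \<Longrightarrow> edg e * vtx (head E e) - edg e \<in> I"
  and relation_E2: "e \<in> arcs E \<Longrightarrow> vtx (head E e) * gho e - gho e \<in> I"
    "e \<in> arcs E \<Longrightarrow> gho e * vtx (tail E e) - gho e \<in> I"
  and relation_CK1: "e \<in> arcs E \<Longrightarrow> e' \<in> arcs E \<Longrightarrow>
    gho e * edg e' - (if e = e' then vtx (head E e) else 0) \<in> I"
  by (rule relation_in_I, unfold lpa_relations_def, blast)+

text \<open>Each letter is fixed on either side by some vertex, and the sum of all vertices fixes
  that vertex because the vertices are orthogonal idempotents.\<close>

lemma vertex_sum_letter:
  assumes g: "g \<in> generators E"
  shows "(\<Sum>v \<in> verts E. vtx v) * gen g - gen g \<in> I" "gen g * (\<Sum>v \<in> verts E. vtx v) - gen g \<in> I"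
proof -
  define \<iota> where "\<iota> = (\<Sum>v \<in> verts E. vtx v)"
  have \<iota>A: "\<iota> \<in> A" unfolding \<iota>_def by auto
  have gA: "gen g \<in> A" using g by auto
  have absorb: "\<iota> * vtx u - vtx u \<in> I" "vtx u * \<iota> - vtx u \<in> I" if u: "u \<in> verts E" for u
  proof -
    have "(\<Sum>v \<in> verts E. vtx v * vtx u - (if v = u then vtx v else 0)) \<in> I"
      "(\<Sum>v \<in> verts E. vtx u * vtx v - (if u = v then vtx u else 0)) \<in> I"
      using u by (auto intro!: I_sum relation_V)
    then show "\<iota> * vtx u - vtx u \<in> I" "vtx u * \<iota> - vtx u \<in> I"
      using u by (simp_all add: \<iota>_def sum_subtractf sum_distrib_left sum_distrib_right sum.delta sum.delta')
  qed
  have left: "\<iota> * gen g - gen g \<in> I" if u: "u \<in> verts E" "vtx u * gen g - gen g \<in> I" for u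
  proof -
    have 1: "\<iota> * gen g - \<iota> * (vtx u * gen g) \<in> I"
      by (rule eqv_mult_left[OF eqv_sym[OF u(2)] \<iota>A])
    have 2: "\<iota> * (vtx u * gen g) - vtx u * gen g \<in> I"
      using eqv_mult_right[OF absorb(1)[OF u(1)] gA] by (simp add: mult.assoc)
    show ?thesis by (rule eqv_trans[OF 1 eqv_trans[OF 2 u(2)]])
  qed
  have right: "gen g * \<iota> - gen g \<in> I" if u: "u \<in> verts E" "gen g * vtx u - gen g \<in> I" for u
  proof -
    have 1: "gen g * \<iota> - (gen g * vtx u) * \<iota> \<in> I"
      by (rule eqv_mult_right[OF eqv_sym[OF u(2)] \<iota>A])
    have 2: "(gen g * vtx u) * \<iota> - gen g * vtx u \<in> I"
      using eqv_mult_left[OF absorb(2)[OF u(1)] gA] by (simp add: mult.assoc)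
    show ?thesis by (rule eqv_trans[OF 1 eqv_trans[OF 2 u(2)]])
  qed
  have "\<exists>u \<in> verts E. vtx u * gen g - gen g \<in> I" "\<exists>u \<in> verts E. gen g * vtx u - gen g \<in> I"
    using g relation_V relation_E1 relation_E2 tail_in_verts head_in_verts
    unfolding generators_def by fastforce+
  then show "\<iota> * gen g - gen g \<in> I" "gen g * \<iota> - gen g \<in> I"
    using left right by auto
qed

text \<open>On the left only the first letter of a word matters, on the right only the last. The
  empty word has neither, hence the restriction to \<open>A0\<close>.\<close>

lemma vertex_sum_unit:
  assumes f: "f \<in> A0"
  shows "(\<Sum>v \<in> verts E. vtx v) * f - f \<in> I" "f * (\<Sum>v \<in> verts E. vtx v) - f \<in> I"
proof -
  define \<iota> where "\<iota> = (\<Sum>v \<in> verts E. vtx v)"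
  have kf: "Poly_Mapping.keys f \<subseteq> {w. ok w \<and> w \<noteq> 0}"
    using f by (auto simp: A0_def mem_A)
  have "\<iota> * f - f \<in> I \<and> f * \<iota> - f \<in> I"
    using kf
  proof (rule poly_mapping_additive_induct)
    fix w and c :: 'k
    assume "w \<in> {w. ok w \<and> w \<noteq> 0}"
    then obtain gs where w: "w = Word gs" "set gs \<subseteq> generators E" "gs \<noteq> []"
      by (cases w) (auto simp: zero_word_def)
    have 1: "Poly_Mapping.single w c = gen (hd gs) * Poly_Mapping.single (Word (tl gs)) c"
      using w by (simp add: mult_single plus_word_def)
    have 2: "Poly_Mapping.single w c = Poly_Mapping.single (Word (butlast gs)) c * gen (last gs)"
      using w by (simp add: mult_single plus_word_def)
    have A: "Poly_Mapping.single (Word (tl gs)) c \<in> A" "Poly_Mapping.single (Word (butlast gs)) c \<in> A"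
      using w by (intro A_single; simp; meson in_set_butlastD list.set_sel(2) subset_iff)+
    have g: "hd gs \<in> generators E" "last gs \<in> generators E"
      using w by auto
    have "\<iota> * Poly_Mapping.single w c - Poly_Mapping.single w c \<in> I"
      unfolding 1 using eqv_mult_right[OF vertex_sum_letter(1)[OF g(1)] A(1)] by (simp add: \<iota>_def mult.assoc)
    moreover have "Poly_Mapping.single w c * \<iota> - Poly_Mapping.single w c \<in> I"
      unfolding 2 using eqv_mult_left[OF vertex_sum_letter(2)[OF g(2)] A(2)] by (simp add: \<iota>_def mult.assoc)
    ultimately show "\<iota> * Poly_Mapping.single w c - Poly_Mapping.single w c \<in> I \<and>
      Poly_Mapping.single w c * \<iota> - Poly_Mapping.single w c \<in> I" by blast
  next
    fix x y assume "\<iota> * x - x \<in> I \<and> x * \<iota> - x \<in> I" "\<iota> * y - y \<in> I \<and> y * \<iota> - y \<in> I"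
    then show "\<iota> * (x + y) - (x + y) \<in> I \<and> (x + y) * \<iota> - (x + y) \<in> I"
      using I_add[of "\<iota> * x - x" "\<iota> * y - y"] I_add[of "x * \<iota> - x" "y * \<iota> - y"]
      by (simp add: algebra_simps)
  qed simp
  then show "\<iota> * f - f \<in> I" "f * \<iota> - f \<in> I" by auto
qed

lemma ring_L: "ring L"
proof (rule ringI)
  have cl: "cls f \<in> carrier L \<longleftrightarrow> (\<exists>g \<in> A0. cls f = cls g)" for f
    by (auto simp: L_carrier)
  have clI: "f \<in> A0 \<Longrightarrow> cls f \<in> carrier L" for f
    by (simp add: L_carrier)
  show "abelian_group L"
  proof (rule abelian_groupI)
    fix x assume "x \<in> carrier L"
    then obtain f where f: "f \<in> A0" "x = cls f" by (auto simp: L_carrier)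
    then have "cls (- f) \<oplus>\<^bsub>L\<^esub> x = \<zero>\<^bsub>L\<^esub>"
      by (simp add: L_add A0_subset L_zero A0_uminus)
    then show "\<exists>y\<in>carrier L. y \<oplus>\<^bsub>L\<^esub> x = \<zero>\<^bsub>L\<^esub>"
      using clI[OF A0_uminus[OF f(1)]] by blast
  qed (auto simp: L_carrier L_add L_zero A0_subset A0_add A_add add_ac)
  show "Group.monoid L"
  proof (rule monoidI)
    show "\<one>\<^bsub>L\<^esub> \<in> carrier L" unfolding L_one by (intro clI A0_sum) simp
    fix x assume "x \<in> carrier L"
    then obtain f where f: "f \<in> A0" "x = cls f" by (auto simp: L_carrier)
    have s: "(\<Sum>v \<in> verts E. vtx v) \<in> A" by auto
    show "\<one>\<^bsub>L\<^esub> \<otimes>\<^bsub>L\<^esub> x = x" "x \<otimes>\<^bsub>L\<^esub> \<one>\<^bsub>L\<^esub> = x"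
      using vertex_sum_unit[OF f(1)] f s by (simp_all add: L_one L_mult A0_subset cls_eq_iff)
  qed (auto simp: L_carrier L_mult A0_subset A0_mult A_mult mult.assoc)
qed (auto simp: L_carrier L_mult L_add A0_subset A0_mult A_mult A_add algebra_simps)

lemma uminus_F: "f \<in> A \<Longrightarrow> \<ominus>\<^bsub>F\<^esub> f = - f"
  by (rule abelian_group.minus_equality[OF ring.is_abelian_group[OF ring_F]]) auto

lemma ideal_F_I:
  assumes "J \<subseteq> A" "0 \<in> J" "\<And>f g. f \<in> J \<Longrightarrow> g \<in> J \<Longrightarrow> f + g \<in> J"
    and left: "\<And>f a. f \<in> J \<Longrightarrow> a \<in> A \<Longrightarrow> a * f \<in> J"
    and right: "\<And>f a. f \<in> J \<Longrightarrow> a \<in> A \<Longrightarrow> f * a \<in> J"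
  shows "ideal J F"
proof (rule idealI[OF ring_F])
  have neg: "- f \<in> J" if "f \<in> J" for f
    using left[OF that A_uminus[OF A_one]] by simp
  show "subgroup J (add_monoid F)"
  proof (rule subgroup.intro)
    fix f assume f: "f \<in> J"
    then have "inv\<^bsub>add_monoid F\<^esub> f = - f"
      using uminus_F[of f] assms(1) by (auto simp: a_inv_def)
    then show "inv\<^bsub>add_monoid F\<^esub> f \<in> J" using neg[OF f] by simp
  qed (use assms in auto)
qed (use left right in auto)

text \<open>Containing \<open>I\<close> keeps congruences modulo \<open>I\<close> valid modulo
  \<open>J\<close>. Two instances matter: \<open>I\<close> itself for the sinks, and the left ideal
  of the relator for \<open>d\<^sup>\<infinity>\<close>.\<close>

definition left_ideal_mod :: "('v, 'e, 'k) polynomial set \<Rightarrow> bool" where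
  "left_ideal_mod J \<longleftrightarrow> I \<subseteq> J \<and> (\<forall>f \<in> J. \<forall>g \<in> J. f + g \<in> J) \<and> (\<forall>a \<in> A. \<forall>f \<in> J. a * f \<in> J)"

lemma left_ideal_mod_I: "left_ideal_mod I"
  by (auto simp: left_ideal_mod_def)

lemma left_ideal_modD:
  assumes "left_ideal_mod J"
  shows "f \<in> I \<Longrightarrow> f \<in> J" "f \<in> J \<Longrightarrow> g \<in> J \<Longrightarrow> f + g \<in> J" "a \<in> A \<Longrightarrow> f \<in> J \<Longrightarrow> a * f \<in> J"
    "f - g \<in> J \<Longrightarrow> g - f \<in> J" "f - g \<in> J \<Longrightarrow> g - h \<in> J \<Longrightarrow> f - h \<in> J"
    "f \<in> J \<Longrightarrow> scale c f \<in> J" "a \<in> A \<Longrightarrow> f - g \<in> J \<Longrightarrow> a * f - a * g \<in> J"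
proof -
  show *: "f \<in> I \<Longrightarrow> f \<in> J" "\<And>f g. f \<in> J \<Longrightarrow> g \<in> J \<Longrightarrow> f + g \<in> J"
    "\<And>a f. a \<in> A \<Longrightarrow> f \<in> J \<Longrightarrow> a * f \<in> J" for f
    using assms by (auto simp: left_ideal_mod_def)
  show "f - g \<in> J \<Longrightarrow> g - f \<in> J"
    using *(3)[of "-1" "f - g"] A_uminus[OF A_one] by simp
  show "f - g \<in> J \<Longrightarrow> g - h \<in> J \<Longrightarrow> f - h \<in> J"
    using *(2)[of "f - g" "g - h"] by simp
  show "f \<in> J \<Longrightarrow> scale c f \<in> J"
    using *(3)[of "Poly_Mapping.single 0 c" f] A_single[of 0 c]
    by (simp add: mult_map_scale_conv_mult zero_word_def)
  show "a \<in> A \<Longrightarrow> f - g \<in> J \<Longrightarrow> a * f - a * g \<in> J"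
    using *(3)[of a "f - g"] by (simp add: right_diff_distrib)
qed

lemma orthogonal:
  "v \<in> verts E \<Longrightarrow> u \<in> verts E \<Longrightarrow> v \<noteq> u \<Longrightarrow> vtx v * vtx u \<in> I"
  "e \<in> arcs E \<Longrightarrow> u \<in> verts E \<Longrightarrow> head E e \<noteq> u \<Longrightarrow> edg e * vtx u \<in> I"
  "e \<in> arcs E \<Longrightarrow> u \<in> verts E \<Longrightarrow> tail E e \<noteq> u \<Longrightarrow> gho e * vtx u \<in> I"
proof -
  show V: "vtx v * vtx u \<in> I" if "v \<in> verts E" "u \<in> verts E" "v \<noteq> u" for v u
    using relation_V[OF that(1,2)] that(3) by simp
  have aux: "x * vtx u \<in> I" if "x \<in> A" "x * vtx v - x \<in> I" "v \<in> verts E" "u \<in> verts E" "v \<noteq> u" for x v u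
    using I_add[OF I_mult_left[OF V[OF that(3,4,5)] that(1)] eqv_mult_right[OF eqv_sym[OF that(2)], of "vtx u"]]
      that(4) by (simp add: mult.assoc)
  show "e \<in> arcs E \<Longrightarrow> u \<in> verts E \<Longrightarrow> head E e \<noteq> u \<Longrightarrow> edg e * vtx u \<in> I"
    by (rule aux[of _ "head E e"]) (auto simp: relation_E1)
  show "e \<in> arcs E \<Longrightarrow> u \<in> verts E \<Longrightarrow> tail E e \<noteq> u \<Longrightarrow> gho e * vtx u \<in> I"
    by (rule aux[of _ "tail E e"]) (auto simp: relation_E2)
qed

text \<open>The empty list gives the identity of the free algebra, which has no endpoint. A path
  that may be trivial is therefore used in the form \<open>epath es * vtx v\<close>.\<close>

definition epath :: "'e list \<Rightarrow> ('v, 'e, 'k) polynomial" where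
  "epath es = Poly_Mapping.single (Word (map Edge es)) 1"

lemma epath_Nil [simp]: "epath [] = 1"
  unfolding epath_def by (simp add: zero_word_def[symmetric])

lemma epath_Cons: "epath (e # es) = edg e * epath es"
  by (simp add: epath_def mult_single plus_word_def)

lemma epath_append: "epath (es @ fs) = epath es * epath fs"
  by (simp add: epath_def mult_single plus_word_def)

lemma epath_in_A [intro]: "set es \<subseteq> arcs E \<Longrightarrow> epath es \<in> A"
  unfolding epath_def by (rule A_single) (auto simp: generators_def)

lemma vtx_epath:
  assumes "set es \<subseteq> arcs E" "es \<noteq> []"
  shows "vtx (tail E (hd es)) * epath es - epath es \<in> I"
proof (cases es)
  case (Cons e fs)
  then have "epath fs \<in> A" using assms by auto
  from eqv_mult_right[OF relation_E1(1) this] show ?thesis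
    using assms Cons by (simp add: epath_Cons mult.assoc)
qed (use assms in simp)

lemma epath_vtx:
  assumes "cas u es v" "set es \<subseteq> arcs E" "es \<noteq> []"
  shows "epath es * vtx v - epath es \<in> I"
  using assms
proof (induction es arbitrary: u)
  case (Cons e es)
  show ?case
  proof (cases "es = []")
    case True
    then show ?thesis using Cons.prems relation_E1(2)[of e] by (simp add: epath_Cons)
  next
    case False
    have "epath es * vtx v - epath es \<in> I" using Cons False by auto
    from eqv_mult_left[OF this, of "edg e"] show ?thesis
      using Cons.prems by (simp add: epath_Cons mult.assoc)
  qed
qed simp

section \<open>The grading\<close>

fun letter_degree :: "('v, 'e) generator \<Rightarrow> int" where
  "letter_degree (Vertex v) = 0"
| "letter_degree (Edge e) = 1"
| "letter_degree (Ghost e) = - 1"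

definition word_degree :: "('v, 'e) generator word \<Rightarrow> int" where
  "word_degree w = (\<Sum>g \<leftarrow> letters w. letter_degree g)"

lemma word_degree_plus: "word_degree (u + w) = word_degree u + word_degree w"
  by (simp add: word_degree_def plus_word_def)

definition component :: "int \<Rightarrow> ('v, 'e, 'k) polynomial \<Rightarrow> ('v, 'e, 'k) polynomial" where
  "component i f = linear_extension (\<lambda>w. if word_degree w = i then Poly_Mapping.single w 1 else 0) f"

lemma component_simps [simp]:
  "component i 0 = 0"
  "component i (f + g) = component i f + component i g"
  "component i (f - g) = component i f - component i g"
  "component i (sum h S) = (\<Sum>j \<in> S. component i (h j))"
  "component i (Poly_Mapping.single w c) = (if word_degree w = i then Poly_Mapping.single w c else 0)"
  by (simp_all add: component_def linear_extension_add linear_extension_diff linear_extension_sum)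

lemma component_single_mult:
  "component i (Poly_Mapping.single w c * f) = Poly_Mapping.single w c * component (i - word_degree w) f"
  by (rule poly_mapping_additive_induct[of f UNIV])
     (auto simp: distrib_left mult_single word_degree_plus)

lemma component_mult_single:
  "component i (f * Poly_Mapping.single w c) = component (i - word_degree w) f * Poly_Mapping.single w c"
  by (rule poly_mapping_additive_induct[of f UNIV])
     (auto simp: distrib_right mult_single word_degree_plus)

lemma lookup_component:
  "Poly_Mapping.lookup (component i f) w = (if word_degree w = i then Poly_Mapping.lookup f w else 0)"
  by (rule poly_mapping_additive_induct[of f UNIV]) (auto simp: lookup_add lookup_single when_def)

lemma sum_components: "f = (\<Sum>i \<in> word_degree ` Poly_Mapping.keys f. component i f)"
  by (rule poly_mapping_eqI) (auto simp: lookup_sum lookup_component sum.delta' in_keys_iff)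

text \<open>Each relation is homogeneous, and the polynomials with all components in
  \<open>I\<close> form an ideal, so \<open>I\<close> is graded.\<close>

lemma component_in_I:
  assumes "f \<in> I" shows "component i f \<in> I"
proof -
  define J where "J = {f \<in> A. \<forall>i. component i f \<in> I}"
  have "ideal J F"
  proof (rule ideal_F_I)
    fix f a assume f: "f \<in> J" and a: "a \<in> A"
    have k: "Poly_Mapping.keys a \<subseteq> {w. ok w}" using a by (simp add: mem_A)
    have "component i (a * f) \<in> I" for i
      using k
    proof (rule poly_mapping_additive_induct)
      show "component i (Poly_Mapping.single w c * f) \<in> I" if "w \<in> {w. ok w}" for w c
        unfolding component_single_mult using f that by (intro I_mult_left) (auto simp: J_def)
    qed (auto simp: distrib_right)
    then show "a * f \<in> J" using f a by (auto simp: J_def)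
    have "component i (f * a) \<in> I" for i
      using k
    proof (rule poly_mapping_additive_induct)
      show "component i (f * Poly_Mapping.single w c) \<in> I" if "w \<in> {w. ok w}" for w c
        unfolding component_mult_single using f that by (intro I_mult_right) (auto simp: J_def)
    qed (auto simp: distrib_left)
    then show "f * a \<in> J" using f a by (auto simp: J_def)
  qed (auto simp: J_def)
  moreover have "lpa_relations E \<subseteq> J"
  proof
    fix f :: "('v, 'e, 'k) polynomial" assume f: "f \<in> lpa_relations E"
    have "component i f = f \<or> component i f = 0" for i
      using f unfolding lpa_relations_def
      by (elim UnE CollectE exE conjE)
         (simp_all add: mult_single plus_word_def word_degree_def split: if_splits)
    then show "f \<in> J"
      using relation_in_I[OF f] relations_subset f unfolding J_def
      by (smt (verit, best) I_zero mem_Collect_eq subset_iff)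
  qed
  ultimately have "I \<subseteq> J" by (rule I_minimal)
  then show ?thesis using assms by (auto simp: J_def)
qed

text \<open>The components of \<open>b\<close> in low degrees vanish, and multiplication by a path of positive
  length carries each component of \<open>b\<close> to one of higher degree.\<close>

lemma fixed_by_path_in_I:
  assumes b: "b \<in> A" "b * epath d - b \<in> I" and d: "d \<noteq> []" "set d \<subseteq> arcs E"
  shows "b \<in> I"
proof -
  define m where "m = int (length d)"
  have m: "m > 0" using d by (simp add: m_def)
  have wd: "word_degree (Word (map Edge d)) = m"
  proof -
    have "(\<Sum>e \<leftarrow> es. (1 :: int)) = int (length es)" for es :: "'e list" by (induction es) auto
    then show ?thesis by (simp add: word_degree_def m_def comp_def)
  qed
  have step: "component i b \<in> I" if "component (i - m) b \<in> I" for i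
  proof -
    have "component (i - m) b * epath d - component i b \<in> I"
      using component_in_I[OF b(2), of i] by (simp add: epath_def component_mult_single wd)
    from I_diff[OF I_mult_right[OF that epath_in_A[OF d(2)]] this] show ?thesis by simp
  qed
  \<comment> \<open>A crude lower bound for the degrees in \<open>b\<close>; unlike a minimum, the
    sum also makes sense for \<open>b = 0\<close>.\<close>
  define N where "N = - (\<Sum>w \<in> Poly_Mapping.keys b. \<bar>word_degree w\<bar>)"
  have low: "N \<le> word_degree w" if "w \<in> Poly_Mapping.keys b" for w
    using member_le_sum[OF that, of "\<lambda>w. \<bar>word_degree w\<bar>"] by (simp add: N_def)
  have "component i b \<in> I" if "i < N + int n" for i n
    using that
  proof (induction n arbitrary: i)
    case 0
    have "component i b = 0"
      by (rule poly_mapping_eqI) (use low 0 in \<open>force simp: lookup_component in_keys_iff\<close>)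
    then show ?case by simp
  next
    case (Suc n)
    show ?case by (rule step, rule Suc.IH) (use Suc.prems m in simp)
  qed
  note all = this
  \<comment> \<open>The bound in \<open>all\<close> is strict, which accounts for the
    \<open>+ 1\<close>; for \<open>i < N\<close> the truncation by \<open>nat\<close> to zero
    suffices.\<close>
  have "component i b \<in> I" for i
    by (rule all[of i "nat (i - N + 1)"]) arith
  then show ?thesis
    using sum_components[of b] by (metis I_sum)
qed

end


section \<open>Path spaces\<close>

text \<open>
  Both kinds of Chen modules are spanned by paths that are stable under prefixing an edge: the
  infinite paths in a tail class, and the finite paths ending in a sink.
\<close>

locale path_space = leavitt_graph E K
  for E :: "('v, 'e) pre_digraph" and K :: "'k::field itself" +
  fixes S :: "'b set" and src :: "'b \<Rightarrow> 'v" and cons :: "'e \<Rightarrow> 'b \<Rightarrow> 'b"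
    and act :: "('v, 'e) generator \<Rightarrow> 'b \<Rightarrow> ('b \<Rightarrow>\<^sub>0 'k)"
  assumes src_in_verts: "q \<in> S \<Longrightarrow> src q \<in> verts E"
    and cons_in_S: "e \<in> arcs E \<Longrightarrow> q \<in> S \<Longrightarrow> head E e = src q \<Longrightarrow> cons e q \<in> S"
    and src_cons: "src (cons e q) = tail E e"
    and act_Vertex: "q \<in> S \<Longrightarrow> act (Vertex v) q = (if v = src q then Poly_Mapping.single q 1 else 0)"
    and act_Edge: "q \<in> S \<Longrightarrow> act (Edge e) q = (if head E e = src q then Poly_Mapping.single (cons e q) 1 else 0)"
    and act_Ghost_cons: "q \<in> S \<Longrightarrow> head E e' = src q \<Longrightarrow>
      act (Ghost e) (cons e' q) = (if e = e' then Poly_Mapping.single q 1 else 0)"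
    and path_cases: "q \<in> S \<Longrightarrow>
      (\<exists>e \<in> arcs E. \<exists>q' \<in> S. head E e = src q' \<and> q = cons e q') \<or>
      out_arcs E (src q) = {} \<and> (\<forall>e \<in> arcs E. act (Ghost e) q = 0)"
begin

abbreviation rep :: "('v, 'e, 'k) polynomial \<Rightarrow> ('b \<Rightarrow>\<^sub>0 'k) \<Rightarrow> ('b \<Rightarrow>\<^sub>0 'k)" where
  "rep \<equiv> poly_rep act"

abbreviation path :: "'b \<Rightarrow> ('b \<Rightarrow>\<^sub>0 'k)" where
  "path q \<equiv> Poly_Mapping.single q 1"

lemma path_space_cases [consumes 1, case_names cons sink]:
  assumes "q \<in> S"
  obtains e q' where "e \<in> arcs E" "q' \<in> S" "head E e = src q'" "q = cons e q'"
  | "out_arcs E (src q) = {}" "\<And>e. e \<in> arcs E \<Longrightarrow> act (Ghost e) q = 0"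
  using path_cases[OF assms] by blast

lemma keys_act:
  assumes g: "g \<in> generators E" and q: "q \<in> S"
  shows "Poly_Mapping.keys (act g q) \<subseteq> S"
proof (cases g)
  case (Vertex v)
  then show ?thesis using q by (simp add: act_Vertex)
next
  case (Edge e)
  then show ?thesis using q g cons_in_S by (auto simp: act_Edge generators_def)
next
  case (Ghost e)
  then have e: "e \<in> arcs E" using g by (auto simp: generators_def)
  from q show ?thesis
    by (cases rule: path_space_cases) (use e Ghost in \<open>auto simp: act_Ghost_cons\<close>)
qed

lemma keys_rep:
  assumes "f \<in> A" "Poly_Mapping.keys x \<subseteq> S"
  shows "Poly_Mapping.keys (rep f x) \<subseteq> S"
  unfolding poly_rep_def
  by (intro keys_linear_extension keys_word_rep keys_act) (use assms in \<open>auto simp: mem_A\<close>)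

lemma relation_acts_zero:
  assumes f: "f \<in> lpa_relations E" and q: "q \<in> S"
  shows "rep f (path q) = 0"
proof -
  have g: "rep (gen g) x = linear_extension (act g) x" for g x
    by (rule poly_rep_gen)
  note simps = poly_rep_simps poly_rep_mult g word_rep_singleton act_Vertex[OF q] act_Edge[OF q]
  from f consider
      (V) v u where "f = vtx v * vtx u - (if v = u then vtx v else 0)"
    | (E1) e where "e \<in> arcs E" "f = vtx (tail E e) * edg e - edg e"
    | (E1') e where "e \<in> arcs E" "f = edg e * vtx (head E e) - edg e"
    | (E2) e where "e \<in> arcs E" "f = vtx (head E e) * gho e - gho e"
    | (E2') e where "e \<in> arcs E" "f = gho e * vtx (tail E e) - gho e"
    | (CK1) e e' where "e \<in> arcs E" "e' \<in> arcs E" "f = gho e * edg e' - (if e = e' then vtx (head E e) else 0)"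
    | (CK2) v where "f = vtx v - (\<Sum>e \<in> out_arcs E v. edg e * gho e)" "out_arcs E v \<noteq> {}"
    unfolding lpa_relations_def by blast
  then show ?thesis
  proof cases
    case V
    then show ?thesis using q by (simp add: simps)
  next
    case E1
    then show ?thesis using q cons_in_S[OF E1(1) q] by (simp add: simps act_Vertex src_cons)
  next
    case E1'
    then show ?thesis using q by (simp add: simps)
  next
    case E2
    from q show ?thesis
    proof (cases rule: path_space_cases)
      case (cons e' q')
      then show ?thesis using E2 by (simp add: simps act_Ghost_cons act_Vertex)
    qed (use E2 in \<open>simp add: simps\<close>)
  next
    case E2'
    from q show ?thesis
    proof (cases rule: path_space_cases)
      case (cons e' q')
      then show ?thesis using E2' q by (auto simp: simps act_Ghost_cons act_Vertex src_cons)
    qed (use E2' in \<open>simp add: simps\<close>)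
  next
    case CK1
    then show ?thesis using q by (simp add: simps act_Ghost_cons)
  next
    case CK2
    from q show ?thesis
    proof (cases rule: path_space_cases)
      case (cons e' q')
      \<comment> \<open>Only the first edge \<open>e'\<close> of \<open>q\<close> contributes: it is
        removed and put back, and it leaves \<open>v\<close> exactly if \<open>q\<close> starts at
        \<open>v\<close>.\<close>
      have "(\<Sum>e \<in> out_arcs E v. rep (edg e * gho e) (path q)) =
          (\<Sum>e \<in> out_arcs E v. if e = e' then path q else 0)"
        using cons by (intro sum.cong) (auto simp: simps act_Ghost_cons act_Edge)
      also have "\<dots> = (if v = src q then path q else 0)"
        using cons by (simp add: sum.delta src_cons out_arcs_def)
      finally show ?thesis using CK2 by (simp add: simps)
    next
      case sink
      have "(\<Sum>e \<in> out_arcs E v. rep (edg e * gho e) (path q)) = 0"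
        using sink(2) by (intro sum.neutral) (auto simp: simps out_arcs_def)
      \<comment> \<open>CK2 is imposed at vertices that emit edges, so on a path that starts at a
        sink its vertex term vanishes as well.\<close>
      moreover have "v \<noteq> src q" using sink(1) CK2 by auto
      ultimately show ?thesis using CK2 by (simp add: simps)
    qed
  qed
qed

text \<open>The span of \<open>S\<close> is stable under the action by \<open>keys_rep\<close>, so
  its annihilator is a two-sided ideal. This makes the action of a coset well defined and lets path
  spaces detect elements outside \<open>I\<close>.\<close>

lemma I_acts_zero:
  assumes "f \<in> I" "Poly_Mapping.keys x \<subseteq> S"
  shows "rep f x = 0"
proof -
  define J where "J = {f \<in> A. \<forall>x. Poly_Mapping.keys x \<subseteq> S \<longrightarrow> rep f x = 0}"
  have "ideal J F"
    by (rule ideal_F_I) (auto simp: J_def poly_rep_simps poly_rep_mult keys_rep)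
  moreover have "lpa_relations E \<subseteq> J"
  proof
    fix f :: "('v, 'e, 'k) polynomial" assume f: "f \<in> lpa_relations E"
    have "rep f x = 0" if "Poly_Mapping.keys x \<subseteq> S" for x
      using that
    proof (rule poly_mapping_additive_induct)
      show "rep f (Poly_Mapping.single q c) = 0" if "q \<in> S" for q c
        using poly_rep_simps(9)[of act f c "path q"] relation_acts_zero[OF f that] by simp
    qed (simp_all add: poly_rep_simps)
    then show "f \<in> J" using f relations_subset by (auto simp: J_def)
  qed
  ultimately have "I \<subseteq> J" by (rule I_minimal)
  then show ?thesis using assms by (auto simp: J_def)
qed

lemma rep_cong:
  assumes "f - g \<in> I" "Poly_Mapping.keys x \<subseteq> S"
  shows "rep f x = rep g x"
  using I_acts_zero[OF assms] by (simp add: poly_rep_simps)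

text \<open>
  A choice of elements \<open>\<iota> q\<close> that is compatible with vertices and edges is automatically
  compatible with the ghost edges, so that its linear extension is a homomorphism modulo \<open>J\<close>.
\<close>

lemma linear_extension_equivariant:
  assumes J: "left_ideal_mod J"
    and \<iota>A: "\<And>q. q \<in> S \<Longrightarrow> \<iota> q \<in> A"
    and \<iota>_src: "\<And>q. q \<in> S \<Longrightarrow> vtx (src q) * \<iota> q - \<iota> q \<in> J"
    and \<iota>_cons: "\<And>e q. e \<in> arcs E \<Longrightarrow> q \<in> S \<Longrightarrow> head E e = src q \<Longrightarrow> edg e * \<iota> q - \<iota> (cons e q) \<in> J"
    and f: "f \<in> A" and x: "Poly_Mapping.keys x \<subseteq> S"
  shows "f * linear_extension \<iota> x - linear_extension \<iota> (rep f x) \<in> J"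
proof -
  note JD = left_ideal_modD[OF J]
  have J0: "0 \<in> J" by (rule JD(1)) simp
  \<comment> \<open>Modulo \<open>J\<close> the element \<open>\<iota> q\<close> equals its source
    vertex times itself, so whatever annihilates that vertex annihilates \<open>\<iota> q\<close>.
    This matches the zero values of \<open>act\<close>.\<close>
  have kill: "a * \<iota> q \<in> J" if q: "q \<in> S" and a: "a \<in> A" "a * vtx (src q) \<in> I" for a q
  proof -
    have "(a * vtx (src q)) * \<iota> q \<in> J" by (rule JD(1)[OF I_mult_right[OF a(2) \<iota>A[OF q]]])
    moreover have "a * \<iota> q - (a * vtx (src q)) * \<iota> q \<in> J"
      using JD(7)[OF a(1) JD(4)[OF \<iota>_src[OF q]]] by (simp add: mult.assoc)
    ultimately show ?thesis using JD(2) by fastforce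
  qed
  have generator: "gen g * \<iota> q - linear_extension \<iota> (act g q) \<in> J"
    if g: "g \<in> generators E" and q: "q \<in> S" for g q
  proof -
    from g consider (V) v where "g = Vertex v" "v \<in> verts E" | (Ed) e where "g = Edge e" "e \<in> arcs E"
      | (Gh) e where "g = Ghost e" "e \<in> arcs E"
      unfolding generators_def by blast
    then show ?thesis
    proof cases
      case V
      then show ?thesis using \<iota>_src[OF q] kill[OF q, of "vtx v"] orthogonal(1)[OF V(2) src_in_verts[OF q]]
        by (auto simp: act_Vertex[OF q])
    next
      case Ed
      then show ?thesis using \<iota>_cons[OF Ed(2) q] kill[OF q, of "edg e"] orthogonal(2)[OF Ed(2) src_in_verts[OF q]]
        by (auto simp: act_Edge[OF q])
    next
      case Gh
      from q show ?thesis
      proof (cases rule: path_space_cases)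
        case (cons e' q')
        have gA: "gho e \<in> A" using Gh by simp
        \<comment> \<open>Writing \<open>\<iota> q\<close> as \<open>e'\<close> times
          \<open>\<iota> q'\<close> makes CK1 applicable; here compatibility with ghost edges
          follows from that with edges.\<close>
        have 1: "gho e * \<iota> q - gho e * (edg e' * \<iota> q') \<in> J"
          using JD(7)[OF gA JD(4)[OF \<iota>_cons[OF cons(1-3)]]] cons(4) by simp
        have "gho e * edg e' * \<iota> q' - (if e = e' then vtx (head E e) else 0) * \<iota> q' \<in> J"
          by (rule JD(1)[OF eqv_mult_right[OF relation_CK1[OF Gh(2) cons(1)] \<iota>A[OF cons(2)]]])
        then have 2: "gho e * (edg e' * \<iota> q') - (if e = e' then vtx (src q') * \<iota> q' else 0) \<in> J"
          using cons(3) by (auto simp: mult.assoc split: if_splits)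
        have 3: "(if e = e' then vtx (src q') * \<iota> q' else 0) - linear_extension \<iota> (act g q) \<in> J"
          using Gh cons \<iota>_src[OF cons(2)] J0 by (simp add: act_Ghost_cons)
        show ?thesis using JD(5)[OF 1 JD(5)[OF 2 3]] Gh(1) by simp
      next
        case sink
        have "tail E e \<noteq> src q" using sink(1) Gh by (auto simp: out_arcs_def)
        then show ?thesis
          using kill[OF q, of "gho e"] orthogonal(3)[OF Gh(2) src_in_verts[OF q]] Gh sink(2) by simp
      qed
    qed
  qed
  have letter: "gen g * linear_extension \<iota> y - linear_extension \<iota> (linear_extension (act g) y) \<in> J"
    if g: "g \<in> generators E" and y: "Poly_Mapping.keys y \<subseteq> S" for g y
    using y
  proof (rule poly_mapping_additive_induct)
    fix q and c :: 'k assume q: "q \<in> S"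
    have "gen g * scale c (\<iota> q) = scale c (gen g * \<iota> q)"
      by (rule poly_mapping_eqI)
         (simp add: mult_map_scale_conv_mult mult.assoc[symmetric] mult_single)
    then show "gen g * linear_extension \<iota> (Poly_Mapping.single q c) -
        linear_extension \<iota> (linear_extension (act g) (Poly_Mapping.single q c)) \<in> J"
      using JD(6)[OF generator[OF g q], of c] by (simp add: linear_extension_scale scale_diff_right)
  next
    fix y z
    assume "gen g * linear_extension \<iota> y - linear_extension \<iota> (linear_extension (act g) y) \<in> J"
      "gen g * linear_extension \<iota> z - linear_extension \<iota> (linear_extension (act g) z) \<in> J"
    from JD(2)[OF this]
    show "gen g * linear_extension \<iota> (y + z) - linear_extension \<iota> (linear_extension (act g) (y + z)) \<in> J"
      by (simp add: linear_extension_add algebra_simps)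
  qed (simp add: J0)
  have word: "Poly_Mapping.single (Word gs) 1 * linear_extension \<iota> x
      - linear_extension \<iota> (word_rep act (Word gs) x) \<in> J" if "set gs \<subseteq> generators E" for gs
    using that
  proof (induction gs)
    case Nil
    then show ?case by (simp add: zero_word_def[symmetric] J0)
  next
    case (Cons g gs)
    have gA: "gen g \<in> A" using Cons.prems by auto
    have "Poly_Mapping.keys (word_rep act (Word gs) x) \<subseteq> S"
      by (rule keys_word_rep) (use Cons.prems x keys_act in auto)
    then have 1: "gen g * linear_extension \<iota> (word_rep act (Word gs) x)
        - linear_extension \<iota> (word_rep act (Word (g # gs)) x) \<in> J"
      using letter[of g] Cons.prems by (simp add: word_rep_Cons)
    have "gen g * (Poly_Mapping.single (Word gs) 1 * linear_extension \<iota> x)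
        - gen g * linear_extension \<iota> (word_rep act (Word gs) x) \<in> J"
      by (rule JD(7)[OF gA Cons.IH]) (use Cons.prems in auto)
    from JD(5)[OF this 1] show ?case
      by (simp add: mult.assoc[symmetric] mult_single plus_word_def)
  qed
  have "Poly_Mapping.keys f \<subseteq> {w. ok w}" using f by (simp add: mem_A)
  then show ?thesis
  proof (rule poly_mapping_additive_induct)
    fix w and c :: 'k assume "w \<in> {w. ok w}"
    then have "scale c (Poly_Mapping.single w 1 * linear_extension \<iota> x - linear_extension \<iota> (word_rep act w x)) \<in> J"
      using word[of "letters w"] by (intro JD(6)) simp
    moreover have "scale c (Poly_Mapping.single w 1 * h) = Poly_Mapping.single w c * h"
      for h :: "('v, 'e, 'k) polynomial"
      using scale_mult_left[of c "Poly_Mapping.single w 1" h] by simp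
    ultimately show "Poly_Mapping.single w c * linear_extension \<iota> x
        - linear_extension \<iota> (rep (Poly_Mapping.single w c) x) \<in> J"
      by (simp add: poly_rep_simps linear_extension_scale scale_diff_right)
  next
    fix f g
    assume "f * linear_extension \<iota> x - linear_extension \<iota> (rep f x) \<in> J"
      "g * linear_extension \<iota> x - linear_extension \<iota> (rep g x) \<in> J"
    from JD(2)[OF this]
    show "(f + g) * linear_extension \<iota> x - linear_extension \<iota> (rep (f + g) x) \<in> J"
      by (simp add: poly_rep_simps linear_extension_add algebra_simps)
  qed (simp add: poly_rep_simps J0)
qed

definition augmentation :: "('b \<Rightarrow>\<^sub>0 'k) \<Rightarrow> 'k" where
  "augmentation x = (\<Sum>q \<in> Poly_Mapping.keys x. Poly_Mapping.lookup x q)"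

text \<open>The defining sum runs over a set that varies with \<open>x\<close>. Seen as a linear
  extension to a one-point basis, it inherits linearity.\<close>

lemma augmentation_alt: "augmentation x = Poly_Mapping.lookup (linear_extension (\<lambda>_. Poly_Mapping.single () 1) x) ()"
  by (simp add: augmentation_def lookup_linear_extension[OF finite_keys order_refl])

lemma augmentation_simps [simp]:
  "augmentation 0 = 0" "augmentation (x + y) = augmentation x + augmentation y"
  "augmentation (x - y) = augmentation x - augmentation y"
  "augmentation (scale c x) = c * augmentation x"
  "augmentation (Poly_Mapping.single q c) = c"
  by (simp_all add: augmentation_alt linear_extension_add linear_extension_diff linear_extension_scale lookup_add lookup_minus)

lemma rep_epath:
  assumes "cas u es (src q)" "set es \<subseteq> arcs E" "q \<in> S"
  shows "rep (epath es) (path q) = path (foldr cons es q) \<and> foldr cons es q \<in> S \<and> src (foldr cons es q) = u"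
  using assms
proof (induction es arbitrary: u)
  case (Cons e es)
  then have "rep (epath es) (path q) = path (foldr cons es q) \<and> foldr cons es q \<in> S
      \<and> src (foldr cons es q) = head E e" by auto
  then show ?case using Cons.prems cons_in_S[of e "foldr cons es q"]
    by (auto simp: epath_Cons poly_rep_mult poly_rep_gen act_Edge src_cons)
qed auto

text \<open>Paths that do not start at \<open>u\<close> are killed by both terms; \<open>d\<close>
  replaces any other path by a single path with the same coefficient.\<close>

lemma augmentation_path_difference:
  assumes d: "awalk u d u" and x: "Poly_Mapping.keys x \<subseteq> S"
  shows "augmentation (rep (epath d * vtx u - vtx u) x) = 0"
  using x
proof (rule poly_mapping_additive_induct)
  fix q and c :: 'k assume q: "q \<in> S"
  have "augmentation (rep (epath d * vtx u - vtx u) (scale c (path q))) = 0"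
    unfolding poly_rep_simps
    using d q rep_epath[of u d q]
    by (auto simp: poly_rep_simps poly_rep_mult word_rep_singleton act_Vertex awalk_def)
  then show "augmentation (rep (epath d * vtx u - vtx u) (Poly_Mapping.single q c)) = 0" by simp
qed (simp_all add: poly_rep_simps)

end

section \<open>Periods of an infinite path\<close>

lemma sdrop_mult_period: "sdrop n p = p \<Longrightarrow> sdrop (k * n) p = p"
  by (induction k) (simp_all add: sdrop_add[symmetric] add.commute)

lemma stake_mult_period:
  assumes "sdrop n p = p"
  shows "stake (k * n) p = concat (replicate k (stake n p))"
proof (induction k)
  case (Suc k)
  have "stake (n + k * n) p = stake n p @ stake (k * n) (sdrop n p)"
    by (simp add: stake_add)
  then show ?case using Suc assms by simp
qed simp

text \<open>Bezout's identity in the form \<open>m * x = n * y + gcd m n\<close> avoids negative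
  shifts: dropping \<open>m * x\<close> edges fixes \<open>p\<close>, and so does dropping the first
  \<open>n * y\<close> of them.\<close>

lemma sdrop_gcd_period:
  assumes "sdrop m p = p" "sdrop n p = p" "m \<noteq> 0"
  shows "sdrop (gcd m n) p = p"
proof -
  obtain x y where xy: "m * x = n * y + gcd m n"
    using bezout_nat[OF assms(3)] by blast
  have "p = sdrop (x * m) p" by (rule sdrop_mult_period[OF assms(1), symmetric])
  also have "\<dots> = sdrop (gcd m n) (sdrop (y * n) p)"
    using xy by (simp add: sdrop_add ac_simps)
  also have "sdrop (y * n) p = p" by (rule sdrop_mult_period[OF assms(2)])
  finally show ?thesis by simp
qed

section \<open>Infinite paths in the graph and the periods of
  \<open>d\<^sup>\<infinity>\<close>\<close>

context leavitt_graph
begin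

lemma infinite_path_in_arcs: "infinite_path E p \<Longrightarrow> p !! i \<in> arcs E"
  by (simp add: infinite_path_def)

lemma infinite_path_shift_arcs:
  assumes "infinite_path E (xs @- q)" shows "set xs \<subseteq> arcs E"
proof
  fix x assume "x \<in> set xs"
  then obtain i where "i < length xs" "x = xs ! i" by (metis in_set_conv_nth)
  then show "x \<in> arcs E" using infinite_path_in_arcs[OF assms, of i] by simp
qed

lemma infinite_path_Cons:
  "infinite_path E (e ## q) \<longleftrightarrow> e \<in> arcs E \<and> head E e = tail E (shd q) \<and> infinite_path E q"
proof -
  have *: "(\<forall>i. P i) \<longleftrightarrow> P 0 \<and> (\<forall>i. P (Suc i))" for P
    by (metis not0_implies_Suc)
  show ?thesis
    unfolding infinite_path_def by (subst *) auto
qed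

lemma infinite_path_cas:
  "infinite_path E p \<Longrightarrow> cas (tail E (shd p)) (stake n p) (tail E (p !! n))"
proof (induction n arbitrary: p)
  case (Suc n)
  have "infinite_path E (shd p ## stl p)" using Suc.prems by simp
  then show ?case using Suc.IH[of "stl p"] by (simp add: infinite_path_Cons del: stream.collapse)
qed simp

text \<open>The junction is included: if \<open>i\<close> is the index of the last edge of
  \<open>es\<close>, then \<open>Suc i\<close> points to \<open>shd q\<close>.\<close>

lemma cas_shift:
  assumes "cas u es (tail E (shd q))" "set es \<subseteq> arcs E" "i < length es"
  shows "(es @- q) !! i \<in> arcs E \<and> head E ((es @- q) !! i) = tail E ((es @- q) !! Suc i)"
  using assms
proof (induction es arbitrary: u i)
  case (Cons e es)
  show ?case
  proof (cases i)
    case 0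
    then show ?thesis using Cons.prems by (cases es) auto
  next
    case (Suc j)
    then show ?thesis using Cons.IH[of "head E e" j] Cons.prems by simp
  qed
qed simp

lemma closed_path_awalk:
  assumes "closed_path E d"
  shows "d \<noteq> []" "awalk (path_source E d) d (path_source E d)"
  using assms unfolding closed_path_def path_source_def awalk_def
  by (auto simp: cas_simp)

lemma infinite_path_cycle:
  assumes "closed_path E d"
  shows "infinite_path E (Stream.cycle d)"
  unfolding infinite_path_def
proof
  fix i
  note d = closed_path_awalk[OF assms]
  define n where "n = length d"
  have n: "n > 0" using d by (simp add: n_def)
  have "sdrop (i div n * n) (Stream.cycle d) = Stream.cycle d"
    by (rule sdrop_mult_period) (use d in \<open>simp add: n_def\<close>)
  then have i: "Stream.cycle d !! (i div n * n + j) = Stream.cycle d !! j" for j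
    by (metis sdrop_snth)
  \<comment> \<open>One copy of \<open>d\<close> is split off the cycle because
    \<open>Suc (i mod n)\<close> may equal \<open>n\<close>, just beyond the end of
    \<open>d\<close>.\<close>
  have "(d @- Stream.cycle d) !! (i mod n) \<in> arcs E \<and>
      head E ((d @- Stream.cycle d) !! (i mod n)) = tail E ((d @- Stream.cycle d) !! Suc (i mod n))"
    by (rule cas_shift[of "path_source E d"])
       (use d n in \<open>auto simp: awalk_def path_source_def n_def\<close>)
  then show "Stream.cycle d !! i \<in> arcs E \<and> head E (Stream.cycle d !! i) = tail E (Stream.cycle d !! Suc i)"
    using i[of "i mod n"] i[of "Suc (i mod n)"] d(1) by (simp add: cycle_decomp[symmetric])
qed

text \<open>A period of \<open>d\<^sup>\<infinity>\<close> and the length of \<open>d\<close> have a common divisor that is again a period, so a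
  shorter period would exhibit \<open>d\<close> as a proper power.\<close>

lemma simple_cycle_period:
  assumes d: "simple_closed_path E d" and g: "g @- Stream.cycle d = Stream.cycle d"
  shows "\<exists>k. g = concat (replicate k d)"
proof -
  have closed: "closed_path E d" using d by (simp add: simple_closed_path_def)
  note dw = closed_path_awalk[OF closed]
  define p where "p = Stream.cycle d"
  define m where "m = length d"
  define l where "l = gcd m (length g)"
  have p: "infinite_path E p" unfolding p_def by (rule infinite_path_cycle[OF closed])
  have m: "m \<noteq> 0" "sdrop m p = p" "stake m p = d" using dw by (simp_all add: m_def p_def)
  have "sdrop (length g) (g @- p) = p" by (simp add: sdrop_shift)
  then have gp: "sdrop (length g) p = p" using g by (simp add: p_def)
  have l: "sdrop l p = p" "l \<noteq> 0"
    unfolding l_def using sdrop_gcd_period[OF m(2) gp m(1)] m(1) by simp_all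
  have "closed_path E (stake l p)"
    unfolding closed_path_def
  proof (intro conjI exI)
    show "stake l p \<noteq> []" using l(2) by simp
    have "p !! l = shd p" using l(1) by (metis sdrop_simps(1))
    then have "cas (tail E (shd p)) (stake l p) (tail E (shd p))"
      using infinite_path_cas[OF p, of l] by simp
    moreover have "set (stake l p) \<subseteq> arcs E"
      using infinite_path_shift_arcs[of "stake l p" "sdrop l p"] p by (simp add: stake_sdrop)
    moreover have "tail E (shd p) \<in> verts E"
      using infinite_path_in_arcs[OF p, of 0] by simp
    ultimately show "awalk (tail E (shd p)) (stake l p) (tail E (shd p))"
      by (simp add: awalk_def)
  qed
  moreover have "d = concat (replicate (m div l) (stake l p))"
    using stake_mult_period[OF l(1), of "m div l"] m(3) by (simp add: l_def)
  ultimately have "\<not> m div l \<ge> 2"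
    using d unfolding simple_closed_path_def by blast
  moreover have "m div l * l = m" by (simp add: l_def)
  ultimately have "m = l" using m(1) by (cases "m div l") auto
  then have "m dvd length g" by (metis l_def gcd_dvd2)
  then obtain k where k: "length g = k * m" by (metis dvdE mult.commute)
  have "g = stake (length g) (g @- p)" by (simp add: stake_shift)
  also have "\<dots> = stake (k * m) p" using g k by (simp add: p_def)
  also have "\<dots> = concat (replicate k d)" using stake_mult_period[OF m(2), of k] m(3) by simp
  finally show ?thesis by blast
qed

lemma left_ideal_mod_multiples:
  assumes "r \<in> A"
  shows "left_ideal_mod {f \<in> A. \<exists>b \<in> A. f - b * r \<in> I}"
  unfolding left_ideal_mod_def
proof (intro conjI ballI)
  show "I \<subseteq> {f \<in> A. \<exists>b \<in> A. f - b * r \<in> I}"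
    using I_subset by (auto intro!: bexI[of _ 0])
next
  fix f g assume "f \<in> {f \<in> A. \<exists>b \<in> A. f - b * r \<in> I}" "g \<in> {f \<in> A. \<exists>b \<in> A. f - b * r \<in> I}"
  then obtain b c where bc: "f \<in> A" "g \<in> A" "b \<in> A" "c \<in> A" "f - b * r \<in> I" "g - c * r \<in> I" by auto
  have "f + g - (b + c) * r \<in> I" using I_add[OF bc(5,6)] by (simp add: algebra_simps)
  then show "f + g \<in> {f \<in> A. \<exists>b \<in> A. f - b * r \<in> I}" using bc by blast
next
  fix a f assume a: "a \<in> A" and "f \<in> {f \<in> A. \<exists>b \<in> A. f - b * r \<in> I}"
  then obtain b where b: "f \<in> A" "b \<in> A" "f - b * r \<in> I" by auto
  have "a * f - (a * b) * r \<in> I" using eqv_mult_left[OF b(3) a] by (simp add: mult.assoc)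
  then show "a * f \<in> {f \<in> A. \<exists>b \<in> A. f - b * r \<in> I}" using a b by blast
qed

end

section \<open>The Chen modules of infinite paths\<close>

locale chen_path = leavitt_graph E K
  for E :: "('v, 'e) pre_digraph" and K :: "'k::field itself" +
  fixes p :: "'e stream"
  assumes p: "infinite_path E p"

sublocale chen_path \<subseteq> path_space E K "tail_class E p" "\<lambda>q. tail E (shd q)" "(##)" "gen_action E"
proof unfold_locales
  have eq_Cons: "tail_equivalent p (e ## q) \<longleftrightarrow> tail_equivalent p q" for e q
  proof
    assume "tail_equivalent p (e ## q)"
    then obtain m n where "sdrop m p = sdrop n (e ## q)" unfolding tail_equivalent_def by blast
    \<comment> \<open>One more edge is dropped on both sides, because \<open>n\<close> may be zero
      and then \<open>sdrop n (e ## q)\<close> still contains \<open>e\<close>.\<close>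
    then have "sdrop (Suc m) p = sdrop n q"
      by (metis sdrop.simps(2) sdrop_stl stream.sel(2))
    then show "tail_equivalent p q" unfolding tail_equivalent_def by blast
  next
    assume "tail_equivalent p q"
    then obtain m n where "sdrop m p = sdrop n q" unfolding tail_equivalent_def by blast
    then have "sdrop m p = sdrop (Suc n) (e ## q)" by simp
    then show "tail_equivalent p (e ## q)" unfolding tail_equivalent_def by blast
  qed
  fix q assume q: "q \<in> tail_class E p"
  then have iq: "infinite_path E q" by (simp add: tail_class_def)
  show "tail E (shd q) \<in> verts E" using infinite_path_in_arcs[OF iq, of 0] by simp
  show "e ## q \<in> tail_class E p" if "e \<in> arcs E" "head E e = tail E (shd q)" for e
    using q that by (simp add: tail_class_def infinite_path_Cons eq_Cons)
  have "infinite_path E (shd q ## stl q)" using iq by simp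
  moreover have "tail_equivalent p (stl q)"
    using q eq_Cons[of "shd q" "stl q"] by (simp add: tail_class_def)
  ultimately have "stl q \<in> tail_class E p" "shd q \<in> arcs E" "head E (shd q) = tail E (shd (stl q))"
    by (simp_all add: tail_class_def infinite_path_Cons del: stream.collapse)
  then show "(\<exists>e\<in>arcs E. \<exists>q'\<in>tail_class E p. head E e = tail E (shd q') \<and> q = e ## q') \<or>
      out_arcs E (tail E (shd q)) = {} \<and> (\<forall>e\<in>arcs E. gen_action E (Ghost e) q = 0)"
    by (metis stream.collapse)
qed auto

context chen_path
begin

abbreviation V :: "(('v, 'e, 'k) lpa_element, 'e stream \<Rightarrow>\<^sub>0 'k) module" where
  "V \<equiv> chen_path_module E p"

lemma V_simps [simp]: "zero V = 0" "add V = (+)"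
  by (simp_all add: chen_path_module_def)

lemma mem_V: "x \<in> carrier V \<longleftrightarrow> Poly_Mapping.keys x \<subseteq> tail_class E p"
  by (simp add: chen_path_module_def)

lemma smult_V:
  assumes x: "x \<in> carrier V"
  shows "cls f \<odot>\<^bsub>V\<^esub> x = rep f x"
proof -
  have "(\<lambda>g. poly_action E g x) ` cls f = {rep f x}"
    unfolding cls_def' poly_action_eq_poly_rep
    using I_acts_zero[of _ x] x
    by (auto simp: mem_V poly_rep_simps image_iff intro!: bexI[of _ 0])
  then show ?thesis by (simp add: chen_path_module_def)
qed

lemma left_module_V: "left_module L V"
proof -
  have closed: "rep f x \<in> carrier V" if "f \<in> A" "x \<in> carrier V" for f x
    using keys_rep[OF that(1)] that(2) by (simp add: mem_V)
  have add: "x + y \<in> carrier V" if "x \<in> carrier V" "y \<in> carrier V" for x y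
    using that Poly_Mapping.keys_add[of x y] unfolding mem_V by blast
  have "abelian_group V"
  proof (rule abelian_groupI)
    fix x assume x: "x \<in> carrier V"
    then have "- x \<in> carrier V" by (auto simp: mem_V in_keys_iff)
    then show "\<exists>y\<in>carrier V. y \<oplus>\<^bsub>V\<^esub> x = \<zero>\<^bsub>V\<^esub>" by (intro bexI[of _ "- x"]) auto
  qed (auto simp: add add_ac, auto simp: mem_V)
  moreover have "\<one>\<^bsub>L\<^esub> \<odot>\<^bsub>V\<^esub> x = x" if x: "x \<in> carrier V" for x
  proof -
    have "Poly_Mapping.keys x \<subseteq> tail_class E p" using x by (simp add: mem_V)
    then have "rep (\<Sum>v \<in> verts E. vtx v) x = x"
    proof (rule poly_mapping_additive_induct)
      fix q and c :: 'k assume q: "q \<in> tail_class E p"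
      \<comment> \<open>Among the vertices only the source of \<open>q\<close> acts nontrivially on
        \<open>q\<close>, so the sum has a single term.\<close>
      show "rep (\<Sum>v \<in> verts E. vtx v) (Poly_Mapping.single q c) = Poly_Mapping.single q c"
        using src_in_verts[OF q]
        by (simp add: poly_rep_simps word_rep_singleton if_distrib[of "scale c"] sum.delta cong: if_cong)
    qed (simp_all add: poly_rep_simps)
    then show ?thesis using smult_V[OF x] by (simp add: L_one)
  qed
  ultimately show ?thesis
    unfolding left_module_def left_module_axioms_def
    by (auto simp: ring_L L_carrier smult_V closed add L_add L_mult A0_subset poly_rep_simps poly_rep_mult)
qed

end

section \<open>The module of a simple closed path\<close>

locale simple_cycle = leavitt_graph E K
  for E :: "('v, 'e) pre_digraph" and K :: "'k::field itself" +
  fixes d :: "'e list"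
  assumes simple: "simple_closed_path E d"

sublocale simple_cycle \<subseteq> chen_path E K "Stream.cycle d"
  by unfold_locales (use simple infinite_path_cycle in \<open>simp add: simple_closed_path_def\<close>)

context simple_cycle
begin

abbreviation c :: "'e stream" where "c \<equiv> Stream.cycle d"
abbreviation u :: 'v where "u \<equiv> path_source E d"

text \<open>This is \<open>d - v\<close>: modulo \<open>I\<close> the factor \<open>vtx u\<close> on
  \<open>epath d\<close> changes nothing, and it gives \<open>relator\<close> the shape
  \<open>epath a * vtx u - epath b * vtx u\<close> in which paths are compared below.\<close>

definition relator :: "('v, 'e, 'k) polynomial" where
  "relator = epath d * vtx u - vtx u"

text \<open>The preimage in \<open>A\<close> of the left ideal \<open>L(d - v)\<close>. A constant
  term in \<open>b\<close> does no harm, since modulo \<open>I\<close> the vertex \<open>u\<close>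
  fixes \<open>relator\<close> on the left.\<close>

definition J :: "('v, 'e, 'k) polynomial set" where
  "J = {f \<in> A. \<exists>b \<in> A. f - b * relator \<in> I}"

lemma d_awalk: "d \<noteq> []" "awalk u d u"
  using closed_path_awalk simple by (auto simp: simple_closed_path_def)

lemma d_arcs: "set d \<subseteq> arcs E" and u_in_verts [simp]: "u \<in> verts E" and d_cas: "cas u d u"
  using d_awalk(2) by (auto simp: awalk_def)

lemma epath_d_in_A [simp]: "epath d \<in> A"
  using d_arcs by auto

lemma relator_in_A0 [simp]: "relator \<in> A0"
  unfolding relator_def by (intro A0_diff A0_mult) simp_all

lemma relator_in_A [simp]: "relator \<in> A"
  by (rule A0_subset) simp

lemma left_ideal_J: "left_ideal_mod J"
  unfolding J_def by (rule left_ideal_mod_multiples) simp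

lemma relator_in_J: "relator \<in> J"
  unfolding J_def by (auto intro!: bexI[of _ 1])

lemma vtx_u_idem: "vtx u * vtx u - vtx u \<in> I"
  using relation_V[of u u] by simp

lemma vtx_u_epath: "vtx u * epath d - epath d \<in> I"
  using vtx_epath[OF d_arcs d_awalk(1)] by (simp add: path_source_def)

lemma epath_vtx_u: "epath d * vtx u - epath d \<in> I"
  by (rule epath_vtx[OF d_cas d_arcs d_awalk(1)])

lemma vtx_relator: "vtx u * relator - relator \<in> I"
  using I_diff[OF eqv_mult_right[OF vtx_u_epath, of "vtx u"] vtx_u_idem]
  by (simp add: relator_def algebra_simps)

lemma relator_vtx: "relator * vtx u - relator \<in> I"
  using I_diff[OF eqv_mult_left[OF vtx_u_idem, of "epath d"] vtx_u_idem]
  by (simp add: relator_def algebra_simps)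

text \<open>Modulo \<open>I\<close> the vertex \<open>u\<close> commutes with \<open>d\<close>, so
  \<open>b * relator\<close> in \<open>I\<close> means that \<open>b * vtx u\<close> is fixed by
  right multiplication with \<open>d\<close>; by the grading only zero is.\<close>

lemma relator_injective:
  assumes b: "b \<in> A" "b * relator \<in> I"
  shows "b * vtx u \<in> I"
proof (rule fixed_by_path_in_I[OF _ _ d_awalk(1) d_arcs])
  have "b * (vtx u * epath d) - b * (epath d * vtx u) \<in> I"
    by (rule eqv_mult_left[OF eqv_trans[OF vtx_u_epath eqv_sym[OF epath_vtx_u]] b(1)])
  from I_add[OF this b(2)] show "b * vtx u * epath d - b * vtx u \<in> I"
    by (simp add: relator_def algebra_simps)
qed (use b in auto)

text \<open>Induction by \<open>d^(k+1) v - v = d (d^k v - v) + (d v - v)\<close>, where the last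
  bracket is \<open>relator\<close>.\<close>

lemma epath_power: "epath (concat (replicate k d)) * vtx u - vtx u \<in> J"
proof (induction k)
  case 0
  then show ?case using left_ideal_modD(1)[OF left_ideal_J I_zero] by simp
next
  case (Suc k)
  have "epath d * (epath (concat (replicate k d)) * vtx u - vtx u) \<in> J"
    by (rule left_ideal_modD(3)[OF left_ideal_J epath_d_in_A Suc])
  from left_ideal_modD(2)[OF left_ideal_J this relator_in_J] show ?case
    by (simp add: relator_def epath_append algebra_simps)
qed

text \<open>The shorter path \<open>a\<close> is an initial segment of \<open>b\<close>, and the
  rest \<open>g\<close> satisfies \<open>g @- c = c\<close>. Here simplicity of \<open>d\<close>
  makes \<open>g\<close> a power of \<open>d\<close>, which acts like a trivial path in front of
  \<open>vtx u\<close> modulo \<open>J\<close>.\<close>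

lemma epath_unique_le:
  assumes eq: "a @- c = b @- c" and b: "set b \<subseteq> arcs E" and le: "length a \<le> length b"
  shows "epath b * vtx u - epath a * vtx u \<in> J"
proof -
  have "stake (length a) (a @- c) = take (length a) b"
    unfolding eq using le by (simp add: stake_shift)
  then have "a = take (length a) b" by (simp add: stake_shift)
  then obtain g where g: "b = a @ g" by (metis append_take_drop_id)
  then have "g @- c = c" using eq by simp
  then obtain k where k: "g = concat (replicate k d)"
    using simple_cycle_period[OF simple] by blast
  have "epath a * (epath g * vtx u) - epath a * vtx u \<in> J"
    unfolding k by (rule left_ideal_modD(7)[OF left_ideal_J _ epath_power]) (use b g in auto)
  then show ?thesis by (simp add: g epath_append mult.assoc)
qed

lemma epath_unique:
  assumes "a @- c = b @- c" "set a \<subseteq> arcs E" "set b \<subseteq> arcs E"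
  shows "epath b * vtx u - epath a * vtx u \<in> J"
proof (cases "length a \<le> length b")
  case True
  then show ?thesis using epath_unique_le assms by blast
next
  case False
  then show ?thesis
    using left_ideal_modD(4)[OF left_ideal_J epath_unique_le[of b a]] assms by simp
qed

lemma tail_class_prefix:
  assumes "q \<in> tail_class E c"
  shows "\<exists>a. q = a @- c \<and> set a \<subseteq> arcs E \<and> cas (tail E (shd q)) a u"
proof -
  have iq: "infinite_path E q" using assms by (simp add: tail_class_def)
  obtain m n where mn: "sdrop m c = sdrop n q"
    using assms by (auto simp: tail_class_def tail_equivalent_def)
  \<comment> \<open>Dropping \<open>k\<close> further edges completes the \<open>m\<close> dropped
    ones to \<open>m\<close> full turns of \<open>d\<close>; the subtraction is exact because
    \<open>d\<close> is nonempty.\<close>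
  define k where "k = m * length d - m"
  have "m + k = m * length d" using d_awalk(1) by (cases d) (simp_all add: k_def)
  then have "sdrop (n + k) q = sdrop (m * length d) c"
    using mn by (metis sdrop_add)
  also have "\<dots> = c" by (rule sdrop_mult_period) (simp add: d_awalk(1))
  finally have c: "sdrop (n + k) q = c" .
  then have q: "q = stake (n + k) q @- c" by (metis stake_sdrop)
  have "q !! (n + k) = shd c" using c by (metis sdrop_simps(1))
  moreover have "shd c = hd d" by simp
  ultimately have "cas (tail E (shd q)) (stake (n + k) q) u"
    using infinite_path_cas[OF iq, of "n + k"] by (simp add: path_source_def)
  moreover have "set (stake (n + k) q) \<subseteq> arcs E"
    using infinite_path_shift_arcs[of "stake (n + k) q" c] iq q by simp
  ultimately show ?thesis using q by blast
qed

text \<open>Such a prefix is not unique, as copies of \<open>d\<close> can be appended, and nothing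
  forces \<open>prefix c\<close> to be empty. By \<open>epath_unique\<close> the choice is invisible
  modulo \<open>J\<close>.\<close>

definition prefix :: "'e stream \<Rightarrow> 'e list" where
  "prefix q = (SOME a. q = a @- c \<and> set a \<subseteq> arcs E \<and> cas (tail E (shd q)) a u)"

lemma prefix:
  assumes "q \<in> tail_class E c"
  shows "q = prefix q @- c" "set (prefix q) \<subseteq> arcs E" "cas (tail E (shd q)) (prefix q) u"
  using someI_ex[OF tail_class_prefix[OF assms]] unfolding prefix_def by blast+

lemma c_in_tail_class: "c \<in> tail_class E c"
  using p by (auto simp: tail_class_def tail_equivalent_def)

lemma foldr_SCons: "foldr (##) a q = a @- q"
  by (induction a) auto

lemma rep_prefix:
  assumes "q \<in> tail_class E c"
  shows "rep (epath (prefix q) * vtx u) (path c) = path q"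
proof -
  have "shd c = hd d" by simp
  then have "cas (tail E (shd q)) (prefix q) (tail E (shd c))"
    using prefix(3)[OF assms] by (simp add: path_source_def)
  from rep_epath[OF this prefix(2)[OF assms] c_in_tail_class] show ?thesis
    using prefix(1)[OF assms]
    by (simp add: poly_rep_mult poly_rep_gen path_source_def foldr_SCons)
qed

text \<open>The map \<open>q \<mapsto> epath (prefix q) * vtx u\<close> is a section of
  \<open>a \<mapsto> a c\<close> and is equivariant modulo \<open>J\<close>. Hence
  \<open>f * \<iota> c\<close> is congruent to the image of \<open>rep f (path c) = 0\<close>, while
  \<open>\<iota> c\<close> is congruent to \<open>vtx u\<close>.\<close>

lemma annihilator:
  assumes f: "f \<in> A" and zero: "rep f (path c) = 0"
  shows "f * vtx u \<in> J"
proof -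
  note JD = left_ideal_modD[OF left_ideal_J]
  define \<iota> where "\<iota> q = epath (prefix q) * vtx u" for q
  have \<iota>A: "\<iota> q \<in> A" if "q \<in> tail_class E c" for q
    unfolding \<iota>_def using prefix(2)[OF that] by (auto intro!: A_mult)
  have "f * linear_extension \<iota> (path c) - linear_extension \<iota> (rep f (path c)) \<in> J"
  proof (rule linear_extension_equivariant[OF left_ideal_J \<iota>A _ _ f])
    fix q assume q: "q \<in> tail_class E c"
    show "vtx (tail E (shd q)) * \<iota> q - \<iota> q \<in> J"
    proof (cases "prefix q = []")
      case True
      then have "q = c" using prefix(1)[OF q] by simp
      then show ?thesis using True vtx_u_idem by (simp add: \<iota>_def path_source_def JD(1))
    next
      case False
      have "shd q = hd (prefix q)" using prefix(1)[OF q] False by (metis shift_simps(1))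
      then show ?thesis
        using JD(1)[OF eqv_mult_right[OF vtx_epath[OF prefix(2)[OF q] False], of "vtx u"]]
        by (simp add: \<iota>_def mult.assoc)
    qed
    fix e assume e: "e \<in> arcs E" "head E e = tail E (shd q)"
    have eq: "e ## q \<in> tail_class E c" by (rule cons_in_S[OF e(1) q e(2)])
    \<comment> \<open>Both lists present the same infinite path, but they may differ by copies of
      \<open>d\<close>.\<close>
    have "epath (e # prefix q) * vtx u - epath (prefix (e ## q)) * vtx u \<in> J"
    proof (rule epath_unique)
      show "prefix (e ## q) @- c = (e # prefix q) @- c"
        using prefix(1)[OF q] prefix(1)[OF eq] by simp
    qed (use prefix(2)[OF eq] prefix(2)[OF q] e in auto)
    then show "edg e * \<iota> q - \<iota> (e ## q) \<in> J"
      by (simp add: \<iota>_def epath_Cons mult.assoc)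
  qed (use c_in_tail_class in simp_all)
  then have "f * \<iota> c \<in> J" using zero by simp
  \<comment> \<open>The empty list is another prefix of \<open>c\<close>, and its lift is
    \<open>vtx u\<close>.\<close>
  moreover have "vtx u - \<iota> c \<in> J"
    using epath_unique[of "prefix c" "[]"] prefix[OF c_in_tail_class] by (simp add: \<iota>_def)
  from JD(7)[OF f this] have "f * vtx u - f * \<iota> c \<in> J" .
  ultimately show ?thesis using JD(2) by fastforce
qed

text \<open>The lift \<open>epath (prefix q) * vtx u\<close> lies in \<open>A0\<close>, so
  \<open>c\<close> generates \<open>V\<close> over \<open>L\<close> and not merely over the free
  algebra.\<close>

lemma generates:
  assumes "x \<in> carrier V"
  shows "\<exists>f \<in> A0. rep f (path c) = x"
proof -
  have "Poly_Mapping.keys x \<subseteq> tail_class E c" using assms by (simp add: mem_V)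
  then show ?thesis
  proof (rule poly_mapping_additive_induct)
    show "\<exists>f\<in>A0. rep f (path c) = 0" by (rule bexI[of _ 0]) (simp_all add: poly_rep_simps)
  next
    fix q and a :: 'k assume q: "q \<in> tail_class E c"
    have "scale a (epath (prefix q)) * vtx u \<in> A0"
      using prefix(2)[OF q] by (intro A0_mult A_scale epath_in_A A0_vtx) auto
    moreover have "rep (scale a (epath (prefix q)) * vtx u) (path c) = Poly_Mapping.single q a"
      using rep_prefix[OF q] by (simp add: scale_mult_left poly_rep_simps)
    ultimately show "\<exists>f\<in>A0. rep f (path c) = Poly_Mapping.single q a" by blast
  next
    fix x y assume "\<exists>f\<in>A0. rep f (path c) = x" "\<exists>f\<in>A0. rep f (path c) = y"
    then obtain f g where fg: "f \<in> A0" "g \<in> A0" "rep f (path c) = x" "rep g (path c) = y" by blast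
    then show "\<exists>f\<in>A0. rep f (path c) = x + y"
      by (intro bexI[of _ "f + g"]) (auto simp: poly_rep_simps)
  qed
qed

lemma cls_eq_zero_iff: "cls f = \<zero>\<^bsub>L\<^esub> \<longleftrightarrow> f \<in> I"
  by (simp add: L_zero cls_eq_iff)

lemma cls_in_L [simp]: "f \<in> A0 \<Longrightarrow> cls f \<in> carrier L"
  by (simp add: L_carrier)

lemma Ext1_trivial_iff:
  assumes T: "left_module L T"
  shows "carrier (Ext1 L V T) = {\<one>\<^bsub>Ext1 L V T\<^esub>} \<longleftrightarrow>
    (\<forall>t \<in> carrier T. cls (vtx u) \<odot>\<^bsub>T\<^esub> t = t \<longrightarrow> (\<exists>s \<in> carrier T. cls relator \<odot>\<^bsub>T\<^esub> s = t))"
proof (rule Ext1_trivial_iff_cyclic[OF left_module_V T])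
  have cV: "path c \<in> carrier V" using c_in_tail_class by (simp add: mem_V)
  show "path c \<in> carrier V" by fact
  have v: "rep (vtx u) (path c) = path c"
    by (simp add: poly_rep_gen path_source_def)
  have "cas u d (tail E (shd c))" using d_cas by (simp add: path_source_def)
  from rep_epath[OF this d_arcs c_in_tail_class]
  have "rep (epath d) (path c) = path c"
    using cycle_decomp[OF d_awalk(1)] by (simp add: foldr_SCons)
  then have "rep relator (path c) = 0" using v by (simp add: relator_def poly_rep_simps(3) poly_rep_mult)
  with v show "cls (vtx u) \<odot>\<^bsub>V\<^esub> path c = path c" "cls relator \<odot>\<^bsub>V\<^esub> path c = \<zero>\<^bsub>V\<^esub>"
    by (simp_all add: smult_V[OF cV])
  show "cls (vtx u) \<otimes>\<^bsub>L\<^esub> cls relator = cls relator" "cls relator \<otimes>\<^bsub>L\<^esub> cls (vtx u) = cls relator"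
    using vtx_relator relator_vtx by (simp_all add: L_mult cls_eq_iff)
  show "\<exists>a \<in> carrier L. y = a \<odot>\<^bsub>V\<^esub> path c" if y: "y \<in> carrier V" for y
    using generates[OF y] by (auto simp: smult_V[OF cV] L_carrier)
  show "\<exists>b \<in> carrier L. a \<otimes>\<^bsub>L\<^esub> cls (vtx u) = b \<otimes>\<^bsub>L\<^esub> cls relator"
    if a: "a \<in> carrier L" "a \<odot>\<^bsub>V\<^esub> path c = \<zero>\<^bsub>V\<^esub>" for a
  proof -
    obtain f where f: "f \<in> A0" "a = cls f" using a by (auto simp: L_carrier)
    then have "f * vtx u \<in> J"
      using annihilator[OF A0_subset[OF f(1)]] a by (simp add: smult_V[OF cV])
    then obtain b where b: "b \<in> A" "f * vtx u - b * relator \<in> I" by (auto simp: J_def)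
    \<comment> \<open>The polynomial \<open>b\<close> may have a constant term, and then its class
      need not lie in \<open>L\<close>. The product \<open>b * vtx u\<close> lies in
      \<open>A0\<close> and agrees with \<open>b\<close> modulo \<open>I\<close> after
      multiplication by \<open>relator\<close>.\<close>
    have "b * relator - b * (vtx u * relator) \<in> I"
      by (rule eqv_mult_left[OF eqv_sym[OF vtx_relator] b(1)])
    from eqv_trans[OF b(2) this] have "cls f \<otimes>\<^bsub>L\<^esub> cls (vtx u) = cls (b * vtx u) \<otimes>\<^bsub>L\<^esub> cls relator"
      using f b by (simp add: L_mult A0_subset A_mult cls_eq_iff mult.assoc)
    moreover have "cls (b * vtx u) \<in> carrier L" using b by (intro cls_in_L A0_mult) simp_all
    ultimately show ?thesis using f(2) by blast
  qed
  show "b \<otimes>\<^bsub>L\<^esub> cls (vtx u) = \<zero>\<^bsub>L\<^esub>" if b: "b \<in> carrier L" "b \<otimes>\<^bsub>L\<^esub> cls relator = \<zero>\<^bsub>L\<^esub>" for b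
  proof -
    obtain f where f: "f \<in> A0" "b = cls f" using b by (auto simp: L_carrier)
    then show ?thesis
      using b(2) relator_injective[of f] by (simp add: L_mult A0_subset cls_eq_zero_iff)
  qed
qed simp_all

text \<open>Off the support only \<open>t = 0\<close> is fixed by the vertex \<open>u\<close>, and
  zero is an image. What depends on the kind of module is isolated in \<open>witness\<close>: a
  \<open>t\<close> fixed by \<open>u\<close> that \<open>relator\<close> does not reach.\<close>

lemma Ext1_nontrivial_iff:
  assumes T: "left_module L T"
    and witness: "u \<in> vertex_support E T \<Longrightarrow>
      \<exists>t \<in> carrier T. cls (vtx u) \<odot>\<^bsub>T\<^esub> t = t \<and> (\<forall>s \<in> carrier T. cls relator \<odot>\<^bsub>T\<^esub> s \<noteq> t)"
  shows "carrier (Ext1 L V T) \<noteq> {\<one>\<^bsub>Ext1 L V T\<^esub>} \<longleftrightarrow> u \<in> vertex_support E T"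
proof (cases "u \<in> vertex_support E T")
  case True
  then show ?thesis using witness Ext1_trivial_iff[OF T] by metis
next
  case False
  interpret T: left_module L T by fact
  from False have zero: "cls (vtx u) \<odot>\<^bsub>T\<^esub> x = \<zero>\<^bsub>T\<^esub>" if "x \<in> carrier T" for x
    using that unfolding vertex_support_def by auto
  have "\<exists>s \<in> carrier T. cls relator \<odot>\<^bsub>T\<^esub> s = t" if "t \<in> carrier T" "cls (vtx u) \<odot>\<^bsub>T\<^esub> t = t" for t
    using zero[OF that(1)] that(2) by (intro bexI[of _ "\<zero>\<^bsub>T\<^esub>"]) simp_all
  then show ?thesis using Ext1_trivial_iff[OF T] False by blast
qed

text \<open>In both kinds of Chen modules the sum of the coefficients vanishes on the image of \<open>relator\<close>,
  but not on the paths starting at \<open>u\<close>.\<close>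

lemma Ext1_path_module:
  assumes "infinite_path E q" and T: "T = chen_path_module E q"
  shows "carrier (Ext1 L V T) \<noteq> {\<one>\<^bsub>Ext1 L V T\<^esub>} \<longleftrightarrow> u \<in> vertex_support E T"
proof -
  interpret T: chen_path E K q by unfold_locales fact
  show ?thesis
    unfolding T
  proof (rule Ext1_nontrivial_iff[OF T.left_module_V])
    assume "u \<in> vertex_support E T.V"
    then have "{cls (vtx u) \<odot>\<^bsub>T.V\<^esub> x | x. x \<in> carrier T.V} \<noteq> {0}"
      by (simp add: vertex_support_def)
    then obtain x where x: "x \<in> carrier T.V" "cls (vtx u) \<odot>\<^bsub>T.V\<^esub> x \<noteq> 0"
      using T.left_module_V
      by (smt (verit, ccfv_threshold) Collect_cong T.mem_V T.smult_V empty_subsetI keys_zero poly_rep_zero_right singleton_conv)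
    \<comment> \<open>If no path in \<open>x\<close> started at \<open>u\<close>, the vertex
      \<open>u\<close> would kill every term of \<open>x\<close>.\<close>
    have "\<exists>r \<in> Poly_Mapping.keys x. tail E (shd r) = u"
    proof (rule ccontr)
      assume "\<not> ?thesis"
      then have "linear_extension (gen_action E (Vertex u)) x = linear_extension (\<lambda>_. 0) x"
        by (intro linear_extension_cong) auto
      also have "\<dots> = 0" by (simp add: linear_extension_def)
      finally show False using x by (simp add: T.smult_V poly_rep_gen)
    qed
    then obtain r where r: "r \<in> tail_class E q" "tail E (shd r) = u"
      using x(1) by (auto simp: T.mem_V)
    then have rV: "path r \<in> carrier T.V" by (simp add: T.mem_V)
    have "cls relator \<odot>\<^bsub>T.V\<^esub> s \<noteq> path r" if "s \<in> carrier T.V" for s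
      using T.augmentation_path_difference[OF d_awalk(2), of s] that
      by (auto simp: T.smult_V T.mem_V relator_def)
    moreover have "cls (vtx u) \<odot>\<^bsub>T.V\<^esub> path r = path r"
      using r by (simp add: T.smult_V[OF rV] poly_rep_gen)
    ultimately show "\<exists>t \<in> carrier T.V. cls (vtx u) \<odot>\<^bsub>T.V\<^esub> t = t \<and>
        (\<forall>s \<in> carrier T.V. cls relator \<odot>\<^bsub>T.V\<^esub> s \<noteq> t)"
      using rV by blast
  qed
qed

end

section \<open>The Chen modules of sinks\<close>

text \<open>The finite paths ending in \<open>w\<close> are lists of edges. The empty list stands
  for the trivial path at \<open>w\<close>, hence the recurring case distinction for the source;
  ghost edges annihilate it.\<close>

fun sink_action ::
  "('v, 'e) pre_digraph \<Rightarrow> 'v \<Rightarrow> ('v, 'e) generator \<Rightarrow> 'e list \<Rightarrow> ('e list \<Rightarrow>\<^sub>0 'k::field)" where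
  "sink_action E w (Vertex v) q =
     (if v = (if q = [] then w else tail E (hd q)) then Poly_Mapping.single q 1 else 0)"
| "sink_action E w (Edge e) q =
     (if head E e = (if q = [] then w else tail E (hd q)) then Poly_Mapping.single (e # q) 1 else 0)"
| "sink_action E w (Ghost e) q =
     (if q \<noteq> [] \<and> e = hd q then Poly_Mapping.single (tl q) 1 else 0)"

locale chen_sink = leavitt_graph E K
  for E :: "('v, 'e) pre_digraph" and K :: "'k::field itself" +
  fixes w :: 'v
  assumes w: "is_sink E w"

text \<open>The trivial path has no first edge and falls under the second alternative of
  \<open>path_cases\<close>, which holds because \<open>w\<close> emits no edges.\<close>

sublocale chen_sink \<subseteq> path_space E K "{q. \<exists>u. awalk u q w}" "\<lambda>q. if q = [] then w else tail E (hd q)"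
  "(#)" "sink_action E w"
proof unfold_locales
  fix q assume "q \<in> {q. \<exists>u. awalk u q w}"
  then obtain u where u: "awalk u q w" by blast
  have w_in: "w \<in> verts E" and w_out: "out_arcs E w = {}" using w by (simp_all add: is_sink_def)
  have src: "u = (if q = [] then w else tail E (hd q))"
    using u by (cases q) (auto simp: awalk_def)
  show "(if q = [] then w else tail E (hd q)) \<in> verts E" using u src by (auto simp: awalk_def)
  show "e # q \<in> {q. \<exists>u. awalk u q w}" if "e \<in> arcs E" "head E e = (if q = [] then w else tail E (hd q))" for e
    using u that src by (auto simp: awalk_def)
  show "(\<exists>e\<in>arcs E. \<exists>q'\<in>{q. \<exists>u. awalk u q w}. head E e = (if q' = [] then w else tail E (hd q')) \<and> q = e # q') \<or>
      out_arcs E (if q = [] then w else tail E (hd q)) = {} \<and> (\<forall>e\<in>arcs E. sink_action E w (Ghost e) q = 0)"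
  proof (cases q)
    case Nil
    then show ?thesis using w_out by simp
  next
    case (Cons e q')
    then have e: "e \<in> arcs E" "cas (head E e) q' w" "set q' \<subseteq> arcs E"
      using u by (auto simp: awalk_def)
    then have "awalk (head E e) q' w" by (simp add: awalk_def)
    moreover have "head E e = (if q' = [] then w else tail E (hd q'))"
      using e by (cases q') auto
    ultimately show ?thesis using Cons e(1) by blast
  qed
qed auto

text \<open>The record is spelled out so that it coincides with \<open>chen_sink_module\<close> once
  that is unfolded.\<close>

lemma left_module_principal:
  fixes R :: "'r ring" (structure)
  assumes R: "ring R" and w: "w \<in> carrier R"
  shows "left_module R \<lparr>carrier = {a \<otimes>\<^bsub>R\<^esub> w | a. a \<in> carrier R}, mult = undefined, one = undefined,
    zero = \<zero>\<^bsub>R\<^esub>, add = add R, smult = mult R\<rparr>"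
proof -
  interpret ring R by fact
  define C where "C = {a \<otimes> w | a. a \<in> carrier R}"
  define M :: "('r, 'r) module" where
    "M = \<lparr>carrier = C, mult = undefined, one = undefined, zero = \<zero>, add = add R, smult = mult R\<rparr>"
  have M_simps [simp]: "carrier M = C" "zero M = \<zero>" "add M = add R" "smult M = mult R"
    by (simp_all add: M_def)
  have C [simp]: "x \<in> carrier R" if "x \<in> C" for x
    using that w by (auto simp: C_def)
  have add [simp]: "x \<oplus> y \<in> C" if "x \<in> C" "y \<in> C" for x y
  proof -
    obtain a b where "a \<in> carrier R" "b \<in> carrier R" "x = a \<otimes> w" "y = b \<otimes> w"
      using \<open>x \<in> C\<close> \<open>y \<in> C\<close> unfolding C_def by blast
    then have "x \<oplus> y = (a \<oplus> b) \<otimes> w" "a \<oplus> b \<in> carrier R"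
      using w by (simp_all add: l_distr)
    then show ?thesis unfolding C_def by blast
  qed
  have smult [simp]: "b \<otimes> x \<in> C" if "b \<in> carrier R" "x \<in> C" for b x
  proof -
    obtain a where "a \<in> carrier R" "x = a \<otimes> w" using \<open>x \<in> C\<close> unfolding C_def by blast
    then have "b \<otimes> x = (b \<otimes> a) \<otimes> w" "b \<otimes> a \<in> carrier R"
      using \<open>b \<in> carrier R\<close> w by (simp_all add: m_assoc)
    then show ?thesis unfolding C_def by blast
  qed
  have "abelian_group M"
  proof (rule abelian_groupI)
    show "\<zero>\<^bsub>M\<^esub> \<in> carrier M" unfolding C_def M_simps using w by (force intro!: exI[of _ \<zero>])
    fix x assume x: "x \<in> carrier M"
    then have "\<ominus> x \<in> C" using smult[of "\<ominus> \<one>" x] by (simp add: l_minus)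
    then show "\<exists>y\<in>carrier M. y \<oplus>\<^bsub>M\<^esub> x = \<zero>\<^bsub>M\<^esub>"
      using x by (intro bexI[of _ "\<ominus> x"]) (simp_all add: l_neg)
  qed (simp_all add: a_ac)
  moreover have "left_module_axioms R M"
    by (rule left_module_axioms.intro) (simp_all add: l_distr r_distr m_assoc)
  ultimately have "left_module R M" using R by (simp add: left_module_def)
  then show ?thesis unfolding M_def C_def .
qed

context chen_sink
begin

abbreviation T :: "(('v, 'e, 'k) lpa_element, ('v, 'e, 'k) lpa_element) module" where
  "T \<equiv> chen_sink_module E w"

lemma w_in_verts [simp]: "w \<in> verts E"
  using w by (simp add: is_sink_def)

lemma left_module_T: "left_module L T"
  unfolding chen_sink_module_def
  by (rule left_module_principal[OF ring_L]) (simp add: L_carrier)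

lemma mem_T: "x \<in> carrier T \<longleftrightarrow> (\<exists>f \<in> A0. x = cls (f * vtx w))"
proof -
  have "cls f \<otimes>\<^bsub>L\<^esub> cls (vtx w) = cls (f * vtx w)" if "f \<in> A0" for f
    using that by (simp add: L_mult A0_subset)
  then have "x \<in> carrier T \<longleftrightarrow> x \<in> (\<lambda>f. cls (f * vtx w)) ` A0"
    by (simp add: chen_sink_module_def L_carrier) (metis (no_types, lifting) image_iff)
  then show ?thesis by blast
qed

lemma T_simps [simp]: "smult T = mult L" "zero T = \<zero>\<^bsub>L\<^esub>"
  by (simp_all add: chen_sink_module_def)

lemma Nil_walk: "[] \<in> {q. \<exists>u. awalk u q w}"
  by (auto simp: awalk_def)

lemma walk_arcs: "q \<in> {q. \<exists>u. awalk u q w} \<Longrightarrow> set q \<subseteq> arcs E"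
  by (auto simp: awalk_def)

lemma source_idem:
  assumes q: "q \<in> {q. \<exists>u. awalk u q w}"
  shows "vtx (if q = [] then w else tail E (hd q)) * (epath q * vtx w) - epath q * vtx w \<in> I"
proof (cases "q = []")
  case True
  then show ?thesis using relation_V[of w w] by simp
next
  case False
  then show ?thesis
    using eqv_mult_right[OF vtx_epath[OF walk_arcs[OF q] False], of "vtx w"] by (simp add: mult.assoc)
qed

text \<open>Equivariance of \<open>q \<mapsto> epath q * vtx w\<close>, now modulo \<open>I\<close>
  itself, shows that the paths span \<open>Lw\<close>: coefficients for \<open>f * vtx w\<close> are
  read off from the action of \<open>f\<close> on the trivial path.\<close>

lemma mult_w_eq:
  assumes "f \<in> A"
  shows "f * vtx w - linear_extension (\<lambda>q. epath q * vtx w) (rep f (path [])) \<in> I"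
proof -
  have "f * linear_extension (\<lambda>q. epath q * vtx w) (path [])
      - linear_extension (\<lambda>q. epath q * vtx w) (rep f (path [])) \<in> I"
  proof (rule linear_extension_equivariant[OF left_ideal_mod_I _ source_idem _ assms])
    show "epath q * vtx w \<in> A" if "q \<in> {q. \<exists>u. awalk u q w}" for q
      using walk_arcs[OF that] by auto
  qed (use Nil_walk in \<open>simp_all add: epath_Cons mult.assoc\<close>)
  then show ?thesis by simp
qed

lemma foldr_Cons_Nil: "foldr (#) q [] = q"
  by (induction q) auto

text \<open>The counterpart of \<open>mult_w_eq\<close>: acting on the trivial path recovers
  \<open>q\<close>, and \<open>I\<close> acts as zero, so the classes of the paths are linearly
  independent in \<open>Lw\<close>.\<close>

lemma rep_walk:
  assumes q: "q \<in> {q. \<exists>u. awalk u q w}"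
  shows "rep (epath q * vtx w) (path []) = path q"
proof -
  obtain u where "awalk u q w" using q by blast
  then have "cas u q (if [] = ([] :: 'e list) then w else tail E (hd []))" "set q \<subseteq> arcs E"
    by (auto simp: awalk_def)
  from rep_epath[OF this Nil_walk] have "rep (epath q) (path []) = path q"
    using foldr_Cons_Nil[of q] by simp
  then show ?thesis by (simp add: poly_rep_mult poly_rep_gen)
qed

end

context simple_cycle
begin

lemma Ext1_sink_module:
  assumes "is_sink E w" and T: "T = chen_sink_module E w"
  shows "carrier (Ext1 L V T) \<noteq> {\<one>\<^bsub>Ext1 L V T\<^esub>} \<longleftrightarrow> u \<in> vertex_support E T"
proof -
  interpret T: chen_sink E K w by unfold_locales fact
  show ?thesis
    unfolding T
  proof (rule Ext1_nontrivial_iff[OF T.left_module_T])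
    let ?S = "{q. \<exists>u. awalk u q w}"
    assume "u \<in> vertex_support E T.T"
    then have "{cls (vtx u) \<odot>\<^bsub>T.T\<^esub> x | x. x \<in> carrier T.T} \<noteq> {\<zero>\<^bsub>L\<^esub>}"
      by (simp add: vertex_support_def)
    \<comment> \<open>A set other than the singleton of zero could still be empty; a member of the
      carrier rules this out.\<close>
    moreover have "\<exists>x. x \<in> carrier T.T"
      using A0_zero unfolding T.mem_T by blast
    ultimately obtain x where "x \<in> carrier T.T" "cls (vtx u) \<otimes>\<^bsub>L\<^esub> x \<noteq> \<zero>\<^bsub>L\<^esub>"
      by auto
    then obtain f where f: "f \<in> A0" and nz: "cls (vtx u) \<otimes>\<^bsub>L\<^esub> cls (f * vtx w) \<noteq> \<zero>\<^bsub>L\<^esub>"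
      unfolding T.mem_T by blast
    then have nI: "vtx u * f * vtx w \<notin> I"
      by (simp add: L_mult A0_subset A_mult cls_eq_zero_iff mult.assoc)
    have fA: "f \<in> A" by (rule A0_subset[OF f])
    define y where "y = T.rep f (T.path [])"
    have y: "Poly_Mapping.keys y \<subseteq> ?S"
      unfolding y_def by (rule T.keys_rep[OF fA]) (use T.Nil_walk in simp)
    \<comment> \<open>Otherwise \<open>mult_w_eq\<close> would put \<open>vtx u * f * vtx w\<close>
      into \<open>I\<close>.\<close>
    have "T.rep (vtx u * f) (T.path []) \<noteq> 0"
      using T.mult_w_eq[of "vtx u * f"] nI fA by (auto simp: A_mult)
    then have ne: "linear_extension (sink_action E w (Vertex u)) y \<noteq> 0"
      by (simp add: poly_rep_mult poly_rep_gen y_def)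
    have "\<exists>q \<in> Poly_Mapping.keys y. (if q = [] then w else tail E (hd q)) = u"
    proof (rule ccontr)
      assume "\<not> ?thesis"
      then have "linear_extension (sink_action E w (Vertex u)) y = linear_extension (\<lambda>_. 0) y"
        by (intro linear_extension_cong) auto
      also have "\<dots> = 0" by (simp add: linear_extension_def)
      finally show False using ne by simp
    qed
    then obtain q where q: "q \<in> ?S" "(if q = [] then w else tail E (hd q)) = u"
      using y by blast
    define t where "t = epath q * vtx w"
    have t: "t \<in> A0" unfolding t_def using T.walk_arcs[OF q(1)] by auto
    have "epath q * (vtx w * vtx w) - epath q * vtx w \<in> I"
      using relation_V[of w w] T.walk_arcs[OF q(1)] by (intro eqv_mult_left) auto
    then have "cls t = cls (t * vtx w)"
      by (simp add: t_def cls_eq_iff mult.assoc eqv_sym)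
    then have tT: "cls t \<in> carrier T.T" using t unfolding T.mem_T by blast
    have "vtx u * t - t \<in> I" using T.source_idem[OF q(1)] unfolding q(2) t_def .
    then have "cls (vtx u) \<odot>\<^bsub>T.T\<^esub> cls t = cls t"
      using t by (simp add: L_mult A0_subset cls_eq_iff)
    moreover have "cls relator \<odot>\<^bsub>T.T\<^esub> s \<noteq> cls t" if s: "s \<in> carrier T.T" for s
    proof
      assume eq: "cls relator \<odot>\<^bsub>T.T\<^esub> s = cls t"
      obtain g where g: "g \<in> A0" "s = cls (g * vtx w)" using s unfolding T.mem_T by blast
      then have "relator * (g * vtx w) - t \<in> I"
        using eq by (simp add: L_mult A0_subset A_mult cls_eq_iff)
      \<comment> \<open>Acting on the trivial path turns the congruence into an equation between
        combinations of paths, with coefficient sum 0 on the left and 1 on the right.\<close>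
      then have "T.rep (relator * (g * vtx w)) (T.path []) = T.rep t (T.path [])"
        by (rule T.rep_cong) (use T.Nil_walk in simp)
      also have "\<dots> = T.path q" unfolding t_def by (rule T.rep_walk[OF q(1)])
      finally have "T.rep relator (T.rep (g * vtx w) (T.path [])) = T.path q"
        by (simp add: poly_rep_mult)
      moreover have "Poly_Mapping.keys (T.rep (g * vtx w) (T.path [])) \<subseteq> ?S"
        by (rule T.keys_rep) (use g T.Nil_walk in \<open>auto simp: A0_subset\<close>)
      ultimately have "T.augmentation (T.path q) = 0"
        using T.augmentation_path_difference[OF d_awalk(2)] by (metis relator_def)
      then show False by simp
    qed
    ultimately show "\<exists>t \<in> carrier T.T. cls (vtx u) \<odot>\<^bsub>T.T\<^esub> t = t \<and>
        (\<forall>s \<in> carrier T.T. cls relator \<odot>\<^bsub>T.T\<^esub> s \<noteq> t)"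
      by (intro bexI[OF _ tT] conjI ballI)
  qed
qed

end

theorem theorem3p10:
  fixes E :: "('v, 'e) pre_digraph"
    and d :: "'e list"
    and L :: "('v, 'e, 'k::field) lpa_element ring"
    and V :: "(('v, 'e, 'k) lpa_element, 'e stream \<Rightarrow>\<^sub>0 'k) module"
  assumes "fin_digraph E"
    and "simple_closed_path E d"
    and "L = leavitt E"
    and "V = chen_path_module E (cycle d)"
  shows
    "(\<forall>p (T :: (('v, 'e, 'k) lpa_element, 'e stream \<Rightarrow>\<^sub>0 'k) module).
        infinite_path E p \<and> T = chen_path_module E p \<longrightarrow>
        (carrier (Ext1 L V T) \<noteq> {\<one>\<^bsub>Ext1 L V T\<^esub>} \<longleftrightarrow> path_source E d \<in> vertex_support E T)) \<and>
     (\<forall>w (T :: (('v, 'e, 'k) lpa_element, ('v, 'e, 'k) lpa_element) module).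
        is_sink E w \<and> T = chen_sink_module E w \<longrightarrow>
        (carrier (Ext1 L V T) \<noteq> {\<one>\<^bsub>Ext1 L V T\<^esub>} \<longleftrightarrow> path_source E d \<in> vertex_support E T))"
proof -
  interpret fin_digraph E by fact
  interpret simple_cycle E "TYPE('k)" d by unfold_locales fact
  show ?thesis
    unfolding assms(3,4)
  proof (intro conjI allI impI; elim conjE)
  qed (rule Ext1_path_module Ext1_sink_module; assumption)+
qed

end
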